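(* Let $\mathbf{X}_{t-n+1},\dots,\mathbf{X}_t,\mathbf X_{t+1}$ be conditionally independent given $(\boldsymbol\mu,\boldsymbol\Sigma)$ with common conditional distribution $\mathcal N_k(\boldsymbol\mu,\boldsymbol\Sigma)$, with $n>k$. Let the portfolio weights $\mathbf v_t\in\mathbb R^k$ and current wealth $W_t$ be given, and let $$W_{t+1}=W_t\left(1+r_{f,t+1}+\mathbf v_t^\top(\mathbf X_{t+1}-r_{f,t+1}\mathbf 1)\right).$$ Let $\widehat W_{t+1}$ denote a random variable whose distribution is the posterior predictive distribution of $W_{t+1}$ given $\mathbf x_{t,n}$. (a) Under the diffuse prior, $$\widehat W_{t+1}\stackrel{d}{=}W_t\Bigg(1+r_{f,t+1}+\mathbf v_t^\top(\overline{\mathbf x}_{t,d}-r_{f,t+1}\mathbf 1)+\sqrt{\mathbf v_t^\top\mathbf S_{t,d}\mathbf v_t}\left(\frac{t_1}{\sqrt{n(n-k)}}+\sqrt{1+\frac{t_1^2}{n-k}}\,\frac{t_2}{\sqrt{n-k+1}}\right)\Bigg),$$ where $t_1$ and $t_2$ are independent random variables with $t_1\sim t_{n-k}$ and $t_2\sim t_{n-k+1}$. (b) Under the conjugate prior, $$\widehat W_{t+1}\stackrel{d}{=}W_t\Bigg(1+r_{f,t+1}+\mathbf v_t^\top(\overline{\mathbf x}_{t,c}-r_{f,t+1}\mathbf 1)+\sqrt{\mathbf v_t^\top\mathbf S_{t,c}\mathbf v_t}\left(\frac{t_1}{\sqrt{(n+r_0)(n+d_0-2k)}}+\sqrt{1+\frac{t_1^2}{n+d_0-2k}}\,\frac{t_2}{\sqrt{n+d_0-2k+1}}\right)\Bigg),$$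 where $t_1$ and $t_2$ are independent random variables with $t_1\sim t_{n+d_0-2k}$ and $t_2\sim t_{n+d_0-2k+1}$.
   Context: Setting. $\boldsymbol\mu\in\mathbb R^k$ and the positive definite $k\times k$ matrix $\boldsymbol\Sigma$ are unknown parameters endowed with a prior $\pi(\boldsymbol\mu,\boldsymbol\Sigma)$; the posterior given the observation matrix $\mathbf x_{t,n}=(\mathbf x_{t-n+1},\dots,\mathbf x_t)$ (realizations of $\mathbf X_{t-n+1},\dots,\mathbf X_t$) is $\pi(\boldsymbol\mu,\boldsymbol\Sigma|\mathbf x_{t,n})\propto L(\mathbf x_{t,n}|\boldsymbol\mu,\boldsymbol\Sigma)\pi(\boldsymbol\mu,\boldsymbol\Sigma)$, with $L$ the normal likelihood. The posterior predictive density of the wealth is $f_{\widehat W_{t+1}}(w|\mathbf x_{t,n})=\int f_{\widehat W_{t+1}}(w|\boldsymbol\mu,\boldsymbol\Sigma,\mathbf x_{t,n})\,\pi(\boldsymbol\mu,\boldsymbol\Sigma|\mathbf x_{t,n})\,d\boldsymbol\mu\,d\boldsymbol\Sigma$, i.e. the conditional law of $W_{t+1}$ given the parameters averaged over the posterior. $r_{f,t+1}$ is the (known) return on the risk-free asset in period $t+1$ and $\mathbf 1$ is the $k$-vector of ones. Priors. Diffuse (Jeffreys) prior: $\pi(\boldsymbol\mu,\boldsymbol\Sigma)\propto|\boldsymbol\Sigma|^{-(k+1)/2}$. Conjugate prior: $\boldsymbol\mu|\boldsymbol\Sigma\sim\mathcal N_k(\mathbf m_0,\frac1{r_0}\boldsymbol\Sigma)$,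 $\boldsymbol\Sigma\sim\mathcal{IW}_k(d_0,\mathbf S_0)$ with hyperparameters $\mathbf m_0\in\mathbb R^k$, $r_0>0$, $d_0$, and $\mathbf S_0$ positive definite. Here $\mathcal{IW}_k(d,\mathbf S)$ (with $d>2k$) is the inverse Wishart distribution with density proportional to $|\boldsymbol\Sigma|^{-d/2}\exp(-\frac12\mathrm{tr}(\mathbf S\boldsymbol\Sigma^{-1}))$; equivalently $\boldsymbol\Sigma^{-1}$ is Wishart with $d-k-1$ degrees of freedom and scale matrix $\mathbf S^{-1}$. Data quantities. $\overline{\mathbf x}_t=\frac1n\sum_{i=t-n+1}^t\mathbf x_i$, $\mathbf S_t=\frac1{n-1}\sum_{i=t-n+1}^t(\mathbf x_i-\overline{\mathbf x}_t)(\mathbf x_i-\overline{\mathbf x}_t)^\top$; $\overline{\mathbf x}_{t,d}=\overline{\mathbf x}_t$, $\mathbf S_{t,d}=(n-1)\mathbf S_t$ (positive definite almost surely since $n>k$); $\overline{\mathbf x}_{t,c}=\frac{n\overline{\mathbf x}_t+r_0\mathbf m_0}{n+r_0}$, $\mathbf S_{t,c}=\mathbf S_{t,d}+\mathbf S_0+\frac{nr_0}{n+r_0}(\mathbf m_0-\overline{\mathbf x}_t)(\mathbf m_0-\overline{\mathbf x}_t)^\top$. Notation. $t_d$ denotes the standard univariate $t$-distribution with $d$ degrees of freedom; $\stackrel{d}{=}$ is equality in distribution (conditionally on the data). *)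

theory Defs
  imports "HOL-Probability.Probability"
begin

definition pos_def :: "real^'k^'k \<Rightarrow> bool" where
  "pos_def A \<longleftrightarrow> transpose A = A \<and> (\<forall>v. v \<noteq> 0 \<longrightarrow> 0 < v \<bullet> (A *v v))"

definition outer :: "real^'k \<Rightarrow> real^'k \<Rightarrow> real^'k^'k" where
  "outer a b = (\<chi> i j. a $ i * b $ j)"

text \<open>Lebesgue measure \<open>d\<Sigma>\<close> on symmetric matrices is Lebesgue measure in the
  \<open>k (k + 1) / 2\<close> functionally independent entries. These are indexed by the unordered pairs
  \<open>{i, j}\<close> (singletons give the diagonal), so that no order on the index type is needed.\<close>

definition sym_lborel :: "(real^'k^'k) measure" where
  "sym_lborel = distr (Pi\<^sub>M (range (\<lambda>(i, j). {i, j})) (\<lambda>_. lborel)) borel (\<lambda>f. \<chi> i j. f {i, j})"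

definition pd_measure :: "(real^'k^'k) measure" where
  "pd_measure = restrict_space sym_lborel {\<Sigma>. pos_def \<Sigma>}"

definition param_measure :: "((real^'k) \<times> (real^'k^'k)) measure" where
  "param_measure = lborel \<Otimes>\<^sub>M pd_measure"

definition mvn_density :: "real^'k \<Rightarrow> real^'k^'k \<Rightarrow> real^'k \<Rightarrow> real" where
  "mvn_density \<mu> \<Sigma> y =
     exp (- ((y - \<mu>) \<bullet> (matrix_inv \<Sigma> *v (y - \<mu>))) / 2) / sqrt ((2 * pi) ^ CARD('k) * det \<Sigma>)"

definition iw_kernel :: "real \<Rightarrow> real^'k^'k \<Rightarrow> real^'k^'k \<Rightarrow> real" where
  "iw_kernel d S \<Sigma> = det \<Sigma> powr (- d / 2) * exp (- trace (S ** matrix_inv \<Sigma>) / 2)"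

text \<open>In this parametrisation \<open>d > 2 k\<close> is required, and the inverse of the random matrix is Wishart
  with \<open>d - k - 1\<close> degrees of freedom.\<close>

definition iw_density :: "real \<Rightarrow> real^'k^'k \<Rightarrow> real^'k^'k \<Rightarrow> real" where
  "iw_density d S \<Sigma> = iw_kernel d S \<Sigma> / (LINT T|pd_measure. iw_kernel d S T)"

definition student_t_density :: "real \<Rightarrow> real \<Rightarrow> real" where
  "student_t_density d y =
     Gamma ((d + 1) / 2) / (sqrt (d * pi) * Gamma (d / 2)) * (1 + y\<^sup>2 / d) powr (- (d + 1) / 2)"

definition indep_student_t ::
  "'q measure \<Rightarrow> real \<Rightarrow> ('q \<Rightarrow> real) \<Rightarrow> real \<Rightarrow> ('q \<Rightarrow> real) \<Rightarrow> bool" where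
  "indep_student_t Q d1 t1 d2 t2 \<longleftrightarrow>
     prob_space Q \<and> prob_space.indep_var Q borel t1 borel t2 \<and>
     distributed Q lborel t1 (\<lambda>y. ennreal (student_t_density d1 y)) \<and>
     distributed Q lborel t2 (\<lambda>y. ennreal (student_t_density d2 y))"

definition window :: "int \<Rightarrow> nat \<Rightarrow> int set" where
  "window t n = {t - int n + 1..t}"

definition likelihood :: "int \<Rightarrow> nat \<Rightarrow> (int \<Rightarrow> real^'k) \<Rightarrow> real^'k \<Rightarrow> real^'k^'k \<Rightarrow> real" where
  "likelihood t n x \<mu> \<Sigma> = (\<Prod>i\<in>window t n. mvn_density \<mu> \<Sigma> (x i))"

text \<open>Priors are densities with respect to \<^const>\<open>param_measure\<close>, possibly improper and only
  specified up to a constant factor, which the normalisation in the posterior removes.\<close>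

definition diffuse_prior :: "real^'k \<Rightarrow> real^'k^'k \<Rightarrow> real" where
  "diffuse_prior \<mu> \<Sigma> = det \<Sigma> powr (- (real CARD('k) + 1) / 2)"

definition conjugate_prior ::
  "real^'k \<Rightarrow> real \<Rightarrow> real \<Rightarrow> real^'k^'k \<Rightarrow> real^'k \<Rightarrow> real^'k^'k \<Rightarrow> real" where
  "conjugate_prior m0 r0 d0 S0 \<mu> \<Sigma> = mvn_density m0 ((1 / r0) *\<^sub>R \<Sigma>) \<mu> * iw_density d0 S0 \<Sigma>"

definition posterior ::
  "(real^'k \<Rightarrow> real^'k^'k \<Rightarrow> real) \<Rightarrow> int \<Rightarrow> nat \<Rightarrow> (int \<Rightarrow> real^'k) \<Rightarrow>
   ((real^'k) \<times> (real^'k^'k)) measure" where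
  "posterior \<pi> t n x =
     (let g = (\<lambda>(\<mu>, \<Sigma>). ennreal (likelihood t n x \<mu> \<Sigma> * \<pi> \<mu> \<Sigma>))
      in density param_measure (\<lambda>\<theta>. g \<theta> / (\<integral>\<^sup>+ \<eta>. g \<eta> \<partial>param_measure)))"

text \<open>\<open>P \<mu> \<Sigma>\<close> is the conditional law of the whole model given the parameters and \<open>Y\<close> the quantity to
  be predicted. For \<open>Y\<close> a function of an observation that is conditionally independent of the data,
  \<open>distr (P \<mu> \<Sigma>) borel Y\<close> is the conditional law of \<open>Y\<close> given the parameters and the data. The Giry
  bind averages it over the posterior; working with laws rather than densities also covers a \<open>Y\<close>
  that is constant, as the wealth is for zero weights.\<close>

definition posterior_predictive ::
  "(real^'k \<Rightarrow> real^'k^'k \<Rightarrow> real) \<Rightarrow> int \<Rightarrow> nat \<Rightarrow> (int \<Rightarrow> real^'k) \<Rightarrow>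
   (real^'k \<Rightarrow> real^'k^'k \<Rightarrow> 'w measure) \<Rightarrow> ('w \<Rightarrow> real) \<Rightarrow> real measure" where
  "posterior_predictive \<pi> t n x P Y = posterior \<pi> t n x \<bind> (\<lambda>(\<mu>, \<Sigma>). distr (P \<mu> \<Sigma>) borel Y)"

definition sample_mean :: "int \<Rightarrow> nat \<Rightarrow> (int \<Rightarrow> real^'k) \<Rightarrow> real^'k" where
  "sample_mean t n x = (1 / real n) *\<^sub>R (\<Sum>i\<in>window t n. x i)"

definition sample_cov :: "int \<Rightarrow> nat \<Rightarrow> (int \<Rightarrow> real^'k) \<Rightarrow> real^'k^'k" where
  "sample_cov t n x = (1 / (real n - 1)) *\<^sub>R
     (\<Sum>i\<in>window t n. outer (x i - sample_mean t n x) (x i - sample_mean t n x))"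

definition mean_d :: "int \<Rightarrow> nat \<Rightarrow> (int \<Rightarrow> real^'k) \<Rightarrow> real^'k" where
  "mean_d t n x = sample_mean t n x"

definition S_d :: "int \<Rightarrow> nat \<Rightarrow> (int \<Rightarrow> real^'k) \<Rightarrow> real^'k^'k" where
  "S_d t n x = (real n - 1) *\<^sub>R sample_cov t n x"

definition mean_c :: "real^'k \<Rightarrow> real \<Rightarrow> int \<Rightarrow> nat \<Rightarrow> (int \<Rightarrow> real^'k) \<Rightarrow> real^'k" where
  "mean_c m0 r0 t n x = (1 / (real n + r0)) *\<^sub>R (real n *\<^sub>R sample_mean t n x + r0 *\<^sub>R m0)"

definition S_c ::
  "real^'k \<Rightarrow> real \<Rightarrow> real^'k^'k \<Rightarrow> int \<Rightarrow> nat \<Rightarrow> (int \<Rightarrow> real^'k) \<Rightarrow> real^'k^'k" where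
  "S_c m0 r0 S0 t n x = S_d t n x + S0 +
     (real n * r0 / (real n + r0)) *\<^sub>R outer (m0 - sample_mean t n x) (m0 - sample_mean t n x)"

end

theory Submission
  imports Defs
begin

text \<open>Both priors make the posterior a normal inverse Wishart law: its density is, up to a constant,
  the product of the density of \<open>N (m, \<Sigma> / r)\<close> at \<open>\<mu>\<close> and of \<^const>\<open>iw_kernel\<close> at \<open>\<Sigma>\<close>, with degree
  \<open>d = n + k\<close> for the diffuse and \<open>d = n + d0\<close> for the conjugate prior (lemmas \<open>diffuse_posterior_kernel\<close> and
  \<open>conjugate_posterior_kernel\<close>). The
  wealth depends on the next observation \<open>X\<close> only through \<open>v \<bullet> X\<close>. Given the parameters this
  is normal with mean \<open>a = v \<bullet> \<mu>\<close> and variance \<open>s = v \<bullet> (\<Sigma> *v v)\<close>, and \<open>a\<close> is itself normal with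
  variance \<open>s / r\<close> given \<open>\<Sigma>\<close>. So everything is reduced to real variables once the posterior law of
  \<open>s\<close> is known.

  This law is inverse gamma. For \<open>v\<close> a unit vector, \<open>s\<close> is a diagonal entry of \<open>\<Sigma>\<close>, that is, the first
  pivot of a Cholesky elimination. In the coordinates of the elimination -- pivot, pivot column
  divided by the pivot, Schur complement -- the determinant is multiplicative and the trace in the
  inverse Wishart kernel is a function of the pivot plus a function of the other coordinates. Hence
  the pivot splits off as a factor with an explicit density (lemma \<open>nn_integral_pd_kernel_pivot\<close>),
  while the other coordinates contribute a constant. A general \<open>v\<close> is reduced to a unit vector by a
  congruence (\<open>inverse_wishart_form_law\<close>). The change to these coordinates is a composition
  of shears, which only rescale and translate some coordinates by amounts that depend on the others,
  so that one-dimensional substitutions suffice (\<open>nn_integral_shear\<close>).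

  As the posterior is normalised, it remains to show that this constant is positive
  and finite. For a scale matrix that is a multiple of the identity this follows by induction
  on the dimension from the same elimination: each step yields an inverse gamma and a Gaussian
  integral (\<open>nn_integral_pd_kernel_scalar\<close>). Every other scale matrix is compared with such a
  multiple.

  The last step is to average the normal laws over \<open>a\<close> and \<open>s\<close>. Integrating first over \<open>s\<close> leaves the
  power \<open>- (\<nu> / 2 + 1)\<close> of \<open>q + r (a - v \<bullet> m)\<^sup>2 + (z - a)\<^sup>2\<close>, where \<open>\<nu> = d - 2 k\<close> and
  \<open>q = v \<bullet> (S *v v)\<close>. Substituting \<open>t1\<close> for \<open>a\<close> and then \<open>t2\<close> for \<open>z\<close>
  turns this into the product of the two \<open>t\<close>-densities (\<open>normal_inverse_gamma_predictive\<close>).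

  Almost sure definiteness of the scatter matrix is a separate matter: \<open>k\<close> differences
  of observations are linearly independent almost surely, as each new one avoids a given hyperplane
  (\<open>AE_pos_def_S_d\<close>).\<close>


section \<open>Positive definite matrices and one step of Cholesky elimination\<close>

lemma matrix_inv_right_eq:
  fixes A B :: "real^'k^'k"
  assumes "A ** B = mat 1"
  shows "matrix_inv A = B"
proof -
  have BA: "B ** A = mat 1"
    using assms matrix_left_right_inverse by blast
  have "A ** matrix_inv A = mat 1 \<and> matrix_inv A ** A = mat 1"
    unfolding matrix_inv_def by (rule someI[of _ B]) (use assms BA in auto)
  then show ?thesis
    by (metis BA matrix_mul_assoc matrix_mul_lid matrix_mul_rid)
qed

lemma matrix_inv_inverse:
  fixes A :: "real^'k^'k"
  assumes "invertible A"
  shows "A ** matrix_inv A = mat 1" "matrix_inv A ** A = mat 1"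
proof -
  obtain B where "A ** B = mat 1" using assms invertible_def by blast
  then show "A ** matrix_inv A = mat 1" using matrix_inv_right_eq by blast
  then show "matrix_inv A ** A = mat 1" using matrix_left_right_inverse by blast
qed

lemma matrix_inv_mult:
  fixes A B :: "real^'k^'k"
  assumes "invertible A" "invertible B"
  shows "matrix_inv (A ** B) = matrix_inv B ** matrix_inv A"
proof (rule matrix_inv_right_eq)
  have "A ** B ** (matrix_inv B ** matrix_inv A) = A ** (B ** matrix_inv B) ** matrix_inv A"
    by (simp add: matrix_mul_assoc)
  then show "A ** B ** (matrix_inv B ** matrix_inv A) = mat 1"
    using assms by (simp add: matrix_inv_inverse)
qed

lemma matrix_inv_transpose:
  fixes A :: "real^'k^'k"
  assumes "invertible A"
  shows "matrix_inv (transpose A) = transpose (matrix_inv A)"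
  by (rule matrix_inv_right_eq) (metis assms matrix_inv_inverse(2) matrix_transpose_mul transpose_mat)

lemma inner_matrix_vector_transpose:
  fixes A :: "real^'k^'k"
  shows "x \<bullet> (A *v y) = (transpose A *v x) \<bullet> y"
  by (metis dot_lmul_matrix transpose_matrix_vector)

lemma outer_mult_vector: "outer a b *v x = (b \<bullet> x) *\<^sub>R a"
  by (simp add: vec_eq_iff outer_def matrix_vector_mult_def inner_vec_def sum_distrib_left
      sum_distrib_right mult_ac)

lemma matrix_mult_outer: "A ** outer a b = outer (A *v a) b"
  and outer_mult_matrix: "outer a b ** A = outer a (transpose A *v b)"
  for A :: "real^'k^'k"
  by (simp_all add: vec_eq_iff outer_def matrix_vector_mult_def transpose_def
      matrix_matrix_mult_def sum_distrib_left sum_distrib_right mult_ac del: transpose_matrix_vector)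

lemma trace_mult_eq: "trace (A ** B) = (\<Sum>i\<in>UNIV. \<Sum>j\<in>UNIV. A$i$j * B$j$i)"
  for A B :: "real^'k^'k"
  by (simp add: trace_def matrix_matrix_mult_def)

lemma trace_outer_mult:
  fixes N :: "real^'k^'k"
  shows "trace (outer a b ** N) = b \<bullet> (N *v a)"
  unfolding trace_mult_eq outer_def inner_vec_def matrix_vector_mult_def
  by (subst sum.swap) (simp add: sum_distrib_left mult_ac)

lemma trace_mult_linear:
  fixes A B C :: "real^'k^'k"
  shows "trace ((A + B) ** C) = trace (A ** C) + trace (B ** C)"
    "trace (C ** (A + B)) = trace (C ** A) + trace (C ** B)"
    "trace ((c *\<^sub>R A) ** C) = c * trace (A ** C)"
    "trace (C ** (c *\<^sub>R A)) = c * trace (C ** A)"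
    "trace ((A - B) ** C) = trace (A ** C) - trace (B ** C)"
  by (simp_all add: trace_mult_eq sum.distrib sum_distrib_left algebra_simps sum_subtractf)

lemma pos_def_sym: "pos_def A \<Longrightarrow> transpose A = A"
  and pos_def_pos: "pos_def A \<Longrightarrow> x \<noteq> 0 \<Longrightarrow> 0 < x \<bullet> (A *v x)"
  by (auto simp: pos_def_def)

lemma pos_def_nonneg: "pos_def A \<Longrightarrow> 0 \<le> x \<bullet> (A *v x)"
  by (cases "x = 0") (auto simp: pos_def_def less_imp_le)

lemma invertible_if_no_kernel:
  fixes A :: "real^'k^'k"
  assumes "\<And>x. A *v x = 0 \<Longrightarrow> x = 0"
  shows "invertible A"
  using assms by (simp add: invertible_left_inverse matrix_left_invertible_ker)

lemma pos_def_invertible: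
  assumes "pos_def A" shows "invertible A"
  by (rule invertible_if_no_kernel) (metis assms inner_zero_right less_irrefl pos_def_pos)

lemma pos_def_mat_1: "pos_def (mat 1)"
  by (simp add: pos_def_def)

text \<open>The segment from \<open>A\<close> to the identity stays positive definite, so \<^const>\<open>det\<close> has no zero on it
  and keeps the sign that it has at the identity.\<close>

lemma pos_def_det_pos:
  assumes A: "pos_def (A :: real^'k^'k)"
  shows "0 < det A"
proof (rule ccontr)
  assume "\<not> 0 < det A"
  define f where "f = (\<lambda>t::real. det (t *\<^sub>R A + (1 - t) *\<^sub>R mat 1))"
  have "continuous_on {0..1} f"
    unfolding f_def det_def
    by (intro continuous_intros continuous_on_component)
  moreover have "f 1 \<le> 0" "0 \<le> f 0"
    using \<open>\<not> 0 < det A\<close> by (simp_all add: f_def)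
  ultimately obtain t where t: "0 \<le> t" "t \<le> 1" "f t = 0"
    using IVT2'[of f 1 0 0] by auto
  have "invertible (t *\<^sub>R A + (1 - t) *\<^sub>R mat 1)"
  proof (rule invertible_if_no_kernel, rule ccontr)
    fix x assume "(t *\<^sub>R A + (1 - t) *\<^sub>R mat 1) *v x = 0" and x: "x \<noteq> 0"
    then have "x \<bullet> ((t *\<^sub>R A + (1 - t) *\<^sub>R mat 1) *v x) = 0" by simp
    then have "t * (x \<bullet> (A *v x)) + (1 - t) * (x \<bullet> x) = 0"
      by (simp add: matrix_vector_mult_add_rdistrib inner_right_distrib
          flip: scaleR_matrix_vector_assoc)
    moreover have "0 \<le> t * (x \<bullet> (A *v x))" "0 \<le> (1 - t) * (x \<bullet> x)"
      using t A by (simp_all add: pos_def_nonneg)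
    ultimately have "t * (x \<bullet> (A *v x)) = 0" "(1 - t) * (x \<bullet> x) = 0" by linarith+
    then show False using pos_def_pos[OF A x] x by auto
  qed
  then show False using t(3) by (simp add: f_def invertible_det_nz)
qed

lemma pos_def_congruence:
  fixes A B :: "real^'k^'k"
  assumes B: "invertible B"
  shows "pos_def (B ** A ** transpose B) \<longleftrightarrow> pos_def A"
proof -
  have *: "pos_def (B ** A ** transpose B)" if A: "pos_def A" and B: "invertible B"
    for A B :: "real^'k^'k"
    unfolding pos_def_def
  proof (intro conjI allI impI)
    show "transpose (B ** A ** transpose B) = B ** A ** transpose B"
      using pos_def_sym[OF A] by (simp add: matrix_transpose_mul matrix_mul_assoc)
    fix x :: "real^'k" assume x: "x \<noteq> 0"
    have "transpose B *v x \<noteq> 0"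
      using x B transpose_invertible[OF B] inj_matrix_vector_mult[of "transpose B"]
      by (metis injD matrix_vector_mult_0_right)
    then show "0 < x \<bullet> (B ** A ** transpose B *v x)"
      using pos_def_pos[OF A]
      by (metis inner_matrix_vector_transpose matrix_vector_mul_assoc)
  qed
  let ?C = "matrix_inv B"
  have C: "invertible ?C" using matrix_inv_inverse[OF B] invertible_def by blast
  have "?C ** (B ** A ** transpose B) ** transpose ?C
      = (?C ** B) ** A ** transpose (?C ** B)"
    by (simp add: matrix_transpose_mul matrix_mul_assoc)
  then have "?C ** (B ** A ** transpose B) ** transpose ?C = A"
    by (simp add: matrix_inv_inverse[OF B])
  then show ?thesis using *[OF _ B] *[OF _ C] by metis
qed

lemma trace_congruence_inv:
  fixes S B D :: "real^'k^'k"
  assumes B: "invertible B" and D: "invertible D"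
  shows "trace (S ** matrix_inv (B ** D ** transpose B))
       = trace (matrix_inv B ** S ** transpose (matrix_inv B) ** matrix_inv D)"
proof -
  have "matrix_inv (B ** D ** transpose B)
      = transpose (matrix_inv B) ** (matrix_inv D ** matrix_inv B)"
    using B D by (simp add: matrix_inv_mult invertible_mult transpose_invertible matrix_inv_transpose)
  then have "trace (S ** matrix_inv (B ** D ** transpose B))
      = trace ((S ** transpose (matrix_inv B) ** matrix_inv D) ** matrix_inv B)"
    by (simp add: matrix_mul_assoc)
  also have "\<dots> = trace (matrix_inv B ** (S ** transpose (matrix_inv B) ** matrix_inv D))"
    by (rule trace_mul_sym)
  finally show ?thesis by (simp add: matrix_mul_assoc)
qed

text \<open>Dimensions are types, so a block of a matrix on a subset of the coordinates is represented by
  the full matrix that is bordered by the identity, that is, which splits off the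
  other coordinates. For such a matrix \<open>pivot i s\<close> replaces the unit at \<open>i\<close> by \<open>s\<close>, and
  \<open>elim_mat\<close> is the unipotent factor of an elimination step.\<close>

definition elim_mat :: "'k \<Rightarrow> real^'k \<Rightarrow> real^'k^'k" where
  "elim_mat i b = mat 1 + outer b (axis i 1)"

definition pivot :: "'k \<Rightarrow> real \<Rightarrow> real^'k^'k \<Rightarrow> real^'k^'k" where
  "pivot i s A = A + (s - 1) *\<^sub>R outer (axis i 1) (axis i 1)"

definition splits_off :: "'k \<Rightarrow> real^'k^'k \<Rightarrow> bool" where
  "splits_off i A \<longleftrightarrow> (\<forall>j. A$i$j = (if i = j then 1 else 0) \<and> A$j$i = (if i = j then 1 else 0))"

lemma elim_mat_mult: "elim_mat i b *v x = x + (x$i) *\<^sub>R b"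
  by (simp add: elim_mat_def matrix_vector_mult_add_rdistrib outer_mult_vector inner_axis')

lemma elim_mat_inverse:
  assumes "b$i = 0"
  shows "elim_mat i b ** elim_mat i (-b) = mat 1"
  using assms by (simp add: matrix_eq elim_mat_mult flip: matrix_vector_mul_assoc)

lemma invertible_elim_mat: "b$i = 0 \<Longrightarrow> invertible (elim_mat i b)"
  using elim_mat_inverse invertible_right_inverse by blast

lemma matrix_inv_elim_mat: "b$i = 0 \<Longrightarrow> matrix_inv (elim_mat i b) = elim_mat i (-b)"
  by (rule matrix_inv_right_eq[OF elim_mat_inverse])

lemma det_elim_mat:
  fixes b :: "real^'k"
  assumes b: "b$i = 0"
  shows "det (elim_mat i b) = 1"
proof -
  have row: "row j (mat 1) = axis j (1::real)" for j :: 'k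
    by (auto simp: row_def mat_def axis_def vec_eq_iff)
  have eq: "transpose (elim_mat i b) = (\<chi> k. if k = i then row i (mat 1) + b else row k (mat 1))"
    by (auto simp: vec_eq_iff transpose_def elim_mat_def outer_def row_def mat_def axis_def)
  have "b = (\<Sum>j\<in>UNIV - {i}. b$j *s axis j 1)"
  proof -
    have "b = (\<Sum>j\<in>UNIV. b$j *s axis j 1)" by (simp add: basis_expansion)
    then show ?thesis by (subst (asm) sum.remove[of _ i]) (auto simp: b)
  qed
  moreover have "(\<Sum>j\<in>UNIV - {i}. b$j *s axis j 1) \<in> vec.span {row j (mat 1) |j. j \<noteq> i}"
    by (intro vec.span_sum vec.span_scale vec.span_base) (auto simp: row)
  ultimately have "b \<in> vec.span {row j (mat 1) |j. j \<noteq> i}" by simp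
  then have "det (transpose (elim_mat i b)) = det (mat 1 :: real^'k^'k)"
    unfolding eq by (rule det_row_span)
  then show ?thesis by simp
qed

lemma splits_off_mult: "splits_off i A \<Longrightarrow> A *v axis i 1 = axis i (1::real)"
  unfolding matrix_vector_mult_basis
  by (auto simp: splits_off_def vec_eq_iff axis_def column_def)

lemma splits_off_row: "splits_off i A \<Longrightarrow> A$i = axis i (1::real)"
  by (auto simp: splits_off_def vec_eq_iff axis_def)

lemma splits_off_component: "splits_off i A \<Longrightarrow> (A *v x)$i = (x$i :: real)"
  by (simp add: matrix_vector_mul_component splits_off_row inner_axis')

lemma splits_off_matrix_inv:
  fixes A :: "real^'k^'k"
  assumes A: "splits_off i A" "invertible A"
  shows "splits_off i (matrix_inv A)"
proof -
  have "matrix_inv A *v axis i 1 = axis i 1"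
    by (metis A matrix_inv_inverse(2) matrix_vector_mul_assoc matrix_vector_mul_lid splits_off_mult)
  then have 1: "matrix_inv A $ j $ i = (if i = j then 1 else 0)" for j
    unfolding matrix_vector_mult_basis by (auto simp: vec_eq_iff column_def axis_def)
  have "(matrix_inv A *v axis j 1)$i = (A *v (matrix_inv A *v axis j 1))$i" for j
    using A by (simp add: splits_off_component)
  then have "(matrix_inv A *v axis j 1)$i = axis j 1 $ i" for j
    using A by (simp add: matrix_inv_inverse matrix_vector_mul_assoc)
  then have 2: "matrix_inv A $ i $ j = (if i = j then 1 else 0)" for j
    unfolding matrix_vector_mult_basis by (auto simp: column_def axis_def)
  show ?thesis using 1 2 by (simp add: splits_off_def)
qed

lemma pivot_mult: "pivot i s A *v x = A *v x + ((s - 1) * x$i) *\<^sub>R axis i 1"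
  by (simp add: pivot_def matrix_vector_mult_add_rdistrib outer_mult_vector inner_axis'
      flip: scaleR_matrix_vector_assoc)

lemma pivot_inverse:
  assumes A: "splits_off i A" "invertible A" and s: "s \<noteq> 0"
  shows "pivot i s A ** pivot i (1/s) (matrix_inv A) = mat 1"
proof -
  have "pivot i s A *v (pivot i (1/s) (matrix_inv A) *v x) = x" for x
  proof -
    have *: "(matrix_inv A *v x)$i = x$i"
      using splits_off_component[OF splits_off_matrix_inv[OF A]] .
    have "pivot i s A *v (pivot i (1/s) (matrix_inv A) *v x)
      = x + ((1/s - 1) * x$i) *\<^sub>R axis i 1 + ((s-1) * (x$i + (1/s - 1) * x$i)) *\<^sub>R axis i 1"
    proof -
      have "A *v (matrix_inv A *v x + ((1/s - 1) * x$i) *\<^sub>R axis i 1)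
          = x + ((1/s - 1) * x$i) *\<^sub>R axis i 1"
        using A by (simp add: matrix_vector_right_distrib matrix_vector_mult_scaleR splits_off_mult
            matrix_vector_mul_assoc matrix_inv_inverse)
      then show ?thesis by (simp add: pivot_mult * del: right_diff_distrib)
    qed
    also have "\<dots> = x + ((1/s - 1) * x$i + (s-1) * (x$i + (1/s - 1) * x$i)) *\<^sub>R axis i 1"
      by (simp add: scaleR_left_distrib)
    also have "(1/s - 1) * x$i + (s-1) * (x$i + (1/s - 1) * x$i) = 0"
      using s by (simp add: field_simps)
    finally show ?thesis by simp
  qed
  then show ?thesis by (simp add: matrix_eq flip: matrix_vector_mul_assoc)
qed

lemma matrix_inv_pivot:
  "splits_off i A \<Longrightarrow> invertible A \<Longrightarrow> s \<noteq> 0 \<Longrightarrow> matrix_inv (pivot i s A) = pivot i (1/s) (matrix_inv A)"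
  by (rule matrix_inv_right_eq[OF pivot_inverse])

lemma invertible_pivot: "splits_off i A \<Longrightarrow> invertible A \<Longrightarrow> s \<noteq> 0 \<Longrightarrow> invertible (pivot i s A)"
  using pivot_inverse invertible_right_inverse by blast

lemma det_pivot:
  fixes A :: "real^'k^'k"
  assumes A: "splits_off i A"
  shows "det (pivot i s A) = s * det A"
proof -
  have 1: "pivot i s A = (\<chi> p. if p = i then s *s axis i 1 else A$p)"
    using A by (auto simp: vec_eq_iff pivot_def splits_off_def outer_def axis_def)
  have 2: "A = (\<chi> p. if p = i then axis i 1 else A$p)"
    using A by (auto simp: vec_eq_iff splits_off_def axis_def)
  show ?thesis unfolding 1 det_row_mul using 2 by simp
qed

lemma pos_def_pivot:
  fixes A :: "real^'k^'k"
  assumes A: "splits_off i A"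
  shows "pos_def (pivot i s A) \<longleftrightarrow> 0 < s \<and> pos_def A"
proof -
  have q: "x \<bullet> (pivot i s A *v x) = x \<bullet> (A *v x) + (s - 1) * (x$i)\<^sup>2" for s x
    by (simp add: pivot_mult inner_right_distrib inner_axis power2_eq_square)
  have tr: "transpose (pivot i s A) = transpose A + (s - 1) *\<^sub>R outer (axis i 1) (axis i 1)"
    by (auto simp: pivot_def transpose_def vec_eq_iff outer_def)
  then have sym: "transpose (pivot i s A) = pivot i s A \<longleftrightarrow> transpose A = A"
    by (simp add: pivot_def)
  \<comment> \<open>the vector \<open>x\<close> without its \<open>i\<close>-th entry; there the form of \<open>A\<close> is that of the rest block\<close>
  have dec: "x \<bullet> (A *v x) = y \<bullet> (A *v y) + (x$i)\<^sup>2"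
    if "y = x - x$i *\<^sub>R axis i 1" for x y
  proof -
    have x: "x = y + x$i *\<^sub>R axis i 1" using that by simp
    have yi: "y$i = 0" using that by simp
    have "A *v x = A *v (y + x$i *\<^sub>R axis i 1)" using x by simp
    then have Ay: "A *v x = A *v y + x$i *\<^sub>R axis i 1"
      using A by (simp add: matrix_vector_right_distrib matrix_vector_mult_scaleR splits_off_mult)
    have "(A *v y)$i = 0" using yi A by (simp add: splits_off_component)
    have "x \<bullet> (A *v x) = (y + x$i *\<^sub>R axis i 1) \<bullet> (A *v y + x$i *\<^sub>R axis i 1)"
      using x Ay by simp
    also have "\<dots> = y \<bullet> (A *v y) + (x$i)\<^sup>2"
      using yi \<open>(A *v y)$i = 0\<close>
      by (simp add: inner_add_left inner_add_right inner_axis inner_axis' power2_eq_square)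
    finally show ?thesis .
  qed
  show ?thesis
  proof
    assume L: "pos_def (pivot i s A)"
    have "0 < axis i 1 \<bullet> (pivot i s A *v axis i 1)"
      by (rule pos_def_pos[OF L]) (simp add: axis_eq_0_iff)
    then have s: "0 < s"
      using A by (simp add: q splits_off_mult inner_axis_axis)
    have "0 < x \<bullet> (A *v x)" if x: "x \<noteq> 0" for x
    proof -
      define y where "y = x - x$i *\<^sub>R axis i 1"
      have yi: "y$i = 0" by (simp add: y_def)
      have e: "y \<bullet> (pivot i s A *v y) = y \<bullet> (A *v y)"
        unfolding q yi by simp
      have nn: "0 \<le> y \<bullet> (A *v y)"
        using pos_def_nonneg[OF L, of y] unfolding e .
      have pp: "0 < y \<bullet> (A *v y)" if "y \<noteq> 0"
        using pos_def_pos[OF L that] unfolding e .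
      have "y \<noteq> 0" if "x$i = 0" using x that by (simp add: y_def)
      then have "0 < y \<bullet> (A *v y) \<or> 0 < (x$i)\<^sup>2"
        using pp by fastforce
      then show ?thesis unfolding dec[OF y_def]
        using nn zero_le_power2[of "x$i"] by linarith
    qed
    then show "0 < s \<and> pos_def A" using s L sym by (simp add: pos_def_def)
  next
    assume R: "0 < s \<and> pos_def A"
    have "0 < x \<bullet> (pivot i s A *v x)" if x: "x \<noteq> 0" for x
    proof -
      define y where "y = x - x$i *\<^sub>R axis i 1"
      have "x \<bullet> (pivot i s A *v x) = y \<bullet> (A *v y) + s * (x$i)\<^sup>2"
        unfolding q dec[OF y_def] by (simp add: algebra_simps)
      moreover have "0 \<le> y \<bullet> (A *v y)" "0 \<le> s * (x$i)\<^sup>2"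
        using R by (simp_all add: pos_def_nonneg)
      moreover have "y \<noteq> 0" if "x$i = 0" using x that by (simp add: y_def)
      then have "0 < y \<bullet> (A *v y) \<or> 0 < s * (x$i)\<^sup>2"
        using R pos_def_pos by fastforce
      ultimately show ?thesis by linarith
    qed
    then show "pos_def (pivot i s A)" using R sym by (simp add: pos_def_def)
  qed
qed

lemma matrix_add_mult: "(A + B) ** C = A ** C + B ** (C :: real^'k^'k)"
  and matrix_mult_add: "C ** (A + B) = C ** A + C ** (B :: real^'k^'k)"
  by (simp_all add: vec_eq_iff matrix_matrix_mult_def algebra_simps sum.distrib)

text \<open>One elimination step undone. For symmetric \<open>A\<close> with \<open>b\<^sub>i = 0\<close> this is the symmetric matrix with
  pivot \<open>s\<close>, pivot column \<open>s (e\<^sub>i + b)\<close> and Schur complement \<open>A\<close>.\<close>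

definition unelim :: "'k \<Rightarrow> real \<Rightarrow> real^'k \<Rightarrow> real^'k^'k \<Rightarrow> real^'k^'k" where
  "unelim i s b A = elim_mat i b ** pivot i s A ** transpose (elim_mat i b)"

lemma unelim_component:
  fixes A :: "real^'k^'k"
  assumes A: "splits_off i A" and b: "b$i = 0"
  shows "unelim i s b A $ p $ q =
    (if p = i then (if q = i then s else s * b$q)
     else if q = i then s * b$p else A$p$q + s * b$p * b$q)"
proof -
  have L: "(elim_mat i b ** X)$p$q = X$p$q + b$p * X$i$q" for X :: "real^'k^'k" and p q
    by (simp add: elim_mat_def matrix_add_mult outer_mult_matrix matrix_vector_mult_basis
        del: transpose_matrix_vector)
      (simp add: outer_def column_def row_def transpose_def)
  have R: "(X ** transpose (elim_mat i b))$p$q = X$p$q + X$p$i * b$q" for X :: "real^'k^'k" and p q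
  proof -
    have t: "transpose (elim_mat i b) = mat 1 + outer (axis i 1) b"
      by (auto simp: vec_eq_iff elim_mat_def transpose_def outer_def mat_def)
    show ?thesis
      by (simp add: t matrix_mult_add matrix_mult_outer matrix_vector_mult_basis)
        (simp add: outer_def column_def)
  qed
  have P: "pivot i s A $ p $ q = (if p = i \<and> q = i then s else A$p$q)" for p q
    using A by (auto simp: pivot_def outer_def axis_def splits_off_def)
  show ?thesis
    unfolding unelim_def R L P using A b by (auto simp: splits_off_def)
qed

lemma pos_def_unelim:
  "splits_off i A \<Longrightarrow> b$i = 0 \<Longrightarrow> pos_def (unelim i s b A) \<longleftrightarrow> 0 < s \<and> pos_def A"
  by (simp add: unelim_def pos_def_congruence invertible_elim_mat pos_def_pivot)

lemma det_unelim: "splits_off i A \<Longrightarrow> b$i = 0 \<Longrightarrow> det (unelim i s b A) = s * det A"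
  by (simp add: unelim_def det_mul det_elim_mat det_pivot)

lemma quad_inv_unelim:
  fixes A :: "real^'k^'k"
  assumes A: "splits_off i A" "invertible A" and b: "b$i = 0" and s: "s \<noteq> 0"
  shows "x \<bullet> (matrix_inv (unelim i s b A) *v x) =
    (x$i)\<^sup>2 / s + (let y = x - x$i *\<^sub>R b in y \<bullet> (matrix_inv A *v y) - (x$i)\<^sup>2)"
proof -
  let ?y = "x - x$i *\<^sub>R b"
  have "matrix_inv (unelim i s b A)
      = transpose (elim_mat i (-b)) ** (pivot i (1/s) (matrix_inv A) ** elim_mat i (-b))"
    unfolding unelim_def using A b s
    by (simp add: matrix_inv_mult invertible_mult transpose_invertible invertible_elim_mat
        invertible_pivot matrix_inv_transpose matrix_inv_elim_mat matrix_inv_pivot)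
  then have "x \<bullet> (matrix_inv (unelim i s b A) *v x)
      = ?y \<bullet> (pivot i (1/s) (matrix_inv A) *v ?y)"
    by (simp add: inner_matrix_vector_transpose elim_mat_mult del: transpose_matrix_vector
        flip: matrix_vector_mul_assoc)
  also have "\<dots> = (x$i)\<^sup>2 / s + (?y \<bullet> (matrix_inv A *v ?y) - (x$i)\<^sup>2)"
    using b by (simp add: pivot_mult inner_right_distrib inner_axis power2_eq_square algebra_simps)
  finally show ?thesis by (simp add: Let_def)
qed

lemma trace_inv_unelim:
  fixes A :: "real^'k^'k"
  assumes A: "splits_off i A" "invertible A" and b: "b$i = 0" and s: "s \<noteq> 0"
  shows "trace (S ** matrix_inv (unelim i s b A)) =
    S$i$i / s + (trace (elim_mat i (-b) ** S ** transpose (elim_mat i (-b)) ** matrix_inv A) - S$i$i)"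
proof -
  let ?R = "elim_mat i (-b) ** S ** transpose (elim_mat i (-b))"
  have "trace (S ** matrix_inv (unelim i s b A)) = trace (?R ** pivot i (1/s) (matrix_inv A))"
    unfolding unelim_def using A b s
    by (simp add: trace_congruence_inv invertible_elim_mat invertible_pivot matrix_inv_elim_mat
        matrix_inv_pivot)
  also have "\<dots> = trace (?R ** matrix_inv A)
      + (1/s - 1) * trace (outer (axis i 1) (axis i 1) ** ?R)"
    unfolding pivot_def trace_mult_linear
    using trace_mul_sym[of ?R "outer (axis i 1) (axis i 1)"] by simp
  also have "trace (outer (axis i 1) (axis i 1) ** ?R) = S$i$i"
  proof -
    have "transpose (elim_mat i (-b)) *v axis i 1 = axis i 1"
      unfolding matrix_vector_mult_basis
      using b by (auto simp: vec_eq_iff column_def transpose_def elim_mat_def outer_def axis_def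
          mat_def)
    then have "axis i 1 \<bullet> (?R *v axis i 1) = axis i 1 \<bullet> (S *v axis i 1)"
      by (metis inner_matrix_vector_transpose matrix_vector_mul_assoc)
    then show ?thesis
      by (simp add: trace_outer_mult matrix_vector_mult_basis inner_axis' column_def)
  qed
  finally show ?thesis by (simp add: algebra_simps)
qed


text \<open>The elimination step itself: the Schur complement at \<open>i\<close> splits off one coordinate more than \<open>A\<close>.
  This is the induction step for statements about positive definite matrices, with the set \<open>J\<close>
  of the coordinates that are left in the role of the dimension.\<close>

lemma pos_def_eliminate:
  fixes A :: "real^'k^'k"
  assumes "pos_def A" "\<And>j. j \<notin> insert i J \<Longrightarrow> splits_off j A"
  obtains s b A' where "0 < s" "b$i = 0" "splits_off i A'" "A = unelim i s b A'" "pos_def A'"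
    "\<And>j. j \<notin> J \<Longrightarrow> splits_off j A'" "\<And>j. j \<notin> J \<Longrightarrow> b$j = 0"
proof -
  define s where "s = A$i$i"
  define b :: "real^'k" where "b = (\<chi> j. if j = i then 0 else A$j$i / s)"
  define A' :: "real^'k^'k" where
    "A' = (\<chi> p q. if p = i \<or> q = i then (if p = q then 1 else 0) else A$p$q - s * b$p * b$q)"
  have sym: "A$p$q = A$q$p" for p q
    using pos_def_sym[OF assms(1)] by (metis transpose_def vec_lambda_beta)
  have "0 < axis i 1 \<bullet> (A *v axis i 1)"
    by (rule pos_def_pos[OF assms(1)]) (simp add: axis_eq_0_iff)
  then have s: "0 < s" by (simp add: s_def matrix_vector_mult_basis column_def inner_axis')
  have bi: "b$i = 0" by (simp add: b_def)
  have A'i: "splits_off i A'" by (auto simp: splits_off_def A'_def)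
  have A: "A = unelim i s b A'"
    unfolding vec_eq_iff unelim_component[OF A'i bi] using s by (auto simp: A'_def b_def s_def sym)
  have pd: "pos_def A'" using assms(1) A pos_def_unelim[OF A'i bi] by simp
  have A'j: "splits_off j A'" if "j \<notin> J" for j
  proof (cases "j = i")
    case False
    with that assms(2) have "splits_off j A" by auto
    then show ?thesis using False by (auto simp: splits_off_def A'_def b_def)
  qed (use A'i in simp)
  have bj: "b$j = 0" if "j \<notin> J" for j
    using assms(2)[of j] that by (auto simp: b_def splits_off_def)
  show ?thesis using s bi A'i A pd A'j bj by (rule that)
qed

lemma splits_off_all_imp_mat_1: "(\<And>i. splits_off i A) \<Longrightarrow> A = (mat 1 :: real^'k^'k)"
  by (simp add: splits_off_def vec_eq_iff mat_def)

lemma pos_def_imp_square: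
  fixes A :: "real^'k^'k"
  assumes "pos_def A"
  obtains R :: "real^'k^'k" where "A = R ** transpose R"
proof -
  have "\<exists>R :: real^'k^'k. A = R ** transpose R" if "pos_def A" "\<And>i. i \<notin> J \<Longrightarrow> splits_off i A" for A :: "real^'k^'k" and J
    using finite[of J] that
  proof (induction J arbitrary: A rule: finite_induct)
    case empty
    then have "A = mat 1" by (intro splits_off_all_imp_mat_1) auto
    then have "A = mat 1 ** transpose (mat 1)" by simp
    then show ?case by blast
  next
    case (insert i J)
    obtain s b A' where s: "0 < s" and A'i: "splits_off i A'"
      and A: "A = unelim i s b A'" and pd: "pos_def A'"
      and A'j: "\<And>j. j \<notin> J \<Longrightarrow> splits_off j A'"
      using pos_def_eliminate[OF insert.prems(1,2)] by blast
    obtain R :: "real^'k^'k" where R: "A' = R ** transpose R" using insert.IH[OF pd A'j] by blast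
    let ?e = "axis i 1 :: real^'k"
    define E where "E = pivot i (sqrt s) (mat 1 :: real^'k^'k)"
    have tE: "transpose E = E"
      by (auto simp: E_def pivot_def vec_eq_iff transpose_def outer_def mat_def)
    have A'e: "(A' *v x)$i = x$i" "A' *v ?e = ?e" for x
      using A'i by (simp_all add: splits_off_component splits_off_mult)
    have "E *v (A' *v (E *v x)) = pivot i s A' *v x" for x
    proof -
      have "A' *v (E *v x) = A' *v x + ((sqrt s - 1) * x$i) *\<^sub>R ?e"
        by (simp add: E_def pivot_mult matrix_vector_right_distrib matrix_vector_mult_scaleR A'e)
      then have "E *v (A' *v (E *v x)) = (A' *v x + ((sqrt s - 1) * x$i) *\<^sub>R ?e) +
          ((sqrt s - 1) * (A' *v x + ((sqrt s - 1) * x$i) *\<^sub>R ?e)$i) *\<^sub>R ?e"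
        by (simp only:) (simp add: E_def pivot_mult)
      also have "\<dots>
        = A' *v x + (((sqrt s - 1) + (sqrt s - 1) * (1 + (sqrt s - 1))) * x$i) *\<^sub>R ?e"
        by (simp add: A'e) (simp add: algebra_simps)
      also have "(sqrt s - 1) + (sqrt s - 1) * (1 + (sqrt s - 1)) = s - 1"
        using s by (simp add: algebra_simps)
      finally show ?thesis by (simp add: pivot_mult)
    qed
    then have EE: "pivot i s A' = E ** A' ** E"
      by (simp add: matrix_eq flip: matrix_vector_mul_assoc)
    have "A = (elim_mat i b ** E ** R) ** transpose (elim_mat i b ** E ** R)"
      unfolding A unelim_def EE by (simp add: R matrix_transpose_mul tE matrix_mul_assoc)
    then show ?case by blast
  qed
  from this[OF assms, of UNIV] show ?thesis using that by auto
qed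

text \<open>Writing \<^term>\<open>N = R ** transpose R\<close> turns the trace of \<open>S N\<close> into a sum of values of the form of \<open>S\<close>.\<close>

lemma trace_mult_mono:
  fixes S N :: "real^'k^'k"
  assumes S: "\<And>x. \<epsilon> * (x \<bullet> x) \<le> x \<bullet> (S *v x)" and N: "pos_def N"
  shows "\<epsilon> * trace N \<le> trace (S ** N)"
proof -
  obtain R :: "real^'k^'k" where R: "N = R ** transpose R" using pos_def_imp_square[OF N] .
  have tr: "trace (T ** N) = (\<Sum>j\<in>UNIV. column j R \<bullet> (T *v column j R))" for T :: "real^'k^'k"
  proof -
    have "trace (T ** N) = trace (transpose R ** (T ** R))"
      unfolding R by (metis matrix_mul_assoc trace_mul_sym)
    also have "\<dots> = (\<Sum>j\<in>UNIV. column j R \<bullet> (T *v column j R))"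
      unfolding trace_def
      by (intro sum.cong refl)
        (simp add: matrix_matrix_mult_def inner_vec_def matrix_vector_mult_def transpose_def column_def)
    finally show ?thesis .
  qed
  have "\<epsilon> * trace N = (\<Sum>j\<in>UNIV. \<epsilon> * (column j R \<bullet> column j R))"
    using tr[of "mat 1"] by (simp add: sum_distrib_left)
  also have "\<dots> \<le> trace (S ** N)" unfolding tr by (intro sum_mono S)
  finally show ?thesis .
qed

lemma pos_def_matrix_inv:
  fixes A :: "real^'k^'k"
  assumes A: "pos_def A"
  shows "pos_def (matrix_inv A)"
proof -
  note inv = pos_def_invertible[OF A]
  have "invertible (matrix_inv A)" using matrix_inv_inverse[OF inv] invertible_def by blast
  moreover have tr: "transpose (matrix_inv A) = matrix_inv A"
    using matrix_inv_transpose[OF inv] unfolding pos_def_sym[OF A] by (rule sym)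
  moreover have "matrix_inv A ** A ** transpose (matrix_inv A) = matrix_inv A"
    by (simp only: tr matrix_inv_inverse[OF inv] matrix_mul_lid)
  ultimately show ?thesis using pos_def_congruence[of "matrix_inv A" A] A by metis
qed


section \<open>Measurability of matrix-valued expressions\<close>

lemma borel_measurable_vec_lambda [measurable (raw)]:
  fixes f :: "'a \<Rightarrow> 'k::finite \<Rightarrow> 'b::euclidean_space"
  assumes [measurable]: "\<And>i. (\<lambda>x. f x i) \<in> borel_measurable M"
  shows "(\<lambda>x. \<chi> i. f x i) \<in> borel_measurable M"
  by (rule borel_measurable_euclidean_space[THEN iffD2]) (auto simp: Basis_vec_def inner_axis)

lemma borel_measurable_vec_nth [measurable (raw)]:
  fixes f :: "'a \<Rightarrow> 'b::euclidean_space ^ 'k"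
  assumes "f \<in> borel_measurable M"
  shows "(\<lambda>x. f x $ i) \<in> borel_measurable M"
proof -
  have "(\<lambda>v :: 'b^'k. v $ i) \<in> borel_measurable borel"
    by (intro borel_measurable_continuous_onI continuous_intros)
  then show ?thesis using assms by measurable
qed

lemma borel_measurable_det [measurable (raw)]:
  fixes f :: "'a \<Rightarrow> real^'k^'k"
  assumes [measurable]: "f \<in> borel_measurable M"
  shows "(\<lambda>x. det (f x)) \<in> borel_measurable M"
  unfolding det_def by measurable

lemma borel_measurable_matrix_vector_mult [measurable (raw)]:
  fixes f :: "'a \<Rightarrow> real^'k^'k"
  assumes [measurable]: "f \<in> borel_measurable M" "g \<in> borel_measurable M"
  shows "(\<lambda>x. f x *v g x) \<in> borel_measurable M"
  unfolding matrix_vector_mult_def by measurable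

lemma borel_measurable_matrix_matrix_mult [measurable (raw)]:
  fixes f :: "'a \<Rightarrow> real^'k^'k"
  assumes [measurable]: "f \<in> borel_measurable M" "g \<in> borel_measurable M"
  shows "(\<lambda>x. f x ** g x) \<in> borel_measurable M"
  unfolding matrix_matrix_mult_def by measurable

lemma borel_measurable_transpose [measurable (raw)]:
  fixes f :: "'a \<Rightarrow> real^'k^'k"
  assumes [measurable]: "f \<in> borel_measurable M"
  shows "(\<lambda>x. transpose (f x)) \<in> borel_measurable M"
  unfolding transpose_def by measurable

lemma borel_measurable_trace [measurable (raw)]:
  fixes f :: "'a \<Rightarrow> real^'k^'k"
  assumes [measurable]: "f \<in> borel_measurable M"
  shows "(\<lambda>x. trace (f x)) \<in> borel_measurable M"
  unfolding trace_def by measurable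

text \<open>Cramer's rule makes the inverse a rational function of the entries; on singular matrices
  \<^const>\<open>matrix_inv\<close> is one fixed, unspecified matrix.\<close>

lemma borel_measurable_matrix_inv [measurable (raw)]:
  fixes f :: "'a \<Rightarrow> real^'k^'k"
  assumes [measurable]: "f \<in> borel_measurable M"
  shows "(\<lambda>x. matrix_inv (f x)) \<in> borel_measurable M"
proof -
  define cof where "cof A = (\<chi> k l. det (\<chi> i j. if j = k then axis l 1 $ i else A$i$j) / det A)"
    for A :: "real^'k^'k"
  have reg: "matrix_inv A = cof A" if "det A \<noteq> 0" for A :: "real^'k^'k"
  proof -
    have inv: "invertible A" using that by (simp add: invertible_det_nz)
    have "matrix_inv A $ k $ l = cof A $ k $ l" for k l
    proof -
      have "A *v (matrix_inv A *v axis l 1) = axis l 1"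
        by (simp add: matrix_vector_mul_assoc matrix_inv_inverse[OF inv] del: matrix_vector_mult_basis)
      then have "matrix_inv A *v axis l 1 =
          (\<chi> k. det (\<chi> i j. if j = k then axis l 1 $ i else A$i$j) / det A)"
        unfolding cramer[OF that] .
      then show ?thesis
        by (simp add: matrix_vector_mult_basis column_def cof_def vec_eq_iff)
    qed
    then show ?thesis by (simp add: vec_eq_iff)
  qed
  have sing: "matrix_inv A = matrix_inv 0" if "det A = 0" for A :: "real^'k^'k"
  proof -
    have "\<not> invertible A" "\<not> invertible (0 :: real^'k^'k)"
      using that by (simp_all add: invertible_det_nz det_0[unfolded mat_0])
    then show ?thesis unfolding matrix_inv_def invertible_def by metis
  qed
  have "(\<lambda>x. if det (f x) = 0 then matrix_inv 0 else cof (f x)) \<in> borel_measurable M"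
    unfolding cof_def by measurable
  then show ?thesis
    by (rule measurable_cong[THEN iffD1, rotated]) (use reg sing in auto)
qed

text \<open>By compactness of the unit sphere a positive definite form is bounded away from 0 there. So
  positive definiteness is a countable union of closed conditions.\<close>

lemma pos_def_iff_bounded_below:
  "pos_def A \<longleftrightarrow> transpose A = A \<and> (\<exists>n::nat. \<forall>x. (1 / real (Suc n)) * (x \<bullet> x) \<le> x \<bullet> (A *v x))"
proof safe
  assume A: "pos_def A"
  show "transpose A = A" using A by (simp add: pos_def_def)
  have ne: "sphere 0 1 \<noteq> ({} :: (real^'a) set)" by simp
  have "continuous_on (sphere 0 1) (\<lambda>x. x \<bullet> (A *v x))"
    by (intro continuous_intros)
  from continuous_attains_inf[OF compact_sphere ne this]
  obtain z where z: "norm z = 1" "\<And>y. norm y = 1 \<Longrightarrow> z \<bullet> (A *v z) \<le> y \<bullet> (A *v y)"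
    by auto
  have "0 < z \<bullet> (A *v z)" using z(1) by (intro pos_def_pos[OF A]) auto
  then obtain n where n: "1 / real (Suc n) < z \<bullet> (A *v z)"
    using nat_approx_posE by blast
  have "(1 / real (Suc n)) * (x \<bullet> x) \<le> x \<bullet> (A *v x)" for x
  proof (cases "x = 0")
    case False
    have "1 / real (Suc n) \<le> (x /\<^sub>R norm x) \<bullet> (A *v (x /\<^sub>R norm x))"
      using n z(2)[of "x /\<^sub>R norm x"] False by simp
    also have "\<dots> = (x \<bullet> (A *v x)) / (norm x)\<^sup>2"
      by (simp add: matrix_vector_mult_scaleR power2_eq_square divide_simps)
    finally have "(1 / real (Suc n)) * (norm x)\<^sup>2 \<le> x \<bullet> (A *v x)"
      using False by (simp add: pos_le_divide_eq)
    then show ?thesis by (simp add: power2_norm_eq_inner)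
  qed simp
  then show "\<exists>n::nat. \<forall>x. (1 / real (Suc n)) * (x \<bullet> x) \<le> x \<bullet> (A *v x)" by blast
next
  fix n assume A: "transpose A = A" "\<forall>x. (1 / real (Suc n)) * (x \<bullet> x) \<le> x \<bullet> (A *v x)"
  have "0 < x \<bullet> (A *v x)" if "x \<noteq> 0" for x
  proof -
    have "0 < (1 / real (Suc n)) * (x \<bullet> x)" using that by simp
    then show ?thesis using A(2) by (meson less_le_trans)
  qed
  then show "pos_def A" using A(1) by (simp add: pos_def_def)
qed

lemma pos_def_borel [measurable]: "Measurable.pred borel (pos_def :: real^'k^'k \<Rightarrow> bool)"
proof -
  have "closed {A :: real^'k^'k. transpose A = A}"
    unfolding transpose_def by (intro closed_Collect_eq continuous_intros)
  moreover have "closed {A :: real^'k^'k. \<forall>x. (1 / real (Suc n)) * (x \<bullet> x) \<le> x \<bullet> (A *v x)}" for n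
    unfolding matrix_vector_mult_def
    by (intro closed_Collect_all closed_Collect_le continuous_intros)
  moreover have "{A. pos_def A} = {A :: real^'k^'k. transpose A = A} \<inter>
      (\<Union>n. {A. \<forall>x. (1 / real (Suc n)) * (x \<bullet> x) \<le> x \<bullet> (A *v x)})"
    by (auto simp: pos_def_iff_bounded_below)
  ultimately have "{A :: real^'k^'k. pos_def A} \<in> sets borel"
    by (simp add: borel_closed sets.Int sets.countable_UN)
  then show ?thesis by (simp add: pred_def)
qed

lemma borel_measurable_mvn_density [measurable (raw)]:
  fixes f :: "'a \<Rightarrow> real^'k"
  assumes [measurable]: "f \<in> borel_measurable M" "g \<in> borel_measurable M" "h \<in> borel_measurable M"
  shows "(\<lambda>x. mvn_density (f x) (g x) (h x)) \<in> borel_measurable M"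
  unfolding mvn_density_def by measurable

lemma borel_measurable_iw_kernel [measurable (raw)]:
  fixes f :: "'a \<Rightarrow> real^'k^'k"
  assumes [measurable]: "f \<in> borel_measurable M"
  shows "(\<lambda>x. iw_kernel d S (f x)) \<in> borel_measurable M"
  unfolding iw_kernel_def by measurable


section \<open>Shears of product Lebesgue measure\<close>

abbreviation lborel_on :: "'i set \<Rightarrow> ('i \<Rightarrow> real) measure" where
  "lborel_on I \<equiv> Pi\<^sub>M I (\<lambda>_. lborel)"

interpretation lborel_prod: product_sigma_finite "\<lambda>_. lborel :: real measure"
  by standard

lemma nn_integral_affine_coordinate:
  fixes a t :: "('i \<Rightarrow> real) \<Rightarrow> real"
  assumes I: "finite I" "p \<in> I"
    and [measurable]: "F \<in> borel_measurable (lborel_on I)"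
      "a \<in> borel_measurable (lborel_on I)" "t \<in> borel_measurable (lborel_on I)"
    and upd: "\<And>f y. a (f(p := y)) = a f" "\<And>f y. t (f(p := y)) = t f"
    and nz: "\<And>f. a f \<noteq> 0"
  shows "(\<integral>\<^sup>+f. F (f(p := a f * f p + t f)) * ennreal \<bar>a f\<bar> \<partial>lborel_on I) = (\<integral>\<^sup>+f. F f \<partial>lborel_on I)"
proof -
  define J where "J = I - {p}"
  have J: "I = insert p J" "finite J" "p \<notin> J" using I by (auto simp: J_def)
  have F': "F \<in> borel_measurable (lborel_on (insert p J))" using assms(3) J(1) by simp
  have [measurable]: "(\<lambda>f. f(p := a f * f p + t f)) \<in> lborel_on I \<rightarrow>\<^sub>M lborel_on I"
  proof (rule measurable_PiM_single')
    fix i assume "i \<in> I"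
    then show "(\<lambda>f. (f(p := a f * f p + t f)) i) \<in> lborel_on I \<rightarrow>\<^sub>M lborel"
      using \<open>p \<in> I\<close> by (cases "i = p") simp_all
  next
    show "(\<lambda>f. f(p := a f * f p + t f)) \<in> space (lborel_on I) \<rightarrow> (\<Pi>\<^sub>E i\<in>I. space lborel)"
      using I by (auto simp: space_PiM PiE_iff extensional_def)
  qed
  have "(\<integral>\<^sup>+f. F (f(p := a f * f p + t f)) * ennreal \<bar>a f\<bar> \<partial>lborel_on I)
      = (\<integral>\<^sup>+x. \<integral>\<^sup>+y. F (x(p := a x * y + t x)) * ennreal \<bar>a x\<bar> \<partial>lborel \<partial>lborel_on J)"
    unfolding J(1) by (subst lborel_prod.product_nn_integral_insert) (use J in \<open>auto simp: upd simp flip: J(1)\<close>)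
  also have "\<dots> = (\<integral>\<^sup>+x. \<integral>\<^sup>+y. F (x(p := y)) \<partial>lborel \<partial>lborel_on J)"
  proof (rule nn_integral_cong)
    fix x assume x: "x \<in> space (lborel_on J)"
    have "(\<lambda>y. F (x(p := y))) \<in> borel_measurable lborel"
      by (rule measurable_compose[OF measurable_component_update F', OF x J(3)])
    then have m [measurable]: "(\<lambda>y. F (x(p := y))) \<in> borel_measurable borel"
      by (simp only: measurable_lborel1 measurable_lborel2)
    have "(\<lambda>y. F (x(p := t x + a x * y))) \<in> borel_measurable borel"
      by (rule measurable_compose[OF _ m, of "\<lambda>y. t x + a x * y" borel]) simp
    then have ma: "(\<lambda>y. F (x(p := t x + a x * y))) \<in> borel_measurable lborel"
      by (simp only: measurable_lborel1 measurable_lborel2)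
    have "(\<integral>\<^sup>+y. F (x(p := y)) \<partial>lborel) = ennreal \<bar>a x\<bar> * (\<integral>\<^sup>+y. F (x(p := t x + a x * y)) \<partial>lborel)"
      by (rule nn_integral_real_affine) (simp_all add: nz)
    then show "(\<integral>\<^sup>+y. F (x(p := a x * y + t x)) * ennreal \<bar>a x\<bar> \<partial>lborel) = (\<integral>\<^sup>+y. F (x(p := y)) \<partial>lborel)"
      using nn_integral_multc[OF ma, of "ennreal \<bar>a x\<bar>"] by (simp add: mult.commute add.commute)
  qed
  also have "\<dots> = (\<integral>\<^sup>+f. F f \<partial>lborel_on I)"
    unfolding J(1) by (subst lborel_prod.product_nn_integral_insert) (use J in \<open>auto simp flip: J(1)\<close>)
  finally show ?thesis .
qed

lemma measurable_shear:
  fixes a t :: "'i \<Rightarrow> ('i \<Rightarrow> real) \<Rightarrow> real"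
  assumes "K \<subseteq> I"
    and [measurable]: "\<And>q. q \<in> K \<Longrightarrow> a q \<in> borel_measurable (lborel_on I)"
      "\<And>q. q \<in> K \<Longrightarrow> t q \<in> borel_measurable (lborel_on I)"
  shows "(\<lambda>f q. if q \<in> K then a q f * f q + t q f else f q) \<in> lborel_on I \<rightarrow>\<^sub>M lborel_on I"
proof (rule measurable_PiM_single')
  fix i assume "i \<in> I"
  then show "(\<lambda>f. if i \<in> K then a i f * f i + t i f else f i) \<in> lborel_on I \<rightarrow>\<^sub>M lborel"
    by (cases "i \<in> K") simp_all
next
  show "(\<lambda>f q. if q \<in> K then a q f * f q + t q f else f q) \<in> space (lborel_on I) \<rightarrow> (\<Pi>\<^sub>E i\<in>I. space lborel)"
    using assms by (auto simp: space_PiM PiE_iff extensional_def)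
qed

text \<open>The Jacobian matrix of such a map is triangular, as the coefficients of the coordinates in \<open>K\<close>
  depend on the coordinates outside \<open>K\<close> only. So those in \<open>K\<close> can be substituted one after the other.\<close>

lemma nn_integral_shear:
  fixes a t :: "'i \<Rightarrow> ('i \<Rightarrow> real) \<Rightarrow> real"
  assumes I: "finite I" "K \<subseteq> I"
    and F: "F \<in> borel_measurable (lborel_on I)"
    and at: "\<And>q. q \<in> K \<Longrightarrow> a q \<in> borel_measurable (lborel_on I)"
      "\<And>q. q \<in> K \<Longrightarrow> t q \<in> borel_measurable (lborel_on I)"
    and upd: "\<And>q p f y. q \<in> K \<Longrightarrow> p \<in> K \<Longrightarrow> a q (f(p := y)) = a q f"
      "\<And>q p f y. q \<in> K \<Longrightarrow> p \<in> K \<Longrightarrow> t q (f(p := y)) = t q f"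
    and nz: "\<And>q f. q \<in> K \<Longrightarrow> a q f \<noteq> 0"
  shows "(\<integral>\<^sup>+f. F (\<lambda>q. if q \<in> K then a q f * f q + t q f else f q) * (\<Prod>q\<in>K. ennreal \<bar>a q f\<bar>) \<partial>lborel_on I)
    = (\<integral>\<^sup>+f. F f \<partial>lborel_on I)"
proof -
  have "finite K" using I finite_subset by blast
  then show ?thesis using I at upd nz
  proof (induction K rule: finite_induct)
    case empty
    then show ?case by simp
  next
    case (insert p K)
    define T where "T f = (\<lambda>q. if q \<in> K then a q f * f q + t q f else f q)" for f
    define G where "G f = F (T f) * (\<Prod>q\<in>K. ennreal \<bar>a q f\<bar>)" for f
    note [measurable] = F insert.prems(3,4)
    have [measurable]: "T \<in> lborel_on I \<rightarrow>\<^sub>M lborel_on I"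
      unfolding T_def by (rule measurable_shear) (use insert.prems in auto)
    have "(\<integral>\<^sup>+f. G f \<partial>lborel_on I) = (\<integral>\<^sup>+f. F f \<partial>lborel_on I)"
      unfolding G_def T_def using insert.prems by (intro insert.IH) auto
    moreover have "(\<integral>\<^sup>+f. G (f(p := a p f * f p + t p f)) * ennreal \<bar>a p f\<bar> \<partial>lborel_on I)
      = (\<integral>\<^sup>+f. G f \<partial>lborel_on I)"
    proof (rule nn_integral_affine_coordinate)
      show "G \<in> borel_measurable (lborel_on I)" unfolding G_def by measurable
      show "a p (f(p := y)) = a p f" "t p (f(p := y)) = t p f" for f y
        by (rule insert.prems(5,6); simp)+
    qed (use insert.prems in auto)
    moreover have "G (f(p := a p f * f p + t p f)) * ennreal \<bar>a p f\<bar> =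
      F (\<lambda>q. if q \<in> insert p K then a q f * f q + t q f else f q) * (\<Prod>q\<in>insert p K. ennreal \<bar>a q f\<bar>)" for f
    proof -
      let ?f = "f(p := a p f * f p + t p f)"
      have u: "a q ?f = a q f" "t q ?f = t q f" if "q \<in> K" for q
        by (rule insert.prems(5,6); use that in simp)+
      have "T ?f = (\<lambda>q. if q \<in> insert p K then a q f * f q + t q f else f q)"
        using insert.hyps by (auto simp: T_def u fun_eq_iff)
      moreover have "(\<Prod>q\<in>K. ennreal \<bar>a q ?f\<bar>) = (\<Prod>q\<in>K. ennreal \<bar>a q f\<bar>)"
        by (intro prod.cong) (simp_all add: u)
      ultimately show ?thesis using insert.hyps by (simp add: G_def mult_ac)
    qed
    ultimately show ?case by simp
  qed
qed


section \<open>The Gaussian integral by elimination\<close>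

lemma nn_integral_gaussian:
  assumes "0 < s"
  shows "(\<integral>\<^sup>+x. ennreal (exp (- x\<^sup>2 / (2 * s))) \<partial>lborel) = ennreal (sqrt (2 * pi * s))"
proof -
  have "1 = emeasure (density lborel (normal_density 0 (sqrt s))) (space lborel)"
    using prob_space.emeasure_space_1[OF prob_space_normal_density[of "sqrt s" 0]] assms by simp
  also have "\<dots> = (\<integral>\<^sup>+x. ennreal (normal_density 0 (sqrt s) x) \<partial>lborel)"
    by (simp add: emeasure_density)
  also have "\<dots> = (\<integral>\<^sup>+x. ennreal (1 / sqrt (2 * pi * s)) * ennreal (exp (- x\<^sup>2 / (2 * s))) \<partial>lborel)"
  proof (rule nn_integral_cong)
    fix x
    have "normal_density 0 (sqrt s) x = 1 / sqrt (2 * pi * s) * exp (- x\<^sup>2 / (2 * s))"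
      using assms by (simp add: normal_density_def)
    then show "ennreal (normal_density 0 (sqrt s) x)
        = ennreal (1 / sqrt (2 * pi * s)) * ennreal (exp (- x\<^sup>2 / (2 * s)))"
      by (metis ennreal_mult'' exp_ge_zero)
  qed
  also have "\<dots> = ennreal (1 / sqrt (2 * pi * s)) * (\<integral>\<^sup>+x. ennreal (exp (- x\<^sup>2 / (2 * s))) \<partial>lborel)"
    by (rule nn_integral_cmult) simp
  finally have 1: "1 = ennreal (1 / sqrt (2 * pi * s)) * (\<integral>\<^sup>+x. ennreal (exp (- x\<^sup>2 / (2 * s))) \<partial>lborel)" .
  define c where "c = sqrt (2 * pi * s)"
  have c: "0 < c" using assms by (simp add: c_def)
  have "ennreal c = ennreal c * (ennreal (1 / c) * (\<integral>\<^sup>+x. ennreal (exp (- x\<^sup>2 / (2 * s))) \<partial>lborel))"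
    unfolding c_def 1[symmetric] by simp
  also have "\<dots> = ennreal (c * (1 / c)) * (\<integral>\<^sup>+x. ennreal (exp (- x\<^sup>2 / (2 * s))) \<partial>lborel)"
    using c by (subst ennreal_mult) (simp_all add: mult.assoc)
  also have "c * (1 / c) = 1" using c by simp
  finally show ?thesis by (simp add: c_def)
qed

lemma quad_inv_unelim_split:
  fixes A :: "real^'k^'k"
  assumes A: "splits_off i A" "invertible A" and b: "b$i = 0" and s: "s \<noteq> 0"
    and x: "x = y + x$i *\<^sub>R (axis i 1 + b)"
  shows "x \<bullet> (matrix_inv (unelim i s b A) *v x) = (x$i)\<^sup>2 / s + y \<bullet> (matrix_inv A *v y)"
proof -
  let ?N = "matrix_inv A" and ?e = "axis i 1 :: real^'k"
  note N = splits_off_matrix_inv[OF A]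
  have yi: "y$i = 0" using arg_cong[OF x, of "\<lambda>z. z$i"] b by simp
  have z: "x - x$i *\<^sub>R b = y + x$i *\<^sub>R ?e"
    by (subst x) (simp add: algebra_simps)
  have "(y + x$i *\<^sub>R ?e) \<bullet> (?N *v (y + x$i *\<^sub>R ?e)) = (y + x$i *\<^sub>R ?e) \<bullet> (?N *v y + x$i *\<^sub>R ?e)"
    using splits_off_mult[OF N]
    by (simp add: matrix_vector_right_distrib matrix_vector_mult_scaleR)
  also have "\<dots> = y \<bullet> (?N *v y) + (x$i)\<^sup>2"
    using yi splits_off_component[OF N, of y]
    by (simp add: inner_add_left inner_add_right inner_axis inner_axis' power2_eq_square)
  finally show ?thesis
    unfolding quad_inv_unelim[OF A b s] Let_def z by simp
qed

definition on_coords :: "'k set \<Rightarrow> ('k \<Rightarrow> 'i) \<Rightarrow> ('i \<Rightarrow> real) \<Rightarrow> real^'k" where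
  "on_coords J e x = (\<chi> j. if j \<in> J then x (e j) else 0)"

lemma borel_measurable_on_coords:
  assumes "e ` J \<subseteq> I"
  shows "on_coords J e \<in> borel_measurable (lborel_on I)"
proof -
  have "(\<lambda>x. x (e j)) \<in> borel_measurable (lborel_on I)" if "j \<in> J" for j
    using assms that measurable_component_singleton[of "e j" I "\<lambda>_. lborel"] by auto
  then have "(\<lambda>x. if j \<in> J then x (e j) else 0) \<in> borel_measurable (lborel_on I)" for j
    by (cases "j \<in> J") auto
  then show ?thesis unfolding on_coords_def by measurable
qed

text \<open>A Cholesky decomposition of \<open>A\<close>, one coordinate at a time: eliminating the coordinate \<open>i\<close> shears the
  others by a multiple of \<open>x\<^sub>i\<close> and splits off the factor \<open>exp (- \<alpha> x\<^sub>i\<^sup>2 / (2 s))\<close>. The coordinates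
  outside \<open>J\<close> are those already eliminated.\<close>

lemma nn_integral_gaussian_form:
  fixes A :: "real^'k^'k" and e :: "'k \<Rightarrow> 'i"
  assumes "pos_def A" "\<And>i. i \<notin> J \<Longrightarrow> splits_off i A" "inj_on e J" "0 < \<alpha>"
  shows "(\<integral>\<^sup>+x. ennreal (exp (- \<alpha> / 2 * (on_coords J e x \<bullet> (matrix_inv A *v on_coords J e x)))) \<partial>lborel_on (e ` J))
    = ennreal (sqrt ((2 * pi / \<alpha>) ^ card J * det A))"
  using finite[of J] assms(1-3)
proof (induction J arbitrary: A rule: finite_induct)
  case empty
  then have "A = mat 1" by (intro splits_off_all_imp_mat_1) auto
  moreover have "on_coords {} e x = 0" for x by (simp add: on_coords_def vec_eq_iff)
  ultimately show ?case by (simp add: PiM_empty)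
next
  case (insert i J)
  obtain s b A' where s: "0 < s" and bi: "b$i = 0" and A'i: "splits_off i A'"
    and A: "A = unelim i s b A'" and pd: "pos_def A'"
    and A'j: "\<And>j. j \<notin> J \<Longrightarrow> splits_off j A'" and bj: "\<And>j. j \<notin> J \<Longrightarrow> b$j = 0"
    using pos_def_eliminate[OF insert.prems(1,2)] by blast
  note inv = pos_def_invertible[OF pd]
  have det: "det A = s * det A'" unfolding A by (rule det_unelim[OF A'i bi])
  define I where "I = e ` insert i J"
  have I: "finite I" "e ` J \<subseteq> I" "e i \<in> I" "I = insert (e i) (e ` J)" "e i \<notin> e ` J"
    using insert.hyps insert.prems(3) by (auto simp: I_def)
  have ne: "e j \<noteq> e i" if "j \<in> J" for j using I(5) that by (metis imageI)
  define inve where "inve = the_inv_into J e"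
  have inve: "inve (e j) = j" if "j \<in> J" for j
    unfolding inve_def using insert.prems(3) that by (intro the_inv_into_f_f) auto
  let ?c = "on_coords (insert i J) e" and ?d = "on_coords J e"
  define F where "F x = ennreal (exp (- \<alpha> / 2 * (?c x \<bullet> (matrix_inv A *v ?c x))))" for x
  define T where "T f = (\<lambda>q. if q \<in> e ` J then 1 * f q + f (e i) * b $ (inve q) else f q)" for f
  have [measurable]: "?c \<in> borel_measurable (lborel_on I)"
    by (rule borel_measurable_on_coords) (simp add: I_def)
  have mi: "(\<lambda>f. f (e i)) \<in> borel_measurable (lborel_on I)"
    using measurable_component_singleton[OF I(3), of "\<lambda>_. lborel :: real measure"] by simp
  have md: "?d \<in> borel_measurable (lborel_on I)" "?d \<in> borel_measurable (lborel_on (e ` J))"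
    by (rule borel_measurable_on_coords; use I in auto)+
  have FT: "F (T f) = ennreal (exp (- (f (e i))\<^sup>2 / (2 * (s / \<alpha>)))) *
      ennreal (exp (- \<alpha> / 2 * (?d f \<bullet> (matrix_inv A' *v ?d f))))" for f
  proof -
    have ci: "?c (T f) $ i = f (e i)" using I(5) by (simp add: on_coords_def T_def)
    have "?c (T f) = ?d f + ?c (T f) $ i *\<^sub>R (axis i 1 + b)"
      unfolding ci vec_eq_iff using insert.hyps I(5)
      by (auto simp: on_coords_def T_def axis_def inve bi bj)
    from quad_inv_unelim_split[OF A'i inv bi _ this, of s]
    have "?c (T f) \<bullet> (matrix_inv A *v ?c (T f)) = (f (e i))\<^sup>2 / s + ?d f \<bullet> (matrix_inv A' *v ?d f)"
      using s by (simp add: ci flip: A)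
    then have "- \<alpha> / 2 * (?c (T f) \<bullet> (matrix_inv A *v ?c (T f))) =
        - (f (e i))\<^sup>2 / (2 * (s / \<alpha>)) + - \<alpha> / 2 * (?d f \<bullet> (matrix_inv A' *v ?d f))"
      using assms(4) s by (simp add: field_simps)
    then show ?thesis by (simp only: F_def exp_add ennreal_mult'' exp_ge_zero)
  qed
  have F: "F \<in> borel_measurable (lborel_on I)" unfolding F_def by measurable
  have t: "(\<lambda>f. f (e i) * b $ inve q) \<in> borel_measurable (lborel_on I)" for q
    using mi by measurable
  have "(\<integral>\<^sup>+x. F x \<partial>lborel_on I) =
      (\<integral>\<^sup>+f. F (T f) * (\<Prod>q\<in>e ` J. ennreal \<bar>1\<bar>) \<partial>lborel_on I)"
    unfolding T_def
  proof (rule nn_integral_shear[OF I(1,2) F _ t, symmetric])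
    fix q p f y assume "p \<in> e ` J"
    then have "e i \<noteq> p" using I(5) by blast
    then show "(f(p := y)) (e i) * b $ inve q = f (e i) * b $ inve q" by simp
  qed simp_all
  also have "\<dots> = (\<integral>\<^sup>+f. ennreal (exp (- (f (e i))\<^sup>2 / (2 * (s / \<alpha>)))) *
      ennreal (exp (- \<alpha> / 2 * (?d f \<bullet> (matrix_inv A' *v ?d f)))) \<partial>lborel_on (insert (e i) (e ` J)))"
    by (simp add: FT flip: I(4))
  also have "\<dots> = (\<integral>\<^sup>+y. \<integral>\<^sup>+f. ennreal (exp (- y\<^sup>2 / (2 * (s / \<alpha>)))) *
      ennreal (exp (- \<alpha> / 2 * (?d f \<bullet> (matrix_inv A' *v ?d f)))) \<partial>lborel_on (e ` J) \<partial>lborel)"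
  proof (subst lborel_prod.product_nn_integral_insert_rev)
    have "?d (f(e i := y)) = ?d f" for f y
      using ne by (auto simp: on_coords_def vec_eq_iff)
    then show "(\<integral>\<^sup>+y. \<integral>\<^sup>+f. ennreal (exp (- ((f(e i := y)) (e i))\<^sup>2 / (2 * (s / \<alpha>)))) *
      ennreal (exp (- \<alpha> / 2 * (?d (f(e i := y)) \<bullet> (matrix_inv A' *v ?d (f(e i := y)))))) \<partial>lborel_on (e ` J) \<partial>lborel)
      = (\<integral>\<^sup>+y. \<integral>\<^sup>+f. ennreal (exp (- y\<^sup>2 / (2 * (s / \<alpha>)))) *
      ennreal (exp (- \<alpha> / 2 * (?d f \<bullet> (matrix_inv A' *v ?d f)))) \<partial>lborel_on (e ` J) \<partial>lborel)"
      by simp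
  next
    show "(\<lambda>f. ennreal (exp (- (f (e i))\<^sup>2 / (2 * (s / \<alpha>)))) *
      ennreal (exp (- \<alpha> / 2 * (?d f \<bullet> (matrix_inv A' *v ?d f))))) \<in>
      borel_measurable (lborel_on (insert (e i) (e ` J)))"
      unfolding I(4)[symmetric] using md(1) mi by measurable
  qed (use I(5) in simp_all)
  also have "\<dots> = (\<integral>\<^sup>+y. ennreal (exp (- y\<^sup>2 / (2 * (s / \<alpha>)))) *
      ennreal (sqrt ((2 * pi / \<alpha>) ^ card J * det A')) \<partial>lborel)"
  proof (rule nn_integral_cong)
    fix y :: real
    have inj: "inj_on e J" using insert.prems(3) by simp
    have m: "(\<lambda>f. ennreal (exp (- \<alpha> / 2 * (?d f \<bullet> (matrix_inv A' *v ?d f))))) \<in> borel_measurable (lborel_on (e ` J))"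
      using md(2) by measurable
    show "(\<integral>\<^sup>+f. ennreal (exp (- y\<^sup>2 / (2 * (s / \<alpha>)))) *
        ennreal (exp (- \<alpha> / 2 * (?d f \<bullet> (matrix_inv A' *v ?d f)))) \<partial>lborel_on (e ` J))
      = ennreal (exp (- y\<^sup>2 / (2 * (s / \<alpha>)))) * ennreal (sqrt ((2 * pi / \<alpha>) ^ card J * det A'))"
      unfolding nn_integral_cmult[OF m] by (subst insert.IH[OF pd _ inj]) (auto intro: A'j)
  qed
  also have "\<dots> = ennreal (sqrt (2 * pi * (s / \<alpha>))) * ennreal (sqrt ((2 * pi / \<alpha>) ^ card J * det A'))"
    using s assms(4) by (subst nn_integral_multc) (simp_all only: nn_integral_gaussian divide_pos_pos, measurable)
  also have "\<dots> = ennreal (sqrt ((2 * pi / \<alpha>) ^ card (insert i J) * det A))"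
  proof -
    have "(2 * pi * (s / \<alpha>)) * ((2 * pi / \<alpha>) ^ card J * det A') = (2 * pi / \<alpha>) ^ card (insert i J) * det A"
      using insert.hyps by (simp add: det)
    moreover have "0 \<le> sqrt (2 * pi * (s / \<alpha>))" using s assms(4) by simp
    ultimately show ?thesis by (metis ennreal_mult' real_sqrt_mult)
  qed
  finally show ?case by (simp add: F_def I_def)
qed


section \<open>Eliminating one coordinate in integrals over symmetric matrices\<close>

text \<open>The coordinates of a symmetric matrix are indexed by unordered pairs, as in \<^const>\<open>sym_lborel\<close>.
  Adding the coordinate \<open>i\<close> to \<open>J\<close> adds the index \<open>{i}\<close> of the pivot and the indices in \<open>edges i J\<close> of
  the pivot column. The identity that borders a \<open>frame\<close> makes an induction on the dimension run
  inside a fixed matrix type.\<close>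

definition pairs :: "'k set \<Rightarrow> 'k set set" where
  "pairs J = (\<lambda>(i, j). {i, j}) ` (J \<times> J)"

definition edges :: "'k \<Rightarrow> 'k set \<Rightarrow> 'k set set" where
  "edges i J = (\<lambda>j. {i, j}) ` J"

definition frame :: "'k set \<Rightarrow> ('k set \<Rightarrow> real) \<Rightarrow> real^'k^'k" where
  "frame J f = (\<chi> i j. if i \<in> J \<and> j \<in> J then f {i, j} else if i = j then 1 else 0)"

lemma finite_pairs: "finite (pairs (J :: 'k::finite set))"
  and finite_edges: "finite (edges i (J :: 'k::finite set))"
  by (simp_all add: pairs_def edges_def)

lemma pairs_empty [simp]: "pairs {} = {}"
  by (simp add: pairs_def)

lemma pairs_UNIV: "pairs UNIV = range (\<lambda>(i, j). {i, j})"
  by (simp add: pairs_def)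

lemma in_pairs: "i \<in> J \<Longrightarrow> j \<in> J \<Longrightarrow> {i, j} \<in> pairs J"
  by (auto simp: pairs_def)

lemma pairs_insert: "pairs (insert i J) = insert {i} (edges i J \<union> pairs J)"
proof -
  have "{i, i} \<in> pairs (insert i J)" by (rule in_pairs) auto
  moreover have "{j, i} = {i, j}" for j by auto
  ultimately show ?thesis by (force simp: pairs_def edges_def image_iff)
qed

lemma pairs_subset: "q \<in> pairs J \<Longrightarrow> q \<subseteq> J"
  by (auto simp: pairs_def)

lemma singleton_not_in:
  "i \<notin> J \<Longrightarrow> {i} \<notin> edges i J" "i \<notin> J \<Longrightarrow> {i} \<notin> pairs J"
  and edge_not_in_pairs: "i \<notin> J \<Longrightarrow> {i, j} \<notin> pairs J"
  by (auto simp: edges_def dest: pairs_subset)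

lemma edges_pairs_disjoint: "i \<notin> J \<Longrightarrow> edges i J \<inter> pairs J = {}"
  by (auto simp: edges_def edge_not_in_pairs)

lemma inj_on_edge: "i \<notin> J \<Longrightarrow> inj_on (\<lambda>j. {i, j}) J"
  by (auto simp: inj_on_def doubleton_eq_iff)

lemma borel_measurable_coordinate: "q \<in> I \<Longrightarrow> (\<lambda>f. f q) \<in> borel_measurable (lborel_on I)"
  using measurable_component_singleton[of q I "\<lambda>_. lborel"] by simp

lemma borel_measurable_frame:
  assumes "pairs J \<subseteq> I"
  shows "frame J \<in> borel_measurable (lborel_on I)"
proof -
  have "(\<lambda>f. if i \<in> J \<and> j \<in> J then f {i, j} else if i = j then 1 else 0) \<in> borel_measurable (lborel_on I)"
    for i j
    using borel_measurable_coordinate[of "{i, j}" I] in_pairs[of i J j] assms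
    by (cases "i \<in> J \<and> j \<in> J") auto
  then show ?thesis unfolding frame_def by measurable
qed

lemma splits_off_frame: "i \<notin> J \<Longrightarrow> splits_off i (frame J f)"
  by (auto simp: splits_off_def frame_def)

abbreviation edge_vec :: "'k \<Rightarrow> 'k set \<Rightarrow> ('k set \<Rightarrow> real) \<Rightarrow> real^'k" where
  "edge_vec i J \<equiv> on_coords J (\<lambda>j. {i, j})"

lemma edge_vec_nth: "i \<notin> J \<Longrightarrow> edge_vec i J f $ i = 0"
  by (simp add: on_coords_def)

text \<open>The product of \<open>b i\<close> and \<open>b j\<close> as a function of the unordered pair \<open>{i, j}\<close>, which is a singleton for
  \<open>i = j\<close>.\<close>

definition pair_prod :: "('k \<Rightarrow> real) \<Rightarrow> 'k set \<Rightarrow> real" where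
  "pair_prod b q = (if card q = 1 then (\<Prod>j\<in>q. (b j)\<^sup>2) else (\<Prod>j\<in>q. b j))"

lemma pair_prod_doubleton: "pair_prod b {i, j} = b i * b j"
  by (simp add: pair_prod_def power2_eq_square card_insert_if)

text \<open>Substitution of the Cholesky coordinates: the entries \<open>{i, j}\<close> are rescaled by the pivot \<open>s\<close>,
  and the block on \<open>J\<close> is translated by \<open>s b b\<^sup>T\<close>, both maps being shears. Rescaling needs
  \<open>s > 0\<close>, and therefore the integrand has to vanish at the other matrices.\<close>

lemma nn_integral_frame_insert:
  fixes J :: "'k::finite set" and G :: "real^'k^'k \<Rightarrow> ennreal"
  assumes i: "i \<notin> J" and G: "G \<in> borel_measurable borel"
    and G0: "\<And>M. M$i$i \<le> 0 \<Longrightarrow> G M = 0"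
  shows "(\<integral>\<^sup>+f. G (frame (insert i J) f) \<partial>lborel_on (pairs (insert i J))) =
    (\<integral>\<^sup>+s. indicator {0<..} s * ennreal (s ^ card J) *
       (\<integral>\<^sup>+f. G (unelim i s (edge_vec i J f) (frame J f)) \<partial>lborel_on (edges i J \<union> pairs J)) \<partial>lborel)"
proof -
  define I where "I = pairs (insert i J)"
  define I' where "I' = edges i J \<union> pairs J"
  have I: "finite I" "pairs J \<subseteq> I" "edges i J \<subseteq> I" "I = insert {i} I'" "{i} \<notin> I'" "finite I'" "{i} \<in> I"
    using finite_pairs[of "insert i J"] singleton_not_in[OF i] finite_pairs[of J] finite_edges[of i J]
    by (auto simp: I_def I'_def pairs_insert)
  define F where "F f = G (frame (insert i J) f)" for f
  define a :: "('k set \<Rightarrow> real) \<Rightarrow> real" where "a f = (if 0 < f {i} then f {i} else 1)" for f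
  \<comment> \<open>In these coordinates \<open>f {i, j}\<close> is \<open>b\<^sub>j\<close> for \<open>T1\<close> and \<open>s b\<^sub>j\<close> for \<open>T2\<close>; this is why \<open>T2\<close> divides by
    the pivot. The value 1 of \<open>a\<close> at other pivots only keeps the coefficient away from 0.\<close>
  define T1 where "T1 f = (\<lambda>q. if q \<in> edges i J then a f * f q + 0 else f q)" for f
  define T2 where "T2 f = (\<lambda>q. if q \<in> pairs J then 1 * f q + pair_prod (\<lambda>j. f {i, j}) q / f {i} else f q)"
    for f
  have mF: "F \<in> borel_measurable (lborel_on I)"
    unfolding F_def using borel_measurable_frame[of "insert i J" I] G by (simp add: I_def)
  have mi: "(\<lambda>f. f {i}) \<in> borel_measurable (lborel_on I)"
    by (rule borel_measurable_coordinate[OF I(7)])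
  then have ma: "a \<in> borel_measurable (lborel_on I)"
    unfolding a_def by measurable
  have mt: "(\<lambda>f. pair_prod (\<lambda>j. f {i, j}) q / f {i}) \<in> borel_measurable (lborel_on I)"
    if q: "q \<in> pairs J" for q
  proof -
    obtain j l where jl: "q = {j, l}" "j \<in> J" "l \<in> J" using q by (auto simp: pairs_def)
    have "{i, j} \<in> I" "{i, l} \<in> I" using jl I(3) by (auto simp: edges_def)
    then show ?thesis unfolding jl(1) pair_prod_doubleton
      by (intro borel_measurable_divide borel_measurable_times borel_measurable_coordinate mi)
  qed
  have mT2: "T2 \<in> lborel_on I \<rightarrow>\<^sub>M lborel_on I"
    unfolding T2_def by (rule measurable_shear) (use I mt in auto)
  have "(\<integral>\<^sup>+f. F f \<partial>lborel_on I) = (\<integral>\<^sup>+f. F (T2 f) * (\<Prod>q\<in>pairs J. ennreal \<bar>1\<bar>) \<partial>lborel_on I)"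
    unfolding T2_def
  proof (rule nn_integral_shear[OF I(1,2) mF _ mt, symmetric])
    fix q p f y assume "p \<in> pairs J"
    then have "{i, j} \<noteq> p" "{i} \<noteq> p" for j
      using edge_not_in_pairs[OF i] singleton_not_in(2)[OF i] by blast+
    then show "pair_prod (\<lambda>j. (f(p := y)) {i, j}) q / (f(p := y)) {i} = pair_prod (\<lambda>j. f {i, j}) q / f {i}"
      by simp
  qed simp_all
  also have "\<dots> = (\<integral>\<^sup>+f. F (T2 f) \<partial>lborel_on I)" by simp
  also have "\<dots> = (\<integral>\<^sup>+f. F (T2 (T1 f)) * (\<Prod>q\<in>edges i J. ennreal \<bar>a f\<bar>) \<partial>lborel_on I)"
    unfolding T1_def
  proof (rule nn_integral_shear[OF I(1,3) _ ma, symmetric])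
    show "(\<lambda>f. F (T2 f)) \<in> borel_measurable (lborel_on I)"
      using measurable_compose[OF mT2 mF] .
    fix p f y assume "p \<in> edges i J"
    then have "{i} \<noteq> p" using singleton_not_in(1)[OF i] by blast
    then show "a (f(p := y)) = a f" by (simp add: a_def)
  qed (simp_all add: a_def)
  also have "\<dots> = (\<integral>\<^sup>+f. indicator {0<..} (f {i}) * ennreal (f {i} ^ card J) *
      G (unelim i (f {i}) (edge_vec i J f) (frame J f)) \<partial>lborel_on I)"
  proof (rule nn_integral_cong)
    fix f :: "'k set \<Rightarrow> real"
    have Ti: "T2 (T1 f) {i} = f {i}"
      using singleton_not_in[OF i] by (simp add: T1_def T2_def)
    show "F (T2 (T1 f)) * (\<Prod>q\<in>edges i J. ennreal \<bar>a f\<bar>) = indicator {0<..} (f {i}) *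
      ennreal (f {i} ^ card J) * G (unelim i (f {i}) (edge_vec i J f) (frame J f))"
    proof (cases "0 < f {i}")
      case False
      then have "F (T2 (T1 f)) = 0"
        unfolding F_def by (intro G0) (simp add: frame_def Ti)
      then show ?thesis using False by simp
    next
      case True
      have e: "T2 (T1 f) {i, j} = f {i} * f {i, j}" "T1 f {i, j} = f {i} * f {i, j}" if "j \<in> J" for j
        using that True edge_not_in_pairs[OF i] by (auto simp: T1_def T2_def edges_def a_def)
      have p: "T2 (T1 f) {j, l} = f {j, l} + f {i} * f {i, j} * f {i, l}" if "j \<in> J" "l \<in> J" for j l
      proof -
        have "{j, l} \<notin> edges i J" "{i} \<notin> edges i J"
          using in_pairs[OF that] edges_pairs_disjoint[OF i] singleton_not_in[OF i] by auto
        then show ?thesis using in_pairs[OF that] True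
          by (simp add: T2_def pair_prod_doubleton e that) (simp add: T1_def)
      qed
      have "frame (insert i J) (T2 (T1 f)) = unelim i (f {i}) (edge_vec i J f) (frame J f)"
        unfolding vec_eq_iff unelim_component[OF splits_off_frame[OF i] edge_vec_nth[OF i]]
        using i e p Ti by (auto simp: frame_def on_coords_def insert_commute)
      moreover have "(\<Prod>q\<in>edges i J. ennreal \<bar>a f\<bar>) = ennreal (f {i} ^ card J)"
        using True card_image[OF inj_on_edge[OF i]] by (simp add: a_def edges_def ennreal_power)
      ultimately show ?thesis using True by (simp add: F_def mult.commute)
    qed
  qed
  also have "\<dots> = (\<integral>\<^sup>+s. \<integral>\<^sup>+f. indicator {0<..} s * ennreal (s ^ card J) *
      G (unelim i s (edge_vec i J f) (frame J f)) \<partial>lborel_on I' \<partial>lborel)"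
    unfolding I(4)
  proof (subst lborel_prod.product_nn_integral_insert_rev)
    have "edge_vec i J (f({i} := s)) = edge_vec i J f" "frame J (f({i} := s)) = frame J f" for f s
      using i by (auto simp: on_coords_def frame_def vec_eq_iff doubleton_eq_iff)
    then show "(\<integral>\<^sup>+s. \<integral>\<^sup>+f. indicator {0<..} ((f({i} := s)) {i}) * ennreal ((f({i} := s)) {i} ^ card J) *
        G (unelim i ((f({i} := s)) {i}) (edge_vec i J (f({i} := s))) (frame J (f({i} := s))))
          \<partial>lborel_on I' \<partial>lborel) =
      (\<integral>\<^sup>+s. \<integral>\<^sup>+f. indicator {0<..} s * ennreal (s ^ card J) *
      G (unelim i s (edge_vec i J f) (frame J f)) \<partial>lborel_on I' \<partial>lborel)"
      by simp
  next
    have "edge_vec i J \<in> borel_measurable (lborel_on I)" "frame J \<in> borel_measurable (lborel_on I)"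
      using I(2,3) by (auto intro!: borel_measurable_on_coords borel_measurable_frame simp: edges_def)
    then show "(\<lambda>f. indicator {0<..} (f {i}) * ennreal (f {i} ^ card J) *
      G (unelim i (f {i}) (edge_vec i J f) (frame J f))) \<in> borel_measurable (lborel_on (insert {i} I'))"
      unfolding I(4)[symmetric] unelim_def elim_mat_def pivot_def outer_def using mi G by measurable
  qed (use I in auto)
  also have "\<dots> = (\<integral>\<^sup>+s. indicator {0<..} s * ennreal (s ^ card J) *
       (\<integral>\<^sup>+f. G (unelim i s (edge_vec i J f) (frame J f)) \<partial>lborel_on I') \<partial>lborel)"
  proof (rule nn_integral_cong, rule nn_integral_cmult)
    fix s
    have "edge_vec i J \<in> borel_measurable (lborel_on I')" "frame J \<in> borel_measurable (lborel_on I')"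
      by (auto intro!: borel_measurable_on_coords borel_measurable_frame simp: edges_def I'_def)
    then show "(\<lambda>f. G (unelim i s (edge_vec i J f) (frame J f))) \<in> borel_measurable (lborel_on I')"
      unfolding unelim_def elim_mat_def pivot_def outer_def using G by measurable
  qed
  finally show ?thesis by (simp add: F_def I_def I'_def)
qed


section \<open>The inverse gamma integral\<close>

definition ig_kernel :: "real \<Rightarrow> real \<Rightarrow> real \<Rightarrow> real" where
  "ig_kernel p q s = (if 0 < s then s powr (- p - 1) * exp (- q / (2 * s)) else 0)"

lemma borel_measurable_ig_kernel [measurable]: "ig_kernel p q \<in> borel_measurable borel"
  unfolding ig_kernel_def by measurable

lemma ig_kernel_nonneg: "0 \<le> ig_kernel p q s"
  by (simp add: ig_kernel_def)

lemma nn_integral_ig_kernel_scale: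
  assumes q: "0 < q"
  shows "(\<integral>\<^sup>+s. ennreal (ig_kernel p q s) \<partial>lborel) =
    ennreal (q powr (- p)) * (\<integral>\<^sup>+s. ennreal (ig_kernel p 1 s) \<partial>lborel)"
proof -
  have "ig_kernel p q (0 + q * s) = q powr (- p - 1) * ig_kernel p 1 s" for s
    using q by (auto simp: ig_kernel_def powr_mult zero_less_mult_iff)
  then have "(\<integral>\<^sup>+s. ennreal (ig_kernel p q s) \<partial>lborel)
      = ennreal \<bar>q\<bar> * (\<integral>\<^sup>+s. ennreal (q powr (- p - 1)) * ennreal (ig_kernel p 1 s) \<partial>lborel)"
    using q by (subst nn_integral_real_affine[where c = q and t = 0])
      (simp_all add: ennreal_mult'' ig_kernel_nonneg)
  also have "\<dots> = ennreal (q * q powr (- p - 1)) * (\<integral>\<^sup>+s. ennreal (ig_kernel p 1 s) \<partial>lborel)"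
    using q by (simp add: nn_integral_cmult ennreal_mult'' mult.assoc)
  also have "q * q powr (- p - 1) = q powr (- p)"
    using q by (simp add: powr_mult_base)
  finally show ?thesis .
qed

lemma nn_integral_ig_kernel_finite:
  assumes p: "0 < p" and q: "0 < q"
  shows "(\<integral>\<^sup>+s. ennreal (ig_kernel p q s) \<partial>lborel) < \<infinity>"
proof -
  \<comment> \<open>From \<open>ln x \<le> x - 1\<close> at \<open>x = c / s\<close>: the maximum of the kernel over \<open>s\<close> is attained at \<open>s = c\<close>.\<close>
  define c where "c = q / (2 * (p + 1))"
  define C where "C = exp (- (p + 1) * (1 + ln c))"
  have c: "0 < c" using p q by (simp add: c_def)
  have bound: "ig_kernel p q s \<le> C" if "0 < s" for s
  proof -
    have "ln (c / s) \<le> c / s - 1" using c that by (intro ln_le_minus_one) simp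
    then have "(p + 1) * (ln c - ln s) \<le> (p + 1) * (c / s - 1)"
      using c that p by (intro mult_left_mono) (simp_all add: ln_div)
    moreover have "(p + 1) * (c / s) = q / (2 * s)" using p that by (simp add: c_def divide_simps)
    ultimately have "(- p - 1) * ln s + - q / (2 * s) \<le> - (p + 1) * (1 + ln c)"
      by (simp add: algebra_simps)
    then show ?thesis using that
      by (simp add: ig_kernel_def C_def powr_def flip: exp_add)
  qed
  have "(\<integral>\<^sup>+s. ennreal (s powr (- p - 1)) * indicator {1..} s \<partial>lborel)
      = ennreal (0 - (- (1 powr (- p)) / p))"
  proof (rule nn_integral_FTC_atLeast)
    fix s :: real assume "1 \<le> s"
    then show "((\<lambda>s. - (s powr (- p)) / p) has_real_derivative s powr (- p - 1)) (at s)"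
      using p by (auto intro!: derivative_eq_intros simp: field_simps)
  next
    show "((\<lambda>s. - (s powr (- p)) / p) \<longlongrightarrow> 0) at_top"
      using tendsto_divide[OF tendsto_minus[OF tendsto_neg_powr[OF _ filterlim_ident, of "- p"]], of "\<lambda>_. p" p] p
      by simp
  qed auto
  then have tail: "(\<integral>\<^sup>+s. ennreal (s powr (- p - 1)) * indicator {1..} s \<partial>lborel) < \<infinity>" by simp
  have "(\<integral>\<^sup>+s. ennreal (ig_kernel p q s) \<partial>lborel)
      \<le> (\<integral>\<^sup>+s. ennreal C * indicator {0..1} s + ennreal (s powr (- p - 1)) * indicator {1..} s \<partial>lborel)"
  proof (rule nn_integral_mono)
    fix s :: real
    consider "s \<le> 0" | "0 < s" "s < 1" | "1 \<le> s" by linarith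
    then show "ennreal (ig_kernel p q s)
        \<le> ennreal C * indicator {0..1} s + ennreal (s powr (- p - 1)) * indicator {1..} s"
    proof cases
      case 1 then show ?thesis by (simp add: ig_kernel_def)
    next
      case 2 then show ?thesis using bound[of s] by (simp add: ennreal_leI)
    next
      case 3
      then have "ig_kernel p q s \<le> s powr (- p - 1)"
        using q by (simp add: ig_kernel_def mult_left_le)
      then have "ennreal (ig_kernel p q s) \<le> ennreal (s powr (- p - 1)) * indicator {1..} s"
        using 3 by (simp add: ennreal_leI)
      then show ?thesis by (meson add_increasing zero_le)
    qed
  qed
  also have "\<dots> = ennreal C + (\<integral>\<^sup>+s. ennreal (s powr (- p - 1)) * indicator {1..} s \<partial>lborel)"
    by (subst nn_integral_add) (simp_all add: nn_integral_cmult)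
  also have "\<dots> < \<infinity>" using tail by simp
  finally show ?thesis .
qed

lemma nn_integral_ig_kernel_pos:
  shows "0 < (\<integral>\<^sup>+s. ennreal (ig_kernel p q s) \<partial>lborel)"
proof (rule ccontr)
  assume "\<not> ?thesis"
  then have "AE s in lborel. ennreal (ig_kernel p q s) = 0"
    by (simp add: nn_integral_0_iff_AE)
  then have "AE s in lborel. s \<le> (0::real)"
    by (rule AE_mp) (simp add: ig_kernel_def split: if_splits)
  then have "AE s in lborel. s \<notin> {0<..1::real}"
    by (rule AE_mp) simp
  then have "{0<..1::real} \<in> null_sets lborel"
    by (simp add: AE_iff_null_sets)
  then have "emeasure lborel {0<..1::real} = 0" by (rule null_setsD1)
  then show False by simp
qed


section \<open>The inverse Wishart integral\<close>

definition pd_kernel :: "real \<Rightarrow> real^'k^'k \<Rightarrow> real^'k^'k \<Rightarrow> ennreal" where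
  "pd_kernel d S M = indicator {M. pos_def M} M * ennreal (iw_kernel d S M)"

text \<open>What is left of \<^const>\<open>pd_kernel\<close> at \<open>unelim i s b A\<close> when the factors that contain \<open>s\<close> are taken
  out. The trace still contains the contribution \<open>S$i$i\<close> of the unit that \<open>A\<close> has at \<open>i\<close>, which has to
  be subtracted.\<close>

definition schur_kernel :: "real \<Rightarrow> real^'k^'k \<Rightarrow> 'k \<Rightarrow> real^'k \<Rightarrow> real^'k^'k \<Rightarrow> ennreal" where
  "schur_kernel d S i b A = indicator {A. pos_def A} A * ennreal (det A powr (- d / 2) *
     exp (- (trace (elim_mat i (- b) ** S ** transpose (elim_mat i (- b)) ** matrix_inv A) - S$i$i) / 2))"

lemma borel_measurable_indicator_pos_def:
  "(\<lambda>M. indicator {M. pos_def M} M) \<in> borel_measurable (borel :: (real^'k^'k) measure)"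
  using pos_def_borel by (simp add: pred_def)

lemma borel_measurable_pd_kernel [measurable]: "pd_kernel d S \<in> borel_measurable borel"
  unfolding pd_kernel_def using borel_measurable_indicator_pos_def by measurable

lemma borel_measurable_schur_kernel:
  assumes [measurable]: "b \<in> borel_measurable M" "A \<in> borel_measurable M"
  shows "(\<lambda>x. schur_kernel d S i (b x) (A x)) \<in> borel_measurable M"
proof -
  have [measurable]: "(\<lambda>x. indicator {A. pos_def A} (A x) :: ennreal) \<in> borel_measurable M"
    using measurable_compose[OF assms(2) borel_measurable_indicator_pos_def] .
  show ?thesis unfolding schur_kernel_def elim_mat_def outer_def by measurable
qed

lemma pd_kernel_unelim:
  assumes A: "splits_off i A" and b: "b$i = 0" and s: "0 < s"
  shows "pd_kernel d S (unelim i s b A) =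
    ennreal (s powr (- d / 2) * exp (- S$i$i / (2 * s))) * schur_kernel d S i b A"
proof (cases "pos_def A")
  case True
  note inv = pos_def_invertible[OF True]
  let ?t = "trace (elim_mat i (- b) ** S ** transpose (elim_mat i (- b)) ** matrix_inv A)"
  have "- trace (S ** matrix_inv (unelim i s b A)) / 2 = - S$i$i / (2 * s) + - (?t - S$i$i) / 2"
    using s by (simp add: trace_inv_unelim[OF A inv b] field_simps)
  moreover have "det (unelim i s b A) powr (- d / 2) = s powr (- d / 2) * det A powr (- d / 2)"
    using s pos_def_det_pos[OF True] by (simp add: det_unelim[OF A b] powr_mult)
  ultimately have "iw_kernel d S (unelim i s b A) =
      (s powr (- d / 2) * exp (- S$i$i / (2 * s))) * (det A powr (- d / 2) * exp (- (?t - S$i$i) / 2))"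
    unfolding iw_kernel_def by (simp only: exp_add mult_ac)
  then show ?thesis using True s pos_def_unelim[OF A b]
    by (simp add: pd_kernel_def schur_kernel_def ennreal_mult'')
next
  case False
  then show ?thesis using pos_def_unelim[OF A b] by (simp add: pd_kernel_def schur_kernel_def)
qed

lemma pos_def_diagonal: "pos_def M \<Longrightarrow> 0 < M$i$i"
  using pos_def_pos[of M "axis i 1"]
  by (simp add: axis_eq_0_iff matrix_vector_mult_basis column_def inner_axis')

text \<open>The pivot is independent of the remaining Cholesky coordinates: its inverse gamma kernel splits off
  as a factor. The exponent loses \<open>card J\<close> to the Jacobian determinant of the rescaling.\<close>

lemma nn_integral_pd_kernel_pivot:
  fixes J :: "'k::finite set" and \<phi> :: "real \<Rightarrow> ennreal"
  assumes i: "i \<notin> J" and [measurable]: "\<phi> \<in> borel_measurable borel"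
  shows "(\<integral>\<^sup>+f. \<phi> (frame (insert i J) f $ i $ i) * pd_kernel d S (frame (insert i J) f)
      \<partial>lborel_on (pairs (insert i J))) =
    (\<integral>\<^sup>+s. \<phi> s * ennreal (ig_kernel (d / 2 - real (card J) - 1) (S$i$i) s) \<partial>lborel) *
    (\<integral>\<^sup>+f. schur_kernel d S i (edge_vec i J f) (frame J f) \<partial>lborel_on (edges i J \<union> pairs J))"
    (is "_ = _ * ?c")
proof -
  let ?I = "edges i J \<union> pairs J"
  have ms: "(\<lambda>f. schur_kernel d S i (edge_vec i J f) (frame J f)) \<in> borel_measurable (lborel_on ?I)"
    by (intro borel_measurable_schur_kernel borel_measurable_on_coords borel_measurable_frame)
      (auto simp: edges_def)
  have "(\<integral>\<^sup>+f. \<phi> (frame (insert i J) f $ i $ i) * pd_kernel d S (frame (insert i J) f)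
      \<partial>lborel_on (pairs (insert i J))) =
    (\<integral>\<^sup>+s. indicator {0<..} s * ennreal (s ^ card J) *
      (\<integral>\<^sup>+f. \<phi> (unelim i s (edge_vec i J f) (frame J f) $ i $ i) *
        pd_kernel d S (unelim i s (edge_vec i J f) (frame J f)) \<partial>lborel_on ?I) \<partial>lborel)"
  proof (rule nn_integral_frame_insert[OF i, of "\<lambda>M. \<phi> (M$i$i) * pd_kernel d S M"])
    show "(\<lambda>M. \<phi> (M$i$i) * pd_kernel d S M) \<in> borel_measurable borel" by measurable
    fix M :: "real^'k^'k" assume "M$i$i \<le> 0"
    then have "\<not> pos_def M" using pos_def_diagonal[of M i] by linarith
    then show "\<phi> (M$i$i) * pd_kernel d S M = 0" by (simp add: pd_kernel_def)
  qed
  also have "\<dots> = (\<integral>\<^sup>+s. \<phi> s * ennreal (ig_kernel (d / 2 - real (card J) - 1) (S$i$i) s) * ?c \<partial>lborel)"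
  proof (rule nn_integral_cong)
    fix s :: real
    show "indicator {0<..} s * ennreal (s ^ card J) *
      (\<integral>\<^sup>+f. \<phi> (unelim i s (edge_vec i J f) (frame J f) $ i $ i) *
        pd_kernel d S (unelim i s (edge_vec i J f) (frame J f)) \<partial>lborel_on ?I)
      = \<phi> s * ennreal (ig_kernel (d / 2 - real (card J) - 1) (S$i$i) s) * ?c"
    proof (cases "0 < s")
      case True
      define w where "w = s powr (- d / 2) * exp (- S$i$i / (2 * s))"
      have "(\<integral>\<^sup>+f. \<phi> (unelim i s (edge_vec i J f) (frame J f) $ i $ i) *
          pd_kernel d S (unelim i s (edge_vec i J f) (frame J f)) \<partial>lborel_on ?I)
        = (\<integral>\<^sup>+f. (\<phi> s * ennreal w) * schur_kernel d S i (edge_vec i J f) (frame J f) \<partial>lborel_on ?I)"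
        using True splits_off_frame[OF i] edge_vec_nth[OF i]
        by (simp add: unelim_component pd_kernel_unelim w_def mult.assoc)
      also have "\<dots> = \<phi> s * ennreal w * ?c" by (rule nn_integral_cmult[OF ms])
      finally have *: "(\<integral>\<^sup>+f. \<phi> (unelim i s (edge_vec i J f) (frame J f) $ i $ i) *
          pd_kernel d S (unelim i s (edge_vec i J f) (frame J f)) \<partial>lborel_on ?I) = \<phi> s * ennreal w * ?c" .
      have "s ^ card J * w = ig_kernel (d / 2 - real (card J) - 1) (S$i$i) s"
        using True by (simp add: w_def ig_kernel_def flip: powr_realpow powr_add mult.assoc)
      then have h: "ennreal (s ^ card J) * ennreal w = ennreal (ig_kernel (d / 2 - real (card J) - 1) (S$i$i) s)"
        using True by (metis ennreal_mult' zero_le_power less_imp_le)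
      show ?thesis using True unfolding * h[symmetric] by (simp add: mult_ac)
    qed (simp add: ig_kernel_def)
  qed
  also have "\<dots> = (\<integral>\<^sup>+s. \<phi> s * ennreal (ig_kernel (d / 2 - real (card J) - 1) (S$i$i) s) \<partial>lborel) * ?c"
    by (rule nn_integral_multc) measurable
  finally show ?thesis .
qed

lemma trace_elim_scalar:
  fixes A :: "real^'k^'k"
  assumes A: "splits_off i A" "invertible A" and b: "b$i = 0"
  shows "trace (elim_mat i (- b) ** (\<epsilon> *\<^sub>R mat 1) ** transpose (elim_mat i (- b)) ** matrix_inv A)
    = \<epsilon> * (trace (matrix_inv A) + b \<bullet> (matrix_inv A *v b))"
proof -
  let ?N = "matrix_inv A" and ?e = "axis i 1 :: real^'k" and ?L = "elim_mat i (- b)"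
  note N = splits_off_matrix_inv[OF A]
  have t: "transpose ?L = mat 1 + outer ?e (- b)"
    by (auto simp: vec_eq_iff elim_mat_def transpose_def outer_def mat_def)
  have "?L ** transpose ?L = mat 1 + outer (- b) ?e + (outer ?e (- b) + outer b b)"
    unfolding t by (simp add: elim_mat_def matrix_add_mult matrix_mult_add matrix_mult_outer
        matrix_vector_mult_add_rdistrib
        outer_mult_vector inner_axis_axis) (simp add: vec_eq_iff outer_def algebra_simps)
  then have "trace (?L ** transpose ?L ** ?N) = trace ?N + ?e \<bullet> (?N *v (- b))
      + (- b \<bullet> (?N *v ?e) + b \<bullet> (?N *v b))"
    by (simp only: trace_mult_linear trace_outer_mult matrix_mul_lid)
  also have "?N *v ?e = ?e" by (rule splits_off_mult[OF N])
  also have "?e \<bullet> (?N *v (- b)) = 0"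
    using splits_off_component[OF N, of "- b"] b by (simp add: inner_axis')
  finally have "trace (?L ** transpose ?L ** ?N) = trace ?N + b \<bullet> (?N *v b)"
    using b by (simp add: inner_axis)
  moreover have "?L ** (\<epsilon> *\<^sub>R mat 1) ** transpose ?L ** ?N = \<epsilon> *\<^sub>R (?L ** transpose ?L ** ?N)"
    by (simp add: vec_eq_iff matrix_matrix_mult_def mat_def sum_distrib_left if_distrib if_distribR
        mult_ac sum_distrib_right cong: if_cong)
  moreover have "trace (\<epsilon> *\<^sub>R X) = \<epsilon> * trace X" for X :: "real^'k^'k"
    by (simp add: trace_def sum_distrib_left)
  ultimately show ?thesis by metis
qed

text \<open>The Gaussian integral over the edge coordinates turns the degree \<open>d\<close> into \<open>d - 1\<close>. This keeps the
  condition \<open>d > 2 card J\<close> alive when the dimension drops by one.\<close>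

lemma nn_integral_schur_kernel_scalar:
  fixes J :: "'k::finite set"
  assumes i: "i \<notin> J" and \<epsilon>: "0 < \<epsilon>"
  shows "(\<integral>\<^sup>+f. schur_kernel d (\<epsilon> *\<^sub>R mat 1 :: real^'k^'k) i (edge_vec i J f) (frame J f) \<partial>lborel_on (edges i J \<union> pairs J))
    = ennreal (exp (\<epsilon> / 2) * sqrt ((2 * pi / \<epsilon>) ^ card J)) *
      (\<integral>\<^sup>+f. pd_kernel (d - 1) (\<epsilon> *\<^sub>R mat 1 :: real^'k^'k) (frame J f) \<partial>lborel_on (pairs J))"
proof -
  let ?S = "\<epsilon> *\<^sub>R mat 1 :: real^'k^'k" and ?C = "exp (\<epsilon> / 2) * sqrt ((2 * pi / \<epsilon>) ^ card J)"
  let ?e = "\<lambda>j. {i, j}"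
  have dj: "pairs J \<inter> edges i J = {}" using edges_pairs_disjoint[OF i] by blast
  have ms: "(\<lambda>f. schur_kernel d ?S i (edge_vec i J f) (frame J f)) \<in> borel_measurable (lborel_on (pairs J \<union> edges i J))"
    by (intro borel_measurable_schur_kernel borel_measurable_on_coords borel_measurable_frame)
      (auto simp: edges_def)
  have "(\<integral>\<^sup>+f. schur_kernel d ?S i (edge_vec i J f) (frame J f) \<partial>lborel_on (edges i J \<union> pairs J))
    = (\<integral>\<^sup>+f. \<integral>\<^sup>+g. schur_kernel d ?S i (edge_vec i J (merge (pairs J) (edges i J) (f, g)))
        (frame J (merge (pairs J) (edges i J) (f, g))) \<partial>lborel_on (edges i J) \<partial>lborel_on (pairs J))"
    unfolding Un_commute[of "edges i J"]
    by (rule lborel_prod.product_nn_integral_fold[OF dj finite_pairs finite_edges ms])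
  also have "\<dots> = (\<integral>\<^sup>+f. \<integral>\<^sup>+g. schur_kernel d ?S i (edge_vec i J g) (frame J f)
      \<partial>lborel_on (edges i J) \<partial>lborel_on (pairs J))"
  proof -
    have "{i, j} \<in> edges i J" if "j \<in> J" for j using that by (simp add: edges_def)
    then have "edge_vec i J (merge (pairs J) (edges i J) (f, g)) = edge_vec i J g"
      "frame J (merge (pairs J) (edges i J) (f, g)) = frame J f" for f g
      using edge_not_in_pairs[OF i] in_pairs[of _ J]
      by (auto simp: on_coords_def frame_def merge_def vec_eq_iff)
    then show ?thesis by simp
  qed
  also have "\<dots> = (\<integral>\<^sup>+f. ennreal ?C * pd_kernel (d - 1) ?S (frame J f) \<partial>lborel_on (pairs J))"
  proof (rule nn_integral_cong)
    fix f :: "'k set \<Rightarrow> real"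
    let ?A = "frame J f"
    show "(\<integral>\<^sup>+g. schur_kernel d ?S i (edge_vec i J g) ?A \<partial>lborel_on (edges i J))
      = ennreal ?C * pd_kernel (d - 1) ?S ?A"
    proof (cases "pos_def ?A")
      case True
      have Si: "?S$i$i = \<epsilon>" by (simp add: mat_def)
      define w where "w = det ?A powr (- d / 2) * exp (- \<epsilon> / 2 * (trace (matrix_inv ?A) - 1))"
      have "schur_kernel d ?S i (edge_vec i J g) ?A
        = ennreal w * ennreal (exp (- \<epsilon> / 2 * (edge_vec i J g \<bullet> (matrix_inv ?A *v edge_vec i J g))))" for g
      proof -
        have "- (trace (elim_mat i (- edge_vec i J g) ** ?S ** transpose (elim_mat i (- edge_vec i J g)) **
            matrix_inv ?A) - ?S$i$i) / 2 = - \<epsilon> / 2 * (trace (matrix_inv ?A) - 1)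
            + - \<epsilon> / 2 * (edge_vec i J g \<bullet> (matrix_inv ?A *v edge_vec i J g))"
          unfolding Si trace_elim_scalar[OF splits_off_frame[OF i] pos_def_invertible[OF True] edge_vec_nth[OF i]]
          by (simp add: field_simps)
        then show ?thesis using True
          unfolding schur_kernel_def w_def by (simp only: exp_add) (simp add: ennreal_mult'' mult.assoc)
      qed
      then have "(\<integral>\<^sup>+g. schur_kernel d ?S i (edge_vec i J g) ?A \<partial>lborel_on (edges i J))
        = (\<integral>\<^sup>+g. ennreal w * ennreal (exp (- \<epsilon> / 2 * (edge_vec i J g \<bullet> (matrix_inv ?A *v edge_vec i J g))))
            \<partial>lborel_on (edges i J))" by simp
      also have "\<dots> = ennreal w * (\<integral>\<^sup>+g. ennreal (exp (- \<epsilon> / 2 * (edge_vec i J g \<bullet> (matrix_inv ?A *v edge_vec i J g))))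
            \<partial>lborel_on (edges i J))"
      proof (rule nn_integral_cmult)
        have "edge_vec i J \<in> borel_measurable (lborel_on (edges i J))"
          by (rule borel_measurable_on_coords) (simp add: edges_def)
        then show "(\<lambda>g. ennreal (exp (- \<epsilon> / 2 * (edge_vec i J g \<bullet> (matrix_inv ?A *v edge_vec i J g)))))
            \<in> borel_measurable (lborel_on (edges i J))" by measurable
      qed
      also have "\<dots> = ennreal w * ennreal (sqrt ((2 * pi / \<epsilon>) ^ card J * det ?A))"
        unfolding edges_def
        by (subst nn_integral_gaussian_form[OF True splits_off_frame inj_on_edge[OF i] \<epsilon>]) auto
      also have "\<dots> = ennreal (?C * iw_kernel (d - 1) ?S ?A)"
      proof -
        have D: "0 < det ?A" by (rule pos_def_det_pos[OF True])
        have 1: "det ?A powr (- d / 2) * sqrt (det ?A) = det ?A powr (- (d - 1) / 2)"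
          using D by (simp add: powr_half_sqrt[symmetric] flip: powr_add) (simp add: field_simps)
        have 2: "trace (?S ** matrix_inv ?A) = \<epsilon> * trace (matrix_inv ?A)"
          by (simp add: trace_mult_linear)
        have 3: "exp (- \<epsilon> / 2 * (trace (matrix_inv ?A) - 1)) = exp (\<epsilon> / 2) * exp (- (\<epsilon> * trace (matrix_inv ?A)) / 2)"
          by (simp add: algebra_simps flip: exp_add)
        have "w * sqrt ((2 * pi / \<epsilon>) ^ card J * det ?A)
          = (det ?A powr (- d / 2) * sqrt (det ?A)) * exp (- \<epsilon> / 2 * (trace (matrix_inv ?A) - 1))
            * sqrt ((2 * pi / \<epsilon>) ^ card J)"
          unfolding w_def real_sqrt_mult by (simp only: mult_ac)
        also have "\<dots> = ?C * iw_kernel (d - 1) ?S ?A"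
          unfolding 1 3 iw_kernel_def 2 by (simp only: mult_ac)
        finally have "w * sqrt ((2 * pi / \<epsilon>) ^ card J * det ?A) = ?C * iw_kernel (d - 1) ?S ?A" .
        moreover have "0 \<le> w" by (simp add: w_def)
        ultimately show ?thesis by (metis ennreal_mult')
      qed
      also have "\<dots> = ennreal ?C * pd_kernel (d - 1) ?S ?A"
        using True by (simp add: pd_kernel_def ennreal_mult' \<epsilon> less_imp_le)
      finally show ?thesis .
    qed (simp add: schur_kernel_def pd_kernel_def)
  qed
  also have "\<dots> = ennreal ?C * (\<integral>\<^sup>+f. pd_kernel (d - 1) ?S (frame J f) \<partial>lborel_on (pairs J))"
    by (rule nn_integral_cmult)
      (use measurable_compose[OF borel_measurable_frame borel_measurable_pd_kernel] in auto)
  finally show ?thesis .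
qed

text \<open>Induction on the dimension: adding a coordinate multiplies the integral for degree \<open>d - 1\<close> by an
  inverse gamma integral, which converges as \<open>d / 2 > card J + 1\<close>, and by a Gaussian factor.\<close>

lemma nn_integral_pd_kernel_scalar:
  fixes J :: "'k::finite set"
  assumes "2 * real (card J) < d" "0 < \<epsilon>"
  shows "0 < (\<integral>\<^sup>+f. pd_kernel d (\<epsilon> *\<^sub>R mat 1 :: real^'k^'k) (frame J f) \<partial>lborel_on (pairs J)) \<and>
    (\<integral>\<^sup>+f. pd_kernel d (\<epsilon> *\<^sub>R mat 1 :: real^'k^'k) (frame J f) \<partial>lborel_on (pairs J)) < \<infinity>"
  using finite[of J] assms(1)
proof (induction J arbitrary: d rule: finite_induct)
  case empty
  have "frame {} f = (mat 1 :: real^'k^'k)" for f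
    by (simp add: frame_def mat_def vec_eq_iff)
  then show ?case
    by (simp add: PiM_empty nn_integral_count_space_finite pd_kernel_def iw_kernel_def pos_def_mat_1)
next
  case (insert i J)
  let ?S = "\<epsilon> *\<^sub>R mat 1 :: real^'k^'k"
  define g where "g = (\<integral>\<^sup>+s. ennreal (ig_kernel (d / 2 - real (card J) - 1) \<epsilon> s) \<partial>lborel)"
  define C where "C = exp (\<epsilon> / 2) * sqrt ((2 * pi / \<epsilon>) ^ card J)"
  define Z where "Z = (\<integral>\<^sup>+f. pd_kernel (d - 1) ?S (frame J f) \<partial>lborel_on (pairs J))"
  have d: "2 * real (card J) < d - 1" "0 < d / 2 - real (card J) - 1"
    using insert.hyps insert.prems by auto
  have "(\<integral>\<^sup>+f. pd_kernel d ?S (frame (insert i J) f) \<partial>lborel_on (pairs (insert i J))) = g * (ennreal C * Z)"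
    using nn_integral_pd_kernel_pivot[OF insert.hyps(2), of "\<lambda>_. 1" d ?S]
      nn_integral_schur_kernel_scalar[OF insert.hyps(2) assms(2), of d]
    by (simp add: g_def C_def Z_def mat_def)
  moreover have "0 < Z" "Z < \<infinity>" using insert.IH[OF d(1)] by (simp_all add: Z_def)
  moreover have "0 < C" using assms(2) by (simp add: C_def)
  moreover have "0 < g" "g < \<infinity>" unfolding g_def
    using nn_integral_ig_kernel_pos nn_integral_ig_kernel_finite[OF d(2) assms(2)] by auto
  ultimately show ?case
    by (simp add: ennreal_zero_less_mult_iff ennreal_mult_less_top)
qed


section \<open>Lebesgue measure on the positive definite matrices\<close>

lemma frame_UNIV: "frame UNIV f = (\<chi> i j. f {i, j})"
  by (simp add: frame_def)

lemma measurable_frame_UNIV: "frame UNIV \<in> borel_measurable (lborel_on (pairs UNIV))"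
  by (rule borel_measurable_frame) simp

lemma sets_sym_lborel [simp, measurable_cong]: "sets sym_lborel = sets borel"
  by (simp add: sym_lborel_def)

lemma sym_lborel_eq: "(sym_lborel :: (real^'k^'k) measure) = distr (lborel_on (pairs UNIV)) borel (frame UNIV)"
  unfolding sym_lborel_def pairs_UNIV frame_UNIV[abs_def] ..

lemma pos_def_in_sets: "{\<Sigma> :: real^'k^'k. pos_def \<Sigma>} \<in> sets borel"
  using pos_def_borel by (simp add: pred_def)

lemma space_pd_measure: "space pd_measure = {\<Sigma> :: real^'k^'k. pos_def \<Sigma>}"
  by (simp add: pd_measure_def space_restrict_space sym_lborel_def)

lemma measurable_pd_measure: "f \<in> borel \<rightarrow>\<^sub>M N \<Longrightarrow> f \<in> (pd_measure :: (real^'k^'k) measure) \<rightarrow>\<^sub>M N"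
  unfolding pd_measure_def by (rule measurable_restrict_space1) simp

lemma nn_integral_pd_measure:
  fixes g :: "real^'k^'k \<Rightarrow> ennreal"
  assumes g: "g \<in> borel_measurable borel"
  shows "(\<integral>\<^sup>+\<Sigma>. g \<Sigma> \<partial>pd_measure) =
    (\<integral>\<^sup>+f. indicator {\<Sigma>. pos_def \<Sigma>} (frame UNIV f) * g (frame UNIV f) \<partial>lborel_on (pairs UNIV))"
proof -
  have "(\<integral>\<^sup>+\<Sigma>. g \<Sigma> \<partial>pd_measure) = (\<integral>\<^sup>+\<Sigma>. indicator {\<Sigma>. pos_def \<Sigma>} \<Sigma> * g \<Sigma> \<partial>sym_lborel)"
    unfolding pd_measure_def
    by (subst nn_integral_restrict_space) (simp_all add: pos_def_in_sets mult.commute)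
  also have "\<dots> = (\<integral>\<^sup>+f. indicator {\<Sigma>. pos_def \<Sigma>} (frame UNIV f) * g (frame UNIV f) \<partial>lborel_on (pairs UNIV))"
    unfolding sym_lborel_eq using g borel_measurable_indicator_pos_def
    by (subst nn_integral_distr) (simp_all add: measurable_frame_UNIV)
  finally show ?thesis .
qed

lemma sigma_finite_sym_lborel: "sigma_finite_measure (sym_lborel :: (real^'k^'k) measure)"
proof
  define A :: "nat \<Rightarrow> (real^'k^'k) set" where "A n = {M. \<forall>i j. \<bar>M$i$j\<bar> \<le> real n}" for n
  have sets: "A n \<in> sets borel" for n
    unfolding A_def by measurable
  have fin: "emeasure sym_lborel (A n) \<noteq> \<infinity>" for n
  proof -
    let ?E = "\<Pi>\<^sub>E q\<in>pairs (UNIV :: 'k set). {- real n..real n}"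
    have "emeasure sym_lborel (A n) = emeasure (lborel_on (pairs UNIV)) (frame UNIV -` A n \<inter> space (lborel_on (pairs UNIV)))"
      unfolding sym_lborel_eq by (rule emeasure_distr[OF measurable_frame_UNIV sets])
    also have "\<dots> \<le> emeasure (lborel_on (pairs UNIV)) ?E"
    proof (rule emeasure_mono)
      show "frame UNIV -` A n \<inter> space (lborel_on (pairs UNIV)) \<subseteq> ?E"
      proof
        fix f assume f: "f \<in> frame UNIV -` A n \<inter> space (lborel_on (pairs UNIV))"
        have "f {i, j} \<in> {- real n..real n}" for i j :: 'k
          using f by (auto simp: A_def frame_UNIV abs_le_iff minus_le_iff)
        then show "f \<in> ?E" using f by (auto simp: space_PiM PiE_iff pairs_def)
      qed
    qed (simp add: finite_pairs)
    also have "\<dots> = (\<Prod>q\<in>pairs (UNIV :: 'k set). emeasure lborel {- real n..real n})"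
      by (rule lborel_prod.emeasure_PiM) (simp_all add: finite_pairs)
    also have "\<dots> < \<infinity>" by (simp add: ennreal_prod_eq_top less_top[symmetric] ennreal_power)
    finally show ?thesis by simp
  qed
  have cover: "M \<in> (\<Union>n. A n)" for M :: "real^'k^'k"
  proof -
    obtain n where n: "(\<Sum>i\<in>UNIV. \<Sum>j\<in>UNIV. \<bar>M$i$j\<bar>) \<le> real n" using real_arch_simple by blast
    have m: "\<bar>M$i$j\<bar> \<le> (\<Sum>i\<in>UNIV. \<Sum>j\<in>UNIV. \<bar>M$i$j\<bar>)" for i j
    proof -
      have "\<bar>M$i$j\<bar> \<le> (\<Sum>j\<in>UNIV. \<bar>M$i$j\<bar>)" by (rule member_le_sum) auto
      also have "\<dots> \<le> (\<Sum>i\<in>UNIV. \<Sum>j\<in>UNIV. \<bar>M$i$j\<bar>)"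
        by (rule member_le_sum[where f = "\<lambda>i. \<Sum>j\<in>UNIV. \<bar>M$i$j\<bar>"]) (auto intro: sum_nonneg)
      finally show ?thesis .
    qed
    have "M \<in> A n" unfolding A_def using order_trans[OF m n] by simp
    then show ?thesis by blast
  qed
  have "UNIV = (\<Union>n. A n)" by (rule UNIV_eq_I) (rule cover)
  then have "\<Union> (range A) = space (sym_lborel :: (real^'k^'k) measure)"
    unfolding sym_lborel_def by simp
  then show "\<exists>A. countable A \<and> A \<subseteq> sets sym_lborel \<and> \<Union> A = space (sym_lborel :: (real^'k^'k) measure) \<and>
      (\<forall>a\<in>A. emeasure sym_lborel a \<noteq> \<infinity>)"
    using sets fin by (intro exI[of _ "range A"] conjI) (simp_all add: image_subset_iff)
qed

lemma sigma_finite_pd_measure: "sigma_finite_measure (pd_measure :: (real^'k^'k) measure)"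
  unfolding pd_measure_def
  by (rule sigma_finite_measure_restrict_space[OF sigma_finite_sym_lborel]) (simp add: pos_def_in_sets)


section \<open>Quadratic forms of an inverse Wishart matrix\<close>

text \<open>Congruence by this matrix makes the value \<open>v \<bullet> (\<Sigma> *v v)\<close> the diagonal entry at \<open>i\<close>.\<close>

definition row_mat :: "'k \<Rightarrow> real^'k \<Rightarrow> real^'k^'k" where
  "row_mat i v = (\<chi> p. if p = i then v else axis p 1)"

lemma row_mat_mult: "(row_mat i v *v x)$p = (if p = i then v \<bullet> x else x$p)"
  by (simp add: row_mat_def matrix_vector_mul_component inner_axis')

lemma invertible_row_mat:
  assumes "v$i \<noteq> 0" shows "invertible (row_mat i v)"
proof (rule invertible_if_no_kernel)
  fix x assume x: "row_mat i v *v x = 0"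
  have "x$p = 0" if "p \<noteq> i" for p using row_mat_mult[of i v x p] x that by simp
  moreover from this have "v \<bullet> x = v$i * x$i"
    unfolding inner_vec_def by (subst sum.remove[of _ i]) auto
  then have "x$i = 0" using row_mat_mult[of i v x i] x assms by simp
  ultimately show "x = 0" by (metis vec_eq_iff zero_index)
qed

lemma row_mat_congruence_nth:
  "(row_mat i v ** M ** transpose (row_mat i v))$p$q =
    (if p = i then (if q = i then \<Sum>j\<in>UNIV. \<Sum>l\<in>UNIV. v$j * v$l * M$j$l else \<Sum>l\<in>UNIV. v$l * M$l$q)
     else if q = i then \<Sum>l\<in>UNIV. v$l * M$p$l else M$p$q)"
proof -
  let ?B = "row_mat i v"
  have L: "(?B ** X)$p$q = (if p = i then \<Sum>l\<in>UNIV. v$l * X$l$q else X$p$q)" for X :: "real^'a^'a" and p q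
    by (simp add: matrix_matrix_mult_def row_mat_def axis_def if_distrib[of "\<lambda>x. x * _"] cong: if_cong)
  have R: "(X ** transpose ?B)$p$q = (if q = i then \<Sum>l\<in>UNIV. v$l * X$p$l else X$p$q)" for X :: "real^'a^'a" and p q
  proof -
    have "(X ** transpose ?B)$p$q = (\<Sum>l\<in>UNIV. ?B$q$l * X$p$l)"
      by (simp add: matrix_matrix_mult_def transpose_def mult.commute)
    then show ?thesis by (simp add: row_mat_def axis_def if_distrib[of "\<lambda>x. x * _"] cong: if_cong)
  qed
  show ?thesis unfolding R L
    by (auto simp: sum_distrib_left mult_ac) (subst sum.swap, simp add: mult.left_commute)
qed

lemma quad_eq_sum: "v \<bullet> (M *v v) = (\<Sum>j\<in>UNIV. \<Sum>l\<in>UNIV. v$j * v$l * M$j$l)"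
  for M :: "real^'k^'k"
  by (simp add: inner_vec_def matrix_vector_mult_def sum_distrib_left mult_ac)

lemma row_mat_congruence_diag:
  "(row_mat i v ** M ** transpose (row_mat i v))$i$i = v \<bullet> (M *v v)"
  by (simp add: row_mat_congruence_nth quad_eq_sum)

text \<open>The congruence by \<^const>\<open>row_mat\<close> is a composition of two shears, in the coordinate \<open>{i}\<close> and in
  the coordinates \<open>{i, j}\<close>.\<close>

lemma nn_integral_congruence:
  fixes v :: "real^'k" and F :: "real^'k^'k \<Rightarrow> ennreal"
  assumes v: "v$i \<noteq> 0" and F: "F \<in> borel_measurable borel"
  shows "(\<integral>\<^sup>+f. F (frame UNIV f) \<partial>lborel_on (pairs UNIV)) = ennreal (\<bar>v$i\<bar> ^ (CARD('k) + 1)) *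
    (\<integral>\<^sup>+f. F (row_mat i v ** frame UNIV f ** transpose (row_mat i v)) \<partial>lborel_on (pairs UNIV))"
proof -
  let ?I = "pairs (UNIV :: 'k set)" and ?K = "edges i (UNIV - {i})" and ?B = "row_mat i v"
  define G where "G f = F (frame UNIV f)" for f
  define t1 where "t1 f = (\<Sum>j\<in>UNIV. \<Sum>l\<in>UNIV. if j = i \<and> l = i then 0 else v$j * v$l * f {j, l})" for f
  define t2 where "t2 q f = (\<Sum>l\<in>UNIV - {i}. v$l * f (insert l (q - {i})))" for q f
  define T1 where "T1 f = (\<lambda>q. if q \<in> {{i}} then (v$i)\<^sup>2 * f q + t1 f else f q)" for f
  define T2 where "T2 f = (\<lambda>q. if q \<in> ?K then v$i * f q + t2 q f else f q)" for f
  have I: "finite ?I" "{{i}} \<subseteq> ?I" "?K \<subseteq> ?I"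
    by (auto simp: finite_pairs pairs_def edges_def)
  have mG: "G \<in> borel_measurable (lborel_on ?I)"
    unfolding G_def using measurable_compose[OF measurable_frame_UNIV F] .
  have coord: "(\<lambda>f. f {j, l}) \<in> borel_measurable (lborel_on ?I)" for j l :: 'k
    by (rule borel_measurable_coordinate) (simp add: in_pairs)
  have mt1: "t1 \<in> borel_measurable (lborel_on ?I)"
    unfolding t1_def using coord by measurable
  have mt2: "t2 q \<in> borel_measurable (lborel_on ?I)" if "q \<in> ?K" for q
  proof -
    obtain j where "q = {i, j}" "j \<noteq> i" using \<open>q \<in> ?K\<close> by (auto simp: edges_def)
    then have "insert l (q - {i}) = {l, j}" for l by auto
    then show ?thesis unfolding t2_def using coord by simp
  qed
  have mT2: "T2 \<in> lborel_on ?I \<rightarrow>\<^sub>M lborel_on ?I"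
    unfolding T2_def by (rule measurable_shear) (use I mt2 in auto)
  have "(\<integral>\<^sup>+f. G f \<partial>lborel_on ?I) = (\<integral>\<^sup>+f. G (T2 f) * (\<Prod>q\<in>?K. ennreal \<bar>v$i\<bar>) \<partial>lborel_on ?I)"
    unfolding T2_def
  proof (rule nn_integral_shear[OF I(1,3) mG _ mt2, symmetric])
    fix q p f y assume "p \<in> ?K"
    then have "insert l (q - {i}) \<noteq> p" if "l \<noteq> i" for l using that by (auto simp: edges_def)
    then show "t2 q (f(p := y)) = t2 q f" by (auto simp: t2_def intro!: sum.cong)
  qed (use v in auto)
  also have "\<dots> = (\<integral>\<^sup>+f. (G (T2 (T1 f)) * (\<Prod>q\<in>?K. ennreal \<bar>v$i\<bar>)) * (\<Prod>q\<in>{{i}}. ennreal \<bar>(v$i)\<^sup>2\<bar>) \<partial>lborel_on ?I)"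
    unfolding T1_def
  proof (rule nn_integral_shear[OF I(1,2) _ _ mt1, symmetric])
    show "(\<lambda>f. G (T2 f) * (\<Prod>q\<in>?K. ennreal \<bar>v$i\<bar>)) \<in> borel_measurable (lborel_on ?I)"
      using measurable_compose[OF mT2 mG] by measurable
    fix p f y assume "p \<in> {{i}}"
    then have "{j, l} \<noteq> p" if "\<not> (j = i \<and> l = i)" for j l using that by auto
    then show "t1 (f(p := y)) = t1 f" by (auto simp: t1_def intro!: sum.cong)
  qed (use v in auto)
  also have "\<dots> = (\<integral>\<^sup>+f. ennreal (\<bar>v$i\<bar> ^ (CARD('k) + 1)) * F (?B ** frame UNIV f ** transpose ?B) \<partial>lborel_on ?I)"
  proof (rule nn_integral_cong)
    fix f :: "'k set \<Rightarrow> real"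
    have ii: "T2 (T1 f) {i} = (v$i)\<^sup>2 * f {i} + t1 f"
      using singleton_not_in(1)[of i "UNIV - {i}"] by (simp add: T2_def T1_def)
    have ij: "T2 (T1 f) {i, j} = v$i * f {i, j} + (\<Sum>l\<in>UNIV - {i}. v$l * f {l, j})" if "j \<noteq> i" for j
    proof -
      have "{i, j} \<in> ?K" "{i, j} \<noteq> {i}" using that by (auto simp: edges_def)
      moreover have "insert l ({i, j} - {i}) = {l, j}" "{l, j} \<noteq> {i}" for l using that by auto
      ultimately show ?thesis by (simp add: T2_def T1_def t2_def)
    qed
    have jl: "T2 (T1 f) {j, l} = f {j, l}" if "j \<noteq> i" "l \<noteq> i" for j l
    proof -
      have "{j, l} \<notin> ?K" "{j, l} \<noteq> {i}" using that by (auto simp: edges_def doubleton_eq_iff)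
      then show ?thesis using that by (simp add: T2_def T1_def)
    qed
    have s: "(\<Sum>l\<in>UNIV. v$l * f {l, j}) = v$i * f {i, j} + (\<Sum>l\<in>UNIV - {i}. v$l * f {l, j})" for j
      by (rule sum.remove) auto
    have "(\<Sum>j\<in>UNIV. \<Sum>l\<in>UNIV. v$j * v$l * f {j, l})
        = (\<Sum>j\<in>UNIV. \<Sum>l\<in>UNIV. (if j = i then if l = i then (v$i)\<^sup>2 * f {i} else 0 else 0)
            + (if j = i \<and> l = i then 0 else v$j * v$l * f {j, l}))"
      by (intro sum.cong refl) (auto simp: power2_eq_square)
    also have "\<dots> = (v$i)\<^sup>2 * f {i} + t1 f"
    proof -
      have "(\<Sum>l\<in>UNIV. if j = i then if l = i then (v$i)\<^sup>2 * f {i} else 0 else 0)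
          = (if j = i then (v$i)\<^sup>2 * f {i} else 0)" for j
        by (cases "j = i") simp_all
      then show ?thesis by (simp add: sum.distrib t1_def)
    qed
    finally have ss: "(\<Sum>j\<in>UNIV. \<Sum>l\<in>UNIV. v$j * v$l * f {j, l}) = (v$i)\<^sup>2 * f {i} + t1 f" .
    have ji: "T2 (T1 f) {j, i} = (\<Sum>l\<in>UNIV. v$l * f {j, l})" if "j \<noteq> i" for j
    proof -
      have "{j, i} = {i, j}" "{j, l} = {l, j}" for l by auto
      then show ?thesis using ij[OF that] s[of j] by simp
    qed
    have "frame UNIV (T2 (T1 f)) = ?B ** frame UNIV f ** transpose ?B"
      unfolding vec_eq_iff row_mat_congruence_nth
      by (auto simp: frame_UNIV ii ij ji jl s ss)
    moreover have "(\<Prod>q\<in>?K. ennreal \<bar>v$i\<bar>) * (\<Prod>q\<in>{{i}}. ennreal \<bar>(v$i)\<^sup>2\<bar>) = ennreal (\<bar>v$i\<bar> ^ (CARD('k) + 1))"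
    proof -
      have "card ?K = CARD('k) - 1"
        unfolding edges_def by (subst card_image[OF inj_on_edge]) (auto simp: card_Diff_singleton)
      moreover have "CARD('k) - 1 + 2 = CARD('k) + 1" using zero_less_card_finite[where 'a='k] by linarith
      ultimately have "\<bar>v$i\<bar> ^ (CARD('k) + 1) = \<bar>v$i\<bar> ^ card ?K * \<bar>(v$i)\<^sup>2\<bar>"
        by (metis power_abs power_add)
      then have "ennreal (\<bar>v$i\<bar> ^ (CARD('k) + 1)) = ennreal \<bar>v$i\<bar> ^ card ?K * ennreal \<bar>(v$i)\<^sup>2\<bar>"
        by (simp only: ennreal_mult'' abs_ge_zero ennreal_power)
      then show ?thesis by simp
    qed
    ultimately show "(G (T2 (T1 f)) * (\<Prod>q\<in>?K. ennreal \<bar>v$i\<bar>)) * (\<Prod>q\<in>{{i}}. ennreal \<bar>(v$i)\<^sup>2\<bar>)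
      = ennreal (\<bar>v$i\<bar> ^ (CARD('k) + 1)) * F (?B ** frame UNIV f ** transpose ?B)"
      by (simp only: G_def mult.assoc) (simp only: mult.commute)
  qed
  also have "\<dots> = ennreal (\<bar>v$i\<bar> ^ (CARD('k) + 1)) * (\<integral>\<^sup>+f. F (?B ** frame UNIV f ** transpose ?B) \<partial>lborel_on ?I)"
    by (rule nn_integral_cmult) (use F measurable_frame_UNIV in measurable)
  finally show ?thesis by (simp add: G_def)
qed

lemma pd_kernel_congruence:
  fixes S B \<Sigma> :: "real^'k^'k"
  assumes B: "invertible B"
  shows "pd_kernel d S \<Sigma> = ennreal ((det B)\<^sup>2 powr (d / 2)) *
    pd_kernel d (B ** S ** transpose B) (B ** \<Sigma> ** transpose B)"
proof (cases "pos_def \<Sigma>")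
  case True
  have dB: "0 < (det B)\<^sup>2" using B by (simp add: invertible_det_nz)
  have D: "0 < det \<Sigma>" by (rule pos_def_det_pos[OF True])
  have "matrix_inv B ** (B ** S ** transpose B) ** transpose (matrix_inv B)
      = (matrix_inv B ** B) ** S ** transpose (matrix_inv B ** B)"
    by (simp add: matrix_transpose_mul matrix_mul_assoc)
  then have "trace (B ** S ** transpose B ** matrix_inv (B ** \<Sigma> ** transpose B)) = trace (S ** matrix_inv \<Sigma>)"
    by (simp add: trace_congruence_inv[OF B pos_def_invertible[OF True]] matrix_inv_inverse[OF B])
  moreover have "det (B ** \<Sigma> ** transpose B) = (det B)\<^sup>2 * det \<Sigma>"
    by (simp add: det_mul power2_eq_square)
  moreover have "(det B)\<^sup>2 powr (d / 2) * ((det B)\<^sup>2 * det \<Sigma>) powr (- d / 2) = det \<Sigma> powr (- d / 2)"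
    using dB D by (simp add: powr_mult flip: powr_add mult.assoc)
  ultimately have "iw_kernel d S \<Sigma> = (det B)\<^sup>2 powr (d / 2) * iw_kernel d (B ** S ** transpose B) (B ** \<Sigma> ** transpose B)"
    unfolding iw_kernel_def by (simp only: flip: mult.assoc)
  then show ?thesis using True pos_def_congruence[OF B]
    by (simp add: pd_kernel_def ennreal_mult')
next
  case False
  then show ?thesis using pos_def_congruence[OF B] by (simp add: pd_kernel_def)
qed

text \<open>Finiteness follows from \<open>S \<ge> \<epsilon> I\<close>, which bounds the kernel by that of a scalar matrix.
  Positivity holds as both kernels are nonzero at exactly the same matrices, the positive definite ones.\<close>

lemma nn_integral_pd_kernel_finite_pos:
  fixes S :: "real^'k^'k"
  assumes S: "pos_def S" and d: "2 * real CARD('k) < d"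
  shows "0 < (\<integral>\<^sup>+f. pd_kernel d S (frame UNIV f) \<partial>lborel_on (pairs UNIV))"
    "(\<integral>\<^sup>+f. pd_kernel d S (frame UNIV f) \<partial>lborel_on (pairs UNIV)) < \<infinity>"
proof -
  have m: "(\<lambda>f. pd_kernel d S (frame UNIV f)) \<in> borel_measurable (lborel_on (pairs UNIV))"
    for S :: "real^'k^'k"
    using measurable_compose[OF measurable_frame_UNIV borel_measurable_pd_kernel] .
  obtain n where n: "\<And>x. 1 / real (Suc n) * (x \<bullet> x) \<le> x \<bullet> (S *v x)"
    using S unfolding pos_def_iff_bounded_below by blast
  define \<epsilon> where "\<epsilon> = 1 / real (Suc n)"
  have \<epsilon>: "0 < \<epsilon>" by (simp add: \<epsilon>_def)
  have "pd_kernel d S \<Sigma> \<le> pd_kernel d (\<epsilon> *\<^sub>R mat 1) \<Sigma>" for \<Sigma> :: "real^'k^'k"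
  proof (cases "pos_def \<Sigma>")
    case True
    have "\<epsilon> * trace (matrix_inv \<Sigma>) \<le> trace (S ** matrix_inv \<Sigma>)"
      by (rule trace_mult_mono[OF _ pos_def_matrix_inv[OF True]]) (use n in \<open>simp add: \<epsilon>_def\<close>)
    then have "iw_kernel d S \<Sigma> \<le> iw_kernel d (\<epsilon> *\<^sub>R mat 1) \<Sigma>"
      by (simp add: iw_kernel_def trace_mult_linear mult_left_mono)
    then show ?thesis using True by (simp add: pd_kernel_def ennreal_leI)
  qed (simp add: pd_kernel_def)
  then have "(\<integral>\<^sup>+f. pd_kernel d S (frame UNIV f) \<partial>lborel_on (pairs UNIV))
      \<le> (\<integral>\<^sup>+f. pd_kernel d (\<epsilon> *\<^sub>R mat 1) (frame UNIV f :: real^'k^'k) \<partial>lborel_on (pairs UNIV))"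
    by (simp add: nn_integral_mono)
  also have "\<dots> < \<infinity>" using nn_integral_pd_kernel_scalar[of "UNIV :: 'k set" d \<epsilon>] d \<epsilon> by simp
  finally show "(\<integral>\<^sup>+f. pd_kernel d S (frame UNIV f) \<partial>lborel_on (pairs UNIV)) < \<infinity>" .
  show "0 < (\<integral>\<^sup>+f. pd_kernel d S (frame UNIV f) \<partial>lborel_on (pairs UNIV))"
  proof (rule ccontr)
    assume "\<not> ?thesis"
    then have "AE f in lborel_on (pairs UNIV). pd_kernel d S (frame UNIV f) = 0"
      by (simp add: nn_integral_0_iff_AE[OF m])
    moreover have "pd_kernel d (\<epsilon> *\<^sub>R mat 1) \<Sigma> = 0" if "pd_kernel d S \<Sigma> = 0" for \<Sigma> :: "real^'k^'k"
      using that pos_def_det_pos[of \<Sigma>]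
      by (cases "pos_def \<Sigma>") (auto simp: pd_kernel_def iw_kernel_def mult_le_0_iff)
    ultimately have "AE f in lborel_on (pairs UNIV). pd_kernel d (\<epsilon> *\<^sub>R mat 1) (frame UNIV f :: real^'k^'k) = 0"
      by (auto elim: AE_mp)
    then have "(\<integral>\<^sup>+f. pd_kernel d (\<epsilon> *\<^sub>R mat 1) (frame UNIV f :: real^'k^'k) \<partial>lborel_on (pairs UNIV)) = 0"
      by (simp add: nn_integral_0_iff_AE[OF m])
    then show False using nn_integral_pd_kernel_scalar[of "UNIV :: 'k set" d \<epsilon>] d \<epsilon> by simp
  qed
qed

lemma nn_integral_iw_kernel:
  fixes S :: "real^'k^'k" and \<phi> :: "real^'k^'k \<Rightarrow> ennreal"
  assumes "\<phi> \<in> borel_measurable borel"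
  shows "(\<integral>\<^sup>+\<Sigma>. \<phi> \<Sigma> * ennreal (iw_kernel d S \<Sigma>) \<partial>pd_measure)
    = (\<integral>\<^sup>+f. \<phi> (frame UNIV f) * pd_kernel d S (frame UNIV f) \<partial>lborel_on (pairs UNIV))"
  using assms by (subst nn_integral_pd_measure) (simp_all add: pd_kernel_def mult_ac)

text \<open>After the congruence by \<^const>\<open>row_mat\<close> the value \<open>v \<bullet> (\<Sigma> *v v)\<close> is the pivot of the first elimination
  step, whose density is known. The remaining coordinates are integrated out into the constant \<open>c\<close>.
  The same identity for the total mass shows that \<open>c\<close> is positive and finite.\<close>

theorem inverse_wishart_form_law:
  fixes S :: "real^'k^'k"
  assumes S: "pos_def S" and d: "2 * real CARD('k) < d" and v: "v \<noteq> 0"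
  obtains c where "0 < c" "c < \<infinity>"
    "\<And>\<phi>. \<phi> \<in> borel_measurable borel \<Longrightarrow>
      (\<integral>\<^sup>+\<Sigma>. \<phi> (v \<bullet> (\<Sigma> *v v)) * ennreal (iw_kernel d S \<Sigma>) \<partial>pd_measure)
      = c * (\<integral>\<^sup>+s. \<phi> s * ennreal (ig_kernel (d / 2 - real CARD('k)) (v \<bullet> (S *v v)) s) \<partial>lborel)"
proof -
  obtain i where vi: "v$i \<noteq> 0" using v by (auto simp: vec_eq_iff)
  let ?B = "row_mat i v" and ?p = "d / 2 - real CARD('k)"
  let ?S = "?B ** S ** transpose ?B"
  note B = invertible_row_mat[OF vi]
  have UN: "insert i (UNIV - {i}) = UNIV" by auto
  have p: "d / 2 - real (card (UNIV - {i} :: 'k set)) - 1 = ?p"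
    by (simp add: card_Diff_singleton of_nat_diff)
  define q where "q = v \<bullet> (S *v v)"
  have q: "0 < q" unfolding q_def by (rule pos_def_pos[OF S v])
  have Sii: "?S$i$i = q" unfolding q_def by (rule row_mat_congruence_diag)
  define c0 where "c0 = (\<integral>\<^sup>+f. schur_kernel d ?S i (edge_vec i (UNIV - {i}) f) (frame (UNIV - {i}) f)
    \<partial>lborel_on (edges i (UNIV - {i}) \<union> pairs (UNIV - {i})))"
  define w where "w = 1 / \<bar>v$i\<bar> ^ (CARD('k) + 1)"
  define c where "c = ennreal ((det ?B)\<^sup>2 powr (d / 2)) * ennreal w * c0"
  have law: "(\<integral>\<^sup>+\<Sigma>. \<phi> (v \<bullet> (\<Sigma> *v v)) * ennreal (iw_kernel d S \<Sigma>) \<partial>pd_measure)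
      = c * (\<integral>\<^sup>+s. \<phi> s * ennreal (ig_kernel ?p q s) \<partial>lborel)"
    if [measurable]: "\<phi> \<in> borel_measurable borel" for \<phi>
  proof -
    define F where "F M = \<phi> (M$i$i) * pd_kernel d ?S M" for M
    have mF: "F \<in> borel_measurable borel" unfolding F_def by measurable
    have "(\<integral>\<^sup>+\<Sigma>. \<phi> (v \<bullet> (\<Sigma> *v v)) * ennreal (iw_kernel d S \<Sigma>) \<partial>pd_measure)
      = (\<integral>\<^sup>+f. \<phi> (v \<bullet> (frame UNIV f *v v)) * pd_kernel d S (frame UNIV f) \<partial>lborel_on (pairs UNIV))"
      by (rule nn_integral_iw_kernel) measurable
    also have "\<dots> = (\<integral>\<^sup>+f. ennreal ((det ?B)\<^sup>2 powr (d / 2)) * F (?B ** frame UNIV f ** transpose ?B) \<partial>lborel_on (pairs UNIV))"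
      by (intro nn_integral_cong, subst pd_kernel_congruence[OF B])
        (simp add: F_def row_mat_congruence_diag mult_ac)
    also have "\<dots> = ennreal ((det ?B)\<^sup>2 powr (d / 2)) *
        (\<integral>\<^sup>+f. F (?B ** frame UNIV f ** transpose ?B) \<partial>lborel_on (pairs UNIV))"
      by (rule nn_integral_cmult) (use mF measurable_frame_UNIV in measurable)
    also have "(\<integral>\<^sup>+f. F (?B ** frame UNIV f ** transpose ?B) \<partial>lborel_on (pairs UNIV))
      = ennreal w * (\<integral>\<^sup>+f. F (frame UNIV f) \<partial>lborel_on (pairs UNIV))"
    proof -
      have "ennreal w * ennreal (\<bar>v$i\<bar> ^ (CARD('k) + 1)) = 1"
        using vi by (simp add: w_def flip: ennreal_mult'' del: power_Suc)
      then show ?thesis unfolding nn_integral_congruence[OF vi mF]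
        by (simp only: flip: mult.assoc) simp
    qed
    also have "(\<integral>\<^sup>+f. F (frame UNIV f) \<partial>lborel_on (pairs UNIV))
      = (\<integral>\<^sup>+s. \<phi> s * ennreal (ig_kernel ?p q s) \<partial>lborel) * c0"
      using nn_integral_pd_kernel_pivot[of i "UNIV - {i}" \<phi> d ?S] that
      unfolding UN p Sii by (simp add: F_def c0_def)
    finally show ?thesis by (simp add: c_def mult_ac)
  qed
  define g where "g = (\<integral>\<^sup>+s. ennreal (ig_kernel ?p q s) \<partial>lborel)"
  have "0 < ?p" using d by simp
  then have g: "0 < g" "g < \<infinity>" unfolding g_def
    using nn_integral_ig_kernel_pos nn_integral_ig_kernel_finite[OF _ q] by auto
  have e: "c * g = (\<integral>\<^sup>+f. pd_kernel d S (frame UNIV f) \<partial>lborel_on (pairs UNIV))"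
    using law[OF borel_measurable_const, of 1] nn_integral_iw_kernel[OF borel_measurable_const, of 1 d S]
    unfolding mult_1 g_def by metis
  have cg: "0 < c * g" "c * g < \<infinity>"
    unfolding e by (rule nn_integral_pd_kernel_finite_pos[OF S d])+
  have "0 < c" using cg(1) by (simp add: ennreal_zero_less_mult_iff)
  moreover have "c < \<infinity>" using cg(2) g by (auto simp: ennreal_mult_less_top)
  ultimately show ?thesis using law that unfolding q_def by blast
qed


section \<open>Linear forms of a normal vector\<close>

lemma nn_integral_lborel_translate:
  fixes f :: "'a::euclidean_space \<Rightarrow> ennreal"
  assumes "f \<in> borel_measurable borel"
  shows "(\<integral>\<^sup>+x. f (c + x) \<partial>lborel) = (\<integral>\<^sup>+x. f x \<partial>lborel)"
  using assms by (subst (2) lborel_distr_plus[symmetric, of c], subst nn_integral_distr) simp_all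

text \<open>Lebesgue measure on vectors is the product of Lebesgue measures over the basis, so this is the
  Gaussian integral with no coordinate split off.\<close>

lemma nn_integral_mvn_density:
  fixes \<Sigma> :: "real^'k^'k"
  assumes \<Sigma>: "pos_def \<Sigma>"
  shows "(\<integral>\<^sup>+y. ennreal (mvn_density \<mu> \<Sigma> y) \<partial>lborel) = 1"
proof -
  let ?q = "\<lambda>y. y \<bullet> (matrix_inv \<Sigma> *v y)" and ?e = "\<lambda>j :: 'k. axis j (1::real)"
  define c where "c = sqrt ((2 * pi) ^ CARD('k) * det \<Sigma>)"
  have c: "0 < c" using pos_def_det_pos[OF \<Sigma>] by (simp add: c_def)
  have B: "(Basis :: (real^'k) set) = ?e ` UNIV" by (auto simp: Basis_vec_def)
  have inj: "inj_on ?e UNIV" by (auto simp: inj_on_def axis_eq_axis)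
  have rep: "(\<Sum>b\<in>Basis. f b *\<^sub>R b) = on_coords UNIV ?e f" for f :: "real^'k \<Rightarrow> real"
  proof -
    have "(\<Sum>b\<in>Basis. f b *\<^sub>R b) = (\<Sum>j\<in>UNIV. f (?e j) *\<^sub>R ?e j)"
      unfolding B by (rule sum.reindex_cong[OF inj refl]) simp
    then show ?thesis
      by (simp add: vec_eq_iff on_coords_def axis_def if_distrib cong: if_cong)
  qed
  have "(\<integral>\<^sup>+y. ennreal (mvn_density \<mu> \<Sigma> y) \<partial>lborel) = (\<integral>\<^sup>+y. ennreal (mvn_density \<mu> \<Sigma> (\<mu> + y)) \<partial>lborel)"
    by (rule nn_integral_lborel_translate[symmetric]) measurable
  also have "\<dots> = (\<integral>\<^sup>+y. ennreal (1 / c) * ennreal (exp (- 1 / 2 * ?q y)) \<partial>lborel)"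
    using c by (intro nn_integral_cong)
      (simp add: mvn_density_def c_def flip: ennreal_mult'')
  also have "\<dots> = ennreal (1 / c) * (\<integral>\<^sup>+y. ennreal (exp (- 1 / 2 * ?q y)) \<partial>lborel)"
    by (rule nn_integral_cmult) measurable
  also have "(\<integral>\<^sup>+y. ennreal (exp (- 1 / 2 * ?q y)) \<partial>lborel)
      = (\<integral>\<^sup>+f. ennreal (exp (- 1 / 2 * ?q (on_coords UNIV ?e f))) \<partial>lborel_on (?e ` UNIV))"
    by (subst lborel_eq[where 'a = "real^'k"], subst nn_integral_distr)
      (use borel_measurable_on_coords[of ?e UNIV Basis] B in \<open>simp_all add: rep\<close>)
  also have "\<dots> = ennreal c"
    using nn_integral_gaussian_form[OF \<Sigma> _ inj, of 1] by (simp add: c_def)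
  also have "ennreal (1 / c) * ennreal c = 1"
    using c by (simp flip: ennreal_mult'')
  finally show ?thesis .
qed

text \<open>After division by the claimed density of \<open>v \<bullet> y\<close>, the normal density is invariant under
  translations along \<open>\<Sigma> *v v\<close>. Smearing the integrand along this direction with a probability density and
  exchanging the integrals separates \<open>v \<bullet> y\<close> from the rest.\<close>

theorem mvn_form_law:
  fixes \<Sigma> :: "real^'k^'k" and F :: "real \<Rightarrow> ennreal"
  assumes \<Sigma>: "pos_def \<Sigma>" and v: "v \<noteq> 0" and [measurable]: "F \<in> borel_measurable borel"
  shows "(\<integral>\<^sup>+y. F (v \<bullet> y) * ennreal (mvn_density \<mu> \<Sigma> y) \<partial>lborel) =
    (\<integral>\<^sup>+z. F z * ennreal (normal_density (v \<bullet> \<mu>) (sqrt (v \<bullet> (\<Sigma> *v v))) z) \<partial>lborel)"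
proof -
  define s where "s = v \<bullet> (\<Sigma> *v v)"
  have s: "0 < s" unfolding s_def by (rule pos_def_pos[OF \<Sigma> v])
  \<comment> \<open>scaled such that a translation by \<open>t *\<^sub>R u\<close> moves \<open>v \<bullet> y\<close> by \<open>t\<close>\<close>
  define u where "u = (1 / s) *\<^sub>R (\<Sigma> *v v)"
  let ?P = "matrix_inv \<Sigma>"
  note inv = pos_def_invertible[OF \<Sigma>]
  have vu: "v \<bullet> u = 1" using s by (simp add: u_def s_def)
  have Pu: "?P *v u = (1 / s) *\<^sub>R v"
    by (simp add: u_def matrix_vector_mult_scaleR matrix_vector_mul_assoc matrix_inv_inverse[OF inv])
  have Psym: "a \<bullet> (?P *v b) = (?P *v a) \<bullet> b" for a b
    using pos_def_sym[OF pos_def_matrix_inv[OF \<Sigma>]] inner_matrix_vector_transpose[of a ?P b] by simp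
  define x where "x y = v \<bullet> (y - \<mu>)" for y
  define N where "N z = ennreal (normal_density 0 (sqrt s) z)" for z
  define G where "G z = F (z + v \<bullet> \<mu>) * ennreal (exp (- z\<^sup>2 / (2 * s)))" for z
  define H where "H y = ennreal (mvn_density \<mu> \<Sigma> y * exp ((x y)\<^sup>2 / (2 * s)))" for y
  have [measurable]: "x \<in> borel_measurable borel" unfolding x_def by measurable
  have [measurable]: "N \<in> borel_measurable borel" "G \<in> borel_measurable borel" "H \<in> borel_measurable borel"
    unfolding N_def G_def H_def by measurable
  have xt: "x (t *\<^sub>R u + y) = t + x y" for t y
    using vu by (simp add: x_def algebra_simps inner_diff_right inner_add_right)
  have H_inv: "H (t *\<^sub>R u + y) = H y" for t y
  proof -
    define z where "z = y - \<mu>"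
    have uz: "u \<bullet> (?P *v z) = x y / s" "z \<bullet> (?P *v u) = x y / s" "u \<bullet> (?P *v u) = 1 / s"
      using vu by (simp_all add: Psym[of u] Pu x_def z_def inner_commute)
    have quad: "(t *\<^sub>R u + z) \<bullet> (?P *v (t *\<^sub>R u + z)) = z \<bullet> (?P *v z) + (2 * t * x y + t\<^sup>2) / s"
      by (simp add: matrix_vector_right_distrib matrix_vector_mult_scaleR inner_add_left inner_add_right
          uz power2_eq_square) (simp add: algebra_simps add_divide_distrib)
    have expo: "- (z \<bullet> (?P *v z) + (2 * t * x y + t\<^sup>2) / s) / 2 + (t + x y)\<^sup>2 / (2 * s)
        = - (z \<bullet> (?P *v z)) / 2 + (x y)\<^sup>2 / (2 * s)"
      using s by (simp add: field_simps power2_eq_square)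
    have dens: "mvn_density \<mu> \<Sigma> y = exp (- (z \<bullet> (?P *v z)) / 2) / sqrt ((2 * pi) ^ CARD('k) * det \<Sigma>)"
      "mvn_density \<mu> \<Sigma> (t *\<^sub>R u + y) =
        exp (- ((t *\<^sub>R u + z) \<bullet> (?P *v (t *\<^sub>R u + z))) / 2) / sqrt ((2 * pi) ^ CARD('k) * det \<Sigma>)"
      unfolding mvn_density_def z_def add_diff_eq by (rule refl)+
    show ?thesis
      unfolding H_def dens xt by (simp only: times_divide_eq_left exp_add[symmetric] quad expo)
  qed
  have FH: "F (v \<bullet> y) * ennreal (mvn_density \<mu> \<Sigma> y) = G (x y) * H y" for y
  proof -
    have "mvn_density \<mu> \<Sigma> y = exp (- (x y)\<^sup>2 / (2 * s)) * (mvn_density \<mu> \<Sigma> y * exp ((x y)\<^sup>2 / (2 * s)))"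
      by (simp add: mult.left_commute flip: exp_add)
    then have "ennreal (mvn_density \<mu> \<Sigma> y) = ennreal (exp (- (x y)\<^sup>2 / (2 * s))) * H y"
      unfolding H_def by (metis ennreal_mult' exp_ge_zero)
    moreover have "x y + v \<bullet> \<mu> = v \<bullet> y" by (simp add: x_def inner_diff_right)
    ultimately show ?thesis by (simp add: G_def mult.assoc)
  qed
  have N1: "(\<integral>\<^sup>+t. N (x y + t) \<partial>lborel) = 1" for y
  proof -
    have "(\<integral>\<^sup>+t. N (x y + t) \<partial>lborel) = (\<integral>\<^sup>+t. N t \<partial>lborel)"
      by (rule nn_integral_lborel_translate) measurable
    also have "\<dots> = emeasure (density lborel (normal_density 0 (sqrt s))) (space lborel)"
      by (simp add: emeasure_density N_def)
    also have "\<dots> = 1"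
      using prob_space.emeasure_space_1[OF prob_space_normal_density[of "sqrt s" 0]] s by simp
    finally show ?thesis .
  qed
  have HN: "H y * N (x y) = ennreal (1 / sqrt (2 * pi * s)) * ennreal (mvn_density \<mu> \<Sigma> y)" for y
  proof -
    have "mvn_density \<mu> \<Sigma> y * exp ((x y)\<^sup>2 / (2 * s)) * normal_density 0 (sqrt s) (x y)
        = 1 / sqrt (2 * pi * s) * mvn_density \<mu> \<Sigma> y"
      using s by (simp add: normal_density_def flip: exp_add)
    then show ?thesis unfolding H_def N_def using s
      by (metis ennreal_mult' ennreal_mult'' normal_density_nonneg divide_nonneg_nonneg real_sqrt_ge_zero
          zero_le_one mult_nonneg_nonneg less_imp_le pi_gt_zero zero_le_numeral)
  qed
  have "(\<integral>\<^sup>+y. F (v \<bullet> y) * ennreal (mvn_density \<mu> \<Sigma> y) \<partial>lborel)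
      = (\<integral>\<^sup>+y. \<integral>\<^sup>+t. G (x y) * H y * N (x y + t) \<partial>lborel \<partial>lborel)"
    by (simp add: FH nn_integral_cmult N1)
  also have "\<dots> = (\<integral>\<^sup>+t. \<integral>\<^sup>+y. G (x y) * H y * N (x y + t) \<partial>lborel \<partial>lborel)"
    by (rule lborel_pair.Fubini') measurable
  also have "\<dots> = (\<integral>\<^sup>+t. \<integral>\<^sup>+y. G (- t + x y) * H y * N (x y) \<partial>lborel \<partial>lborel)"
  proof (rule nn_integral_cong)
    fix t :: real
    have "(\<integral>\<^sup>+y. G (x y) * H y * N (x y + t) \<partial>lborel)
        = (\<integral>\<^sup>+y. G (x ((- t) *\<^sub>R u + y)) * H ((- t) *\<^sub>R u + y) * N (x ((- t) *\<^sub>R u + y) + t) \<partial>lborel)"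
      by (rule nn_integral_lborel_translate[symmetric]) measurable
    then show "(\<integral>\<^sup>+y. G (x y) * H y * N (x y + t) \<partial>lborel) = (\<integral>\<^sup>+y. G (- t + x y) * H y * N (x y) \<partial>lborel)"
      by (simp only: H_inv xt) simp
  qed
  also have "\<dots> = (\<integral>\<^sup>+y. \<integral>\<^sup>+t. G (- t + x y) * H y * N (x y) \<partial>lborel \<partial>lborel)"
    by (rule lborel_pair.Fubini') measurable
  also have "\<dots> = (\<integral>\<^sup>+y. (\<integral>\<^sup>+t. G t \<partial>lborel) * (H y * N (x y)) \<partial>lborel)"
  proof (rule nn_integral_cong)
    fix y
    have "(\<integral>\<^sup>+t. G t \<partial>lborel) = (\<integral>\<^sup>+t. G (- t + x y) \<partial>lborel)"
      by (subst nn_integral_real_affine[where c = "-1" and t = "x y"]) (simp_all add: add.commute)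
    then show "(\<integral>\<^sup>+t. G (- t + x y) * H y * N (x y) \<partial>lborel) = (\<integral>\<^sup>+t. G t \<partial>lborel) * (H y * N (x y))"
      by (simp add: mult.assoc nn_integral_multc)
  qed
  also have "\<dots> = (\<integral>\<^sup>+t. G t \<partial>lborel) * ennreal (1 / sqrt (2 * pi * s))"
    by (simp only: HN) (simp add: nn_integral_cmult nn_integral_mvn_density[OF \<Sigma>])
  also have "\<dots> = (\<integral>\<^sup>+t. F (v \<bullet> \<mu> + t) * ennreal (normal_density (v \<bullet> \<mu>) (sqrt s) (v \<bullet> \<mu> + t)) \<partial>lborel)"
  proof -
    have "normal_density (v \<bullet> \<mu>) (sqrt s) (v \<bullet> \<mu> + t) = exp (- t\<^sup>2 / (2 * s)) * (1 / sqrt (2 * pi * s))" for t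
      using s by (simp add: normal_density_def)
    then have "ennreal (normal_density (v \<bullet> \<mu>) (sqrt s) (v \<bullet> \<mu> + t))
        = ennreal (exp (- t\<^sup>2 / (2 * s))) * ennreal (1 / sqrt (2 * pi * s))" for t
      by (metis ennreal_mult' exp_ge_zero)
    then have "F (v \<bullet> \<mu> + t) * ennreal (normal_density (v \<bullet> \<mu>) (sqrt s) (v \<bullet> \<mu> + t))
        = G t * ennreal (1 / sqrt (2 * pi * s))" for t
      by (simp add: G_def mult.assoc add.commute)
    then show ?thesis by (simp add: nn_integral_multc)
  qed
  also have "\<dots> = (\<integral>\<^sup>+z. F z * ennreal (normal_density (v \<bullet> \<mu>) (sqrt s) z) \<partial>lborel)"
    by (rule nn_integral_lborel_translate) measurable
  finally show ?thesis by (simp add: s_def)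
qed


section \<open>Normal mixtures over an inverse gamma variance\<close>

lemma borel_measurable_normal_density' [measurable (raw)]:
  assumes [measurable]: "f \<in> borel_measurable M" "g \<in> borel_measurable M" "h \<in> borel_measurable M"
  shows "(\<lambda>x. normal_density (f x) (g x) (h x)) \<in> borel_measurable M"
  unfolding normal_density_def by measurable

lemma borel_measurable_ig_kernel' [measurable (raw)]:
  assumes [measurable]: "f \<in> borel_measurable M" "g \<in> borel_measurable M"
  shows "(\<lambda>x. ig_kernel p (f x) (g x)) \<in> borel_measurable M"
  unfolding ig_kernel_def by measurable

lemma ig_kernel_normal:
  assumes r: "0 < r"
  shows "ig_kernel p q s * normal_density m (sqrt (s / r)) a * normal_density a (sqrt s) z =
    sqrt r / (2 * pi) * ig_kernel (p + 1) (q + r * (a - m)\<^sup>2 + (z - a)\<^sup>2) s"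
proof (cases "0 < s")
  case True
  have "sqrt (2 * pi * (s / r)) * sqrt (2 * pi * s) = 2 * pi * s / sqrt r"
  proof -
    have "2 * pi * (s / r) * (2 * pi * s) = (2 * pi * s)\<^sup>2 / r" by (simp add: power2_eq_square)
    then have "sqrt (2 * pi * (s / r) * (2 * pi * s)) = sqrt ((2 * pi * s)\<^sup>2) / sqrt r"
      by (simp only: real_sqrt_divide)
    then show ?thesis using True by (simp only: real_sqrt_mult[of "2 * pi * (s / r)"] real_sqrt_abs) simp
  qed
  then have n: "1 / sqrt (2 * pi * (s / r)) * (1 / sqrt (2 * pi * s)) = sqrt r / (2 * pi) * s powr (- 1)"
    using True by (simp add: powr_minus_divide)
  have e: "- q / (2 * s) + - (a - m)\<^sup>2 / (2 * (s / r)) + - (z - a)\<^sup>2 / (2 * s)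
      = - (q + r * (a - m)\<^sup>2 + (z - a)\<^sup>2) / (2 * s)"
    using True r by (simp add: field_simps)
  have p: "s powr (- p - 1) * s powr (- 1) = s powr (- (p + 1) - 1)"
    by (subst powr_add[symmetric]) simp
  have "ig_kernel p q s * normal_density m (sqrt (s / r)) a * normal_density a (sqrt s) z =
    s powr (- p - 1) * (1 / sqrt (2 * pi * (s / r)) * (1 / sqrt (2 * pi * s))) *
      (exp (- q / (2 * s)) * exp (- (a - m)\<^sup>2 / (2 * (s / r))) * exp (- (z - a)\<^sup>2 / (2 * s)))"
    using True r by (simp add: ig_kernel_def normal_density_def)
  also have "\<dots> = sqrt r / (2 * pi) * (s powr (- p - 1) * s powr (- 1)) *
      exp (- (q + r * (a - m)\<^sup>2 + (z - a)\<^sup>2) / (2 * s))"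
    unfolding n by (simp only: flip: exp_add e) (simp only: mult_ac)
  finally show ?thesis using True unfolding p by (simp add: ig_kernel_def)
qed (simp add: ig_kernel_def)

text \<open>The variance is integrated out first, which leaves a power of \<open>q + r (a - m)\<^sup>2 + (z - a)\<^sup>2\<close>. The
  substitutions for \<open>a\<close> and \<open>z\<close> factor it into the kernels of the two \<open>t\<close>-densities; the factor
  \<open>sqrt (1 + y1\<^sup>2 / \<nu>)\<close> from \<open>dz\<close> corrects the exponent of the first kernel.\<close>

theorem normal_inverse_gamma_predictive:
  fixes m q r \<nu> :: real
  defines "T \<equiv> \<lambda>y1 y2. m + sqrt q * (y1 / sqrt (r * \<nu>) + sqrt (1 + y1\<^sup>2 / \<nu>) * (y2 / sqrt (\<nu> + 1)))"
  assumes \<nu>: "0 < \<nu>" and q: "0 < q" and r: "0 < r"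
  obtains K where "0 < K" "K < \<infinity>"
    "\<And>h. h \<in> borel_measurable borel \<Longrightarrow>
      (\<integral>\<^sup>+s. (\<integral>\<^sup>+a. (\<integral>\<^sup>+z. h z * ennreal (normal_density a (sqrt s) z) \<partial>lborel) *
          ennreal (normal_density m (sqrt (s / r)) a) \<partial>lborel) * ennreal (ig_kernel (\<nu> / 2) q s) \<partial>lborel)
      = K * (\<integral>\<^sup>+y1. \<integral>\<^sup>+y2. h (T y1 y2) * ennreal (student_t_density (\<nu> + 1) y2) *
          ennreal (student_t_density \<nu> y1) \<partial>lborel \<partial>lborel)"
proof -
  let ?st = student_t_density
  define p where "p = \<nu> / 2 + 1"
  define g where "g = (\<integral>\<^sup>+s. ennreal (ig_kernel p 1 s) \<partial>lborel)"
  have g: "0 < g" "g < \<infinity>" unfolding g_def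
    using nn_integral_ig_kernel_pos nn_integral_ig_kernel_finite[of p 1] \<nu> by (auto simp: p_def)
  define k where "k d = Gamma ((d + 1) / 2) / (sqrt (d * pi) * Gamma (d / 2))" for d :: real
  have k: "0 < k d" if "0 < d" for d
    using that by (simp add: k_def Gamma_real_pos)
  have st: "0 \<le> ?st d y" if "0 < d" for d y
    using k[OF that] unfolding student_t_density_def k_def
    by (intro mult_nonneg_nonneg) (auto intro: less_imp_le)
  define \<alpha> where "\<alpha> = sqrt q / sqrt (r * \<nu>)"
  have \<alpha>: "0 < \<alpha>" using q r \<nu> by (simp add: \<alpha>_def)
  define \<beta> where "\<beta> y = sqrt q * sqrt (1 + y\<^sup>2 / \<nu>) / sqrt (\<nu> + 1)" for y
  have pos: "0 < 1 + y\<^sup>2 / d" if "0 < d" for y d :: real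
    using that by (simp add: add_pos_nonneg)
  have \<beta>: "0 < \<beta> y" for y using q \<nu> pos[OF \<nu>, of y] by (simp add: \<beta>_def)
  have T: "T y1 y2 = m + \<alpha> * y1 + \<beta> y1 * y2" for y1 y2
    by (simp add: T_def \<alpha>_def \<beta>_def algebra_simps)
  define c where "c = sqrt r / (2 * pi)"
  have c: "0 < c" using r by (simp add: c_def)
  define C where "C = c * \<alpha> * (sqrt q / sqrt (\<nu> + 1)) * q powr (- p) / (k \<nu> * k (\<nu> + 1))"
  have C: "0 < C" using c \<alpha> q \<nu> k[of \<nu>] k[of "\<nu> + 1"] by (simp add: C_def)
  define Q where "Q a z = q + r * (a - m)\<^sup>2 + (z - a)\<^sup>2" for a z
  have Q: "0 < Q a z" for a z using q r by (simp add: Q_def add_pos_nonneg)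
  have QT: "Q (m + \<alpha> * y1) (T y1 y2) = q * (1 + y1\<^sup>2 / \<nu>) * (1 + y2\<^sup>2 / (\<nu> + 1))" for y1 y2
  proof -
    define u w where "u = y1\<^sup>2 / \<nu>" and "w = y2\<^sup>2 / (\<nu> + 1)"
    have "r * (\<alpha> * y1)\<^sup>2 = q * u"
      using q r \<nu> by (simp add: u_def \<alpha>_def power_mult_distrib power_divide real_sqrt_mult)
    moreover have "(\<beta> y1 * y2)\<^sup>2 = q * (1 + u) * w"
      using q \<nu> pos[OF \<nu>, of y1] by (simp add: u_def w_def \<beta>_def power_mult_distrib power_divide)
    ultimately show ?thesis unfolding u_def[symmetric] w_def[symmetric]
      by (simp add: T Q_def algebra_simps)
  qed
  have dens: "\<alpha> * (\<beta> y1 * (c * Q (m + \<alpha> * y1) (T y1 y2) powr (- p))) = C * (?st (\<nu> + 1) y2 * ?st \<nu> y1)" for y1 y2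
  proof -
    let ?A = "1 + y1\<^sup>2 / \<nu>" and ?B = "1 + y2\<^sup>2 / (\<nu> + 1)"
    have A: "0 < ?A" and B: "0 < ?B" using pos[OF \<nu>] pos[of "\<nu> + 1"] \<nu> by auto
    have "1 / 2 + - p = - (\<nu> + 1) / 2" by (simp add: p_def field_simps)
    then have "sqrt ?A * ?A powr (- p) = ?A powr (- (\<nu> + 1) / 2)"
      using powr_add[of ?A "1 / 2" "- p"] A by (simp only: powr_half_sqrt less_imp_le)
    moreover have "- p = - (\<nu> + 1 + 1) / 2" by (simp add: p_def field_simps)
    then have "?B powr (- p) = ?B powr (- (\<nu> + 1 + 1) / 2)" by (simp only:)
    moreover have "(q * ?A * ?B) powr (- p) = q powr (- p) * ?A powr (- p) * ?B powr (- p)"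
      using q A B by (simp add: powr_mult)
    ultimately have "\<beta> y1 * (q * ?A * ?B) powr (- p) = (sqrt q / sqrt (\<nu> + 1)) * q powr (- p) *
        (?A powr (- (\<nu> + 1) / 2) * ?B powr (- (\<nu> + 1 + 1) / 2))"
      by (simp add: \<beta>_def)
    then have "c * \<alpha> * (\<beta> y1 * (q * ?A * ?B) powr (- p)) = C * ((k \<nu> * ?A powr (- (\<nu> + 1) / 2)) *
        (k (\<nu> + 1) * ?B powr (- (\<nu> + 1 + 1) / 2)))"
      using k[of \<nu>] k[of "\<nu> + 1"] \<nu> by (simp add: C_def mult.assoc)
    then show ?thesis unfolding QT by (simp add: student_t_density_def k_def mult_ac)
  qed
  have main: "(\<integral>\<^sup>+s. (\<integral>\<^sup>+a. (\<integral>\<^sup>+z. h z * ennreal (normal_density a (sqrt s) z) \<partial>lborel) *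
          ennreal (normal_density m (sqrt (s / r)) a) \<partial>lborel) * ennreal (ig_kernel (\<nu> / 2) q s) \<partial>lborel)
      = (ennreal C * g) * (\<integral>\<^sup>+y1. \<integral>\<^sup>+y2. h (T y1 y2) * ennreal (?st (\<nu> + 1) y2) * ennreal (?st \<nu> y1) \<partial>lborel \<partial>lborel)"
    (is "?mix = _")
    if [measurable]: "h \<in> borel_measurable borel" for h
  proof -
    have [measurable]: "(\<lambda>x. Q (f x) (f' x)) \<in> borel_measurable M"
      if [measurable]: "f \<in> borel_measurable M" "f' \<in> borel_measurable M" for f f' and M :: "'z measure"
      unfolding Q_def by measurable
    define V where "V a z = h z * ennreal (c * Q a z powr (- p)) * g" for a z
    have [measurable]: "(\<lambda>x. V (f x) (f' x)) \<in> borel_measurable M"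
      if [measurable]: "f \<in> borel_measurable M" "f' \<in> borel_measurable M" for f f' and M :: "'z measure"
      unfolding V_def by measurable
    have "?mix = (\<integral>\<^sup>+s. \<integral>\<^sup>+a. \<integral>\<^sup>+z. h z * ennreal c * ennreal (ig_kernel p (Q a z) s) \<partial>lborel \<partial>lborel \<partial>lborel)"
    proof (rule nn_integral_cong)
      fix s :: real
      have eq: "h z * ennreal (normal_density a (sqrt s) z) * ennreal (normal_density m (sqrt (s / r)) a) *
          ennreal (ig_kernel (\<nu> / 2) q s) = h z * ennreal c * ennreal (ig_kernel p (Q a z) s)" for a z
      proof -
        have "ennreal (normal_density a (sqrt s) z) * (ennreal (normal_density m (sqrt (s / r)) a) *
          ennreal (ig_kernel (\<nu> / 2) q s)) = ennreal c * ennreal (ig_kernel p (Q a z) s)"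
          using ig_kernel_normal[OF r, of "\<nu> / 2" q s m a z] c
          by (simp add: p_def Q_def c_def ig_kernel_nonneg mult_ac flip: ennreal_mult)
        then show ?thesis by (simp only: mult.assoc)
      qed
      show "(\<integral>\<^sup>+a. (\<integral>\<^sup>+z. h z * ennreal (normal_density a (sqrt s) z) \<partial>lborel) *
          ennreal (normal_density m (sqrt (s / r)) a) \<partial>lborel) * ennreal (ig_kernel (\<nu> / 2) q s)
        = (\<integral>\<^sup>+a. \<integral>\<^sup>+z. h z * ennreal c * ennreal (ig_kernel p (Q a z) s) \<partial>lborel \<partial>lborel)"
        unfolding eq[symmetric] by (simp add: nn_integral_multc)
    qed
    also have "\<dots> = (\<integral>\<^sup>+a. \<integral>\<^sup>+s. \<integral>\<^sup>+z. h z * ennreal c * ennreal (ig_kernel p (Q a z) s) \<partial>lborel \<partial>lborel \<partial>lborel)"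
      by (rule lborel_pair.Fubini') measurable
    also have "\<dots> = (\<integral>\<^sup>+a. \<integral>\<^sup>+z. \<integral>\<^sup>+s. h z * ennreal c * ennreal (ig_kernel p (Q a z) s) \<partial>lborel \<partial>lborel \<partial>lborel)"
      by (intro nn_integral_cong lborel_pair.Fubini') measurable
    also have "\<dots> = (\<integral>\<^sup>+a. \<integral>\<^sup>+z. V a z \<partial>lborel \<partial>lborel)"
    proof (intro nn_integral_cong)
      fix a z :: real
      have "(\<integral>\<^sup>+s. h z * ennreal c * ennreal (ig_kernel p (Q a z) s) \<partial>lborel)
          = h z * ennreal c * (ennreal (Q a z powr (- p)) * g)"
        unfolding g_def nn_integral_ig_kernel_scale[OF Q, symmetric] by (rule nn_integral_cmult) measurable
      then show "(\<integral>\<^sup>+s. h z * ennreal c * ennreal (ig_kernel p (Q a z) s) \<partial>lborel) = V a z"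
        using c by (simp only: V_def ennreal_mult' less_imp_le mult.assoc)
    qed
    also have "\<dots> = (\<integral>\<^sup>+y1. ennreal \<alpha> * (\<integral>\<^sup>+z. V (m + \<alpha> * y1) z \<partial>lborel) \<partial>lborel)"
      using \<alpha> by (subst nn_integral_real_affine[where c = \<alpha> and t = m]) (simp_all add: nn_integral_cmult)
    also have "\<dots> = (\<integral>\<^sup>+y1. ennreal \<alpha> * (ennreal (\<beta> y1) * (\<integral>\<^sup>+y2. V (m + \<alpha> * y1) (T y1 y2) \<partial>lborel)) \<partial>lborel)"
    proof (intro nn_integral_cong arg_cong2[where f = "(*)"] refl)
      fix y1
      show "(\<integral>\<^sup>+z. V (m + \<alpha> * y1) z \<partial>lborel) = ennreal (\<beta> y1) * (\<integral>\<^sup>+y2. V (m + \<alpha> * y1) (T y1 y2) \<partial>lborel)"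
        using \<beta>[of y1] unfolding T
        by (subst nn_integral_real_affine[where c = "\<beta> y1" and t = "m + \<alpha> * y1"]) simp_all
    qed
    also have "\<dots> = (\<integral>\<^sup>+y1. \<integral>\<^sup>+y2. (ennreal C * g) * (h (T y1 y2) * ennreal (?st (\<nu> + 1) y2) * ennreal (?st \<nu> y1)) \<partial>lborel \<partial>lborel)"
    proof (rule nn_integral_cong)
      fix y1
      have [measurable]: "T y1 \<in> borel_measurable borel" unfolding T_def by measurable
      have pt: "ennreal \<alpha> * (ennreal (\<beta> y1) * V (m + \<alpha> * y1) (T y1 y2))
        = (ennreal C * g) * (h (T y1 y2) * ennreal (?st (\<nu> + 1) y2) * ennreal (?st \<nu> y1))" for y2
      proof -
        have "ennreal \<alpha> * (ennreal (\<beta> y1) * ennreal (c * Q (m + \<alpha> * y1) (T y1 y2) powr (- p)))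
          = ennreal (C * (?st (\<nu> + 1) y2 * ?st \<nu> y1))"
          unfolding dens[symmetric] using \<alpha> \<beta>[of y1] by (simp only: ennreal_mult' less_imp_le)
        also have "\<dots> = ennreal C * (ennreal (?st (\<nu> + 1) y2) * ennreal (?st \<nu> y1))"
          using C st[of "\<nu> + 1"] st[of \<nu>] \<nu> by (simp add: ennreal_mult)
        finally have e: "ennreal \<alpha> * (ennreal (\<beta> y1) * ennreal (c * Q (m + \<alpha> * y1) (T y1 y2) powr (- p)))
          = ennreal C * (ennreal (?st (\<nu> + 1) y2) * ennreal (?st \<nu> y1))" .
        have "ennreal \<alpha> * (ennreal (\<beta> y1) * V (m + \<alpha> * y1) (T y1 y2))
          = (ennreal \<alpha> * (ennreal (\<beta> y1) * ennreal (c * Q (m + \<alpha> * y1) (T y1 y2) powr (- p)))) * (h (T y1 y2) * g)"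
          unfolding V_def by (simp only: mult_ac)
        then show ?thesis unfolding e by (simp only: mult_ac)
      qed
      show "ennreal \<alpha> * (ennreal (\<beta> y1) * (\<integral>\<^sup>+y2. V (m + \<alpha> * y1) (T y1 y2) \<partial>lborel))
       = (\<integral>\<^sup>+y2. (ennreal C * g) * (h (T y1 y2) * ennreal (?st (\<nu> + 1) y2) * ennreal (?st \<nu> y1)) \<partial>lborel)"
        unfolding pt[symmetric] by (simp add: nn_integral_cmult)
    qed
    also have "\<dots> = (ennreal C * g) * (\<integral>\<^sup>+y1. \<integral>\<^sup>+y2. h (T y1 y2) * ennreal (?st (\<nu> + 1) y2) * ennreal (?st \<nu> y1) \<partial>lborel \<partial>lborel)"
      unfolding student_t_density_def T_def by (simp add: nn_integral_cmult)
    finally show ?thesis .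
  qed
  have "0 < ennreal C * g" "ennreal C * g < \<infinity>"
    using C g by (simp_all add: ennreal_zero_less_mult_iff ennreal_mult_less_top)
  then show ?thesis using main that by blast
qed


section \<open>Conjugacy\<close>

lemma finite_window [simp]: "finite (window t n)"
  and card_window [simp]: "card (window t n) = n"
  by (simp_all add: window_def)

lemma S_d_eq_sum:
  assumes "n \<noteq> 1"
  shows "S_d t n x = (\<Sum>i\<in>window t n. outer (x i - sample_mean t n x) (x i - sample_mean t n x))"
  using assms by (simp add: S_d_def sample_cov_def)

lemma sum_centered:
  assumes "n \<noteq> 0"
  shows "(\<Sum>i\<in>window t n. x i - sample_mean t n x) = 0"
  using assms by (simp add: sum_subtractf sample_mean_def sum_constant_scaleR del: sum_constant)

lemma trace_sum_mult: "trace ((\<Sum>i\<in>I. A i) ** N) = (\<Sum>i\<in>I. trace (A i ** N))"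
  for N :: "real^'k^'k"
proof (induction I rule: infinite_finite_induct)
  case (insert i I)
  then show ?case by (simp add: trace_mult_linear)
qed (simp_all add: trace_def matrix_matrix_mult_def)

lemma sum_mult_vector: "(\<Sum>i\<in>I. A i) *v x = (\<Sum>i\<in>I. A i *v x)"
  for A :: "'i \<Rightarrow> real^'k^'k"
  by (induction I rule: infinite_finite_induct) (simp_all add: matrix_vector_mult_add_rdistrib)

lemma mult_sum_vector: "A *v (\<Sum>i\<in>I. x i) = (\<Sum>i\<in>I. A *v x i)"
  for A :: "real^'k^'k"
  by (rule linear_sum) simp

lemma S_d_form:
  assumes "n \<noteq> 1"
  shows "v \<bullet> (S_d t n x *v v) = (\<Sum>i\<in>window t n. (v \<bullet> (x i - sample_mean t n x))\<^sup>2)"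
  unfolding S_d_eq_sum[OF assms]
  by (simp add: sum_mult_vector outer_mult_vector inner_sum_right power2_eq_square inner_commute)

lemma transpose_S_d:
  assumes "n \<noteq> 1"
  shows "transpose (S_d t n x) = S_d t n x"
  unfolding S_d_eq_sum[OF assms] by (simp add: vec_eq_iff transpose_def outer_def mult.commute)

lemma sum_form_decomposition:
  fixes P :: "real^'k^'k"
  assumes P: "transpose P = P" and n: "n \<noteq> 0" "n \<noteq> 1"
  shows "(\<Sum>i\<in>window t n. (x i - \<mu>) \<bullet> (P *v (x i - \<mu>))) =
    real n * ((\<mu> - sample_mean t n x) \<bullet> (P *v (\<mu> - sample_mean t n x))) + trace (S_d t n x ** P)"
proof -
  define m where "m = sample_mean t n x"
  define \<delta> where "\<delta> = \<mu> - m"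
  have sym: "a \<bullet> (P *v b) = b \<bullet> (P *v a)" for a b
    using inner_matrix_vector_transpose[of a P b] P by (simp add: inner_commute)
  have "(c - \<delta>) \<bullet> (P *v (c - \<delta>)) = c \<bullet> (P *v c) - 2 * (\<delta> \<bullet> (P *v c)) + \<delta> \<bullet> (P *v \<delta>)" for c
    by (simp add: matrix_vector_mult_diff_distrib inner_diff_left inner_diff_right sym[of c \<delta>])
  moreover have "x i - \<mu> = (x i - m) - \<delta>" for i by (simp add: \<delta>_def)
  ultimately have "(x i - \<mu>) \<bullet> (P *v (x i - \<mu>))
      = (x i - m) \<bullet> (P *v (x i - m)) - 2 * (\<delta> \<bullet> (P *v (x i - m))) + \<delta> \<bullet> (P *v \<delta>)" for i
    by metis
  moreover have "(\<Sum>i\<in>window t n. \<delta> \<bullet> (P *v (x i - m))) = 0"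
    using sum_centered[OF n(1), of x t] by (simp add: m_def flip: inner_sum_right mult_sum_vector)
  moreover have "trace (S_d t n x ** P) = (\<Sum>i\<in>window t n. (x i - m) \<bullet> (P *v (x i - m)))"
    unfolding S_d_eq_sum[OF n(2)] trace_sum_mult by (simp add: trace_outer_mult m_def)
  ultimately show ?thesis
    by (simp add: sum.distrib sum_subtractf \<delta>_def m_def flip: sum_distrib_left)
qed

lemma likelihood_eq:
  fixes \<Sigma> :: "real^'k^'k"
  assumes \<Sigma>: "pos_def \<Sigma>" and n: "n \<noteq> 0" "n \<noteq> 1"
  shows "likelihood t n x \<mu> \<Sigma> = ((2 * pi) ^ CARD('k)) powr (- real n / 2) * det \<Sigma> powr (- real n / 2) *
    exp (- (real n * ((\<mu> - sample_mean t n x) \<bullet> (matrix_inv \<Sigma> *v (\<mu> - sample_mean t n x)))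
      + trace (S_d t n x ** matrix_inv \<Sigma>)) / 2)"
proof -
  define D where "D = (2 * pi) ^ CARD('k) * det \<Sigma>"
  let ?P = "matrix_inv \<Sigma>"
  have D: "0 < D" using pos_def_det_pos[OF \<Sigma>] by (simp add: D_def)
  have "likelihood t n x \<mu> \<Sigma> = (\<Prod>i\<in>window t n. exp (- ((x i - \<mu>) \<bullet> (?P *v (x i - \<mu>))) / 2)) / sqrt D ^ n"
    by (simp add: likelihood_def mvn_density_def D_def prod_dividef)
  also have "(\<Prod>i\<in>window t n. exp (- ((x i - \<mu>) \<bullet> (?P *v (x i - \<mu>))) / 2))
      = exp (- (\<Sum>i\<in>window t n. (x i - \<mu>) \<bullet> (?P *v (x i - \<mu>))) / 2)"
    by (simp add: exp_sum[symmetric] sum_divide_distrib sum_negf)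
  also have "sqrt D ^ n = D powr (real n / 2)"
    using D by (simp add: powr_half_sqrt[symmetric] powr_powr flip: powr_realpow)
  finally have "likelihood t n x \<mu> \<Sigma> = D powr (- real n / 2) *
      exp (- (\<Sum>i\<in>window t n. (x i - \<mu>) \<bullet> (?P *v (x i - \<mu>))) / 2)"
    by (simp add: powr_minus_divide)
  then show ?thesis
    unfolding sum_form_decomposition[OF pos_def_sym[OF pos_def_matrix_inv[OF \<Sigma>]] n]
    using pos_def_det_pos[OF \<Sigma>] by (simp add: D_def powr_mult)
qed

lemma pos_def_scaleR:
  assumes "pos_def A" "0 < c"
  shows "pos_def (c *\<^sub>R A)"
proof -
  have "v \<bullet> ((c *\<^sub>R A) *v v) = c * (v \<bullet> (A *v v))" for v
    using scaleR_matrix_vector_assoc[of c A v] by (metis inner_scaleR_right)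
  then show ?thesis using assms by (simp add: pos_def_def transpose_scalar)
qed

lemma det_scaleR: "det (c *\<^sub>R A) = c ^ CARD('k) * det A"
  for A :: "real^'k^'k"
proof -
  have "c *\<^sub>R A = matrix ((*\<^sub>R) c) ** A"
    by (simp add: matrix_scaleR vec_eq_iff matrix_matrix_mult_def mat_def if_distrib if_distribR cong: if_cong)
  then show ?thesis by (simp add: det_mul)
qed

lemma mvn_density_scaled:
  fixes \<Sigma> :: "real^'k^'k"
  assumes \<Sigma>: "pos_def \<Sigma>" and r: "0 < r"
  shows "mvn_density m ((1 / r) *\<^sub>R \<Sigma>) \<mu> = sqrt ((r / (2 * pi)) ^ CARD('k)) * det \<Sigma> powr (- 1 / 2) *
    exp (- (r * ((\<mu> - m) \<bullet> (matrix_inv \<Sigma> *v (\<mu> - m)))) / 2)"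
proof -
  have "matrix_inv ((1 / r) *\<^sub>R \<Sigma>) = r *\<^sub>R matrix_inv \<Sigma>"
  proof (rule matrix_inv_right_eq)
    have "((1 / r) *\<^sub>R \<Sigma>) ** (r *\<^sub>R matrix_inv \<Sigma>) = \<Sigma> ** matrix_inv \<Sigma>"
      using r by (simp add: vec_eq_iff matrix_matrix_mult_def)
    then show "((1 / r) *\<^sub>R \<Sigma>) ** (r *\<^sub>R matrix_inv \<Sigma>) = mat 1"
      by (simp add: matrix_inv_inverse[OF pos_def_invertible[OF \<Sigma>]])
  qed
  then have q: "(\<mu> - m) \<bullet> (matrix_inv ((1 / r) *\<^sub>R \<Sigma>) *v (\<mu> - m)) = r * ((\<mu> - m) \<bullet> (matrix_inv \<Sigma> *v (\<mu> - m)))"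
    by (simp flip: scaleR_matrix_vector_assoc)
  have D: "0 < det \<Sigma>" by (rule pos_def_det_pos[OF \<Sigma>])
  have c: "1 / sqrt ((2 * pi) ^ CARD('k) * det ((1 / r) *\<^sub>R \<Sigma>)) = sqrt ((r / (2 * pi)) ^ CARD('k)) * det \<Sigma> powr (- 1 / 2)"
    using D r by (simp add: det_scaleR real_sqrt_mult real_sqrt_divide powr_minus_divide powr_half_sqrt
        power_divide)
  have yz: "y / z = 1 / z * y" for y z :: real by simp
  show ?thesis unfolding mvn_density_def q c[symmetric] by (rule yz)
qed

text \<open>By \<open>likelihood_eq\<close> the likelihood is already a normal inverse Wishart kernel. The factor
  \<open>det \<Sigma> powr (- 1 / 2)\<close> that normalises the density of \<open>\<mu>\<close> is taken from the power of the
  determinant, so that the degree is \<open>n + (k + 1) - 1\<close>.\<close>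

lemma diffuse_posterior_kernel:
  fixes x :: "int \<Rightarrow> real^'k"
  assumes n: "CARD('k) < n"
  obtains C where "0 < C"
    "\<And>\<mu> \<Sigma>. pos_def \<Sigma> \<Longrightarrow> likelihood t n x \<mu> \<Sigma> * diffuse_prior \<mu> (\<Sigma> :: real^'k^'k) =
      C * (mvn_density (mean_d t n x) ((1 / real n) *\<^sub>R \<Sigma>) \<mu> * iw_kernel (real n + real CARD('k)) (S_d t n x) \<Sigma>)"
proof -
  have n01: "n \<noteq> 0" "n \<noteq> 1" using n zero_less_card_finite[where 'a='k] by linarith+
  define c where "c = sqrt ((real n / (2 * pi)) ^ CARD('k))"
  define C where "C = ((2 * pi) ^ CARD('k)) powr (- real n / 2) / c"
  have c: "0 < c" using n01 by (simp add: c_def)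
  have "likelihood t n x \<mu> \<Sigma> * diffuse_prior \<mu> \<Sigma> =
      C * (mvn_density (mean_d t n x) ((1 / real n) *\<^sub>R \<Sigma>) \<mu> * iw_kernel (real n + real CARD('k)) (S_d t n x) \<Sigma>)"
    if \<Sigma>: "pos_def \<Sigma>" for \<mu> and \<Sigma> :: "real^'k^'k"
  proof -
    define Q where "Q = real n * ((\<mu> - mean_d t n x) \<bullet> (matrix_inv \<Sigma> *v (\<mu> - mean_d t n x)))"
    define T where "T = trace (S_d t n x ** matrix_inv \<Sigma>)"
    define \<Delta> where "\<Delta> = det \<Sigma>"
    have "\<Delta> powr (- real n / 2) * \<Delta> powr (- (real CARD('k) + 1) / 2)
        = \<Delta> powr (- 1 / 2) * \<Delta> powr (- (real n + real CARD('k)) / 2)"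
      unfolding powr_add[symmetric] by (rule arg_cong[where f = "(powr) \<Delta>"]) (simp add: field_simps)
    moreover have "exp (- (Q + T) / 2) = exp (- Q / 2) * exp (- T / 2)"
      by (simp add: add_divide_distrib flip: exp_add)
    ultimately have eq: "((2 * pi) ^ CARD('k)) powr (- real n / 2) * \<Delta> powr (- real n / 2) * exp (- (Q + T) / 2)
          * \<Delta> powr (- (real CARD('k) + 1) / 2)
        = C * ((c * \<Delta> powr (- 1 / 2) * exp (- Q / 2)) * (\<Delta> powr (- (real n + real CARD('k)) / 2) * exp (- T / 2)))"
      using c by (simp add: C_def)
    have n0: "0 < real n" using n01 by simp
    show ?thesis
      using eq unfolding likelihood_eq[OF \<Sigma> n01] mvn_density_scaled[OF \<Sigma> n0] diffuse_prior_def
        iw_kernel_def mean_d_def Q_def T_def \<Delta>_def c_def .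
  qed
  moreover have "0 < C" using c by (simp add: C_def)
  ultimately show ?thesis using that by blast
qed

lemma iw_kernel_integral_pos:
  fixes S :: "real^'k^'k"
  assumes S: "pos_def S" and d: "2 * real CARD('k) < d"
  shows "0 < (LINT T|pd_measure. iw_kernel d S T)"
proof -
  let ?Z = "\<integral>\<^sup>+T. ennreal (iw_kernel d S T) \<partial>pd_measure"
  have Z: "?Z = (\<integral>\<^sup>+f. pd_kernel d S (frame UNIV f) \<partial>lborel_on (pairs UNIV))"
    using nn_integral_iw_kernel[OF borel_measurable_const, of 1 d S] unfolding mult_1 .
  have "0 < ?Z" unfolding Z by (rule nn_integral_pd_kernel_finite_pos(1)[OF S d])
  moreover have "?Z < \<infinity>" unfolding Z by (rule nn_integral_pd_kernel_finite_pos(2)[OF S d])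
  moreover have "(LINT T|pd_measure. iw_kernel d S T) = enn2real ?Z"
  proof (rule integral_eq_nn_integral)
    show "iw_kernel d S \<in> borel_measurable pd_measure"
      by (rule measurable_pd_measure) measurable
  qed (simp add: iw_kernel_def)
  ultimately show ?thesis by (simp add: enn2real_positive_iff)
qed

text \<open>The forms in \<open>\<mu>\<close> of likelihood and prior add up to one completed square. What is left over is
  the outer product in \<^const>\<open>S_c\<close>.\<close>

lemma conjugate_posterior_kernel:
  fixes S0 :: "real^'k^'k"
  assumes n: "CARD('k) < n" and r0: "0 < r0" and d0: "2 * real CARD('k) < d0" and S0: "pos_def S0"
  obtains C where "0 < C"
    "\<And>\<mu> \<Sigma>. pos_def \<Sigma> \<Longrightarrow> likelihood t n x \<mu> \<Sigma> * conjugate_prior m0 r0 d0 S0 \<mu> \<Sigma> =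
      C * (mvn_density (mean_c m0 r0 t n x) ((1 / (real n + r0)) *\<^sub>R \<Sigma>) \<mu> *
        iw_kernel (real n + d0) (S_c m0 r0 S0 t n x) \<Sigma>)"
proof -
  have n01: "n \<noteq> 0" "n \<noteq> 1" using n zero_less_card_finite[where 'a='k] by linarith+
  define r where "r = real n + r0"
  have r: "0 < r" using r0 by (simp add: r_def add_nonneg_pos)
  define Z where "Z = (LINT T|pd_measure. iw_kernel d0 S0 T)"
  have Z: "0 < Z" unfolding Z_def by (rule iw_kernel_integral_pos[OF S0 d0])
  define c c0 where "c = sqrt ((r / (2 * pi)) ^ CARD('k))" and "c0 = sqrt ((r0 / (2 * pi)) ^ CARD('k))"
  have c: "0 < c" "0 < c0" using r r0 by (simp_all add: c_def c0_def)
  define C where "C = ((2 * pi) ^ CARD('k)) powr (- real n / 2) * c0 / (c * Z)"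
  have "likelihood t n x \<mu> \<Sigma> * conjugate_prior m0 r0 d0 S0 \<mu> \<Sigma> =
      C * (mvn_density (mean_c m0 r0 t n x) ((1 / r) *\<^sub>R \<Sigma>) \<mu> * iw_kernel (real n + d0) (S_c m0 r0 S0 t n x) \<Sigma>)"
    if \<Sigma>: "pos_def \<Sigma>" for \<mu> \<Sigma>
  proof -
    let ?P = "matrix_inv \<Sigma>" and ?m = "sample_mean t n x" and ?mc = "mean_c m0 r0 t n x"
    have sym: "a \<bullet> (?P *v b) = b \<bullet> (?P *v a)" for a b
      using inner_matrix_vector_transpose[of a ?P b] pos_def_sym[OF pos_def_matrix_inv[OF \<Sigma>]]
      by (simp add: inner_commute)
    define a b where "a = \<mu> - ?m" and "b = \<mu> - m0"
    define \<alpha> \<beta> \<gamma> where "\<alpha> = a \<bullet> (?P *v a)" and "\<beta> = b \<bullet> (?P *v b)" and "\<gamma> = a \<bullet> (?P *v b)"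
    have \<gamma>: "b \<bullet> (?P *v a) = \<gamma>" unfolding \<gamma>_def by (rule sym)
    have "r *\<^sub>R (\<mu> - ?mc) = real n *\<^sub>R a + r0 *\<^sub>R b"
    proof -
      have "r *\<^sub>R ?mc = real n *\<^sub>R ?m + r0 *\<^sub>R m0"
        using r by (simp add: mean_c_def flip: r_def)
      then show ?thesis
        by (simp add: scaleR_diff_right a_def b_def) (simp add: r_def algebra_simps)
    qed
    then have mc: "\<mu> - ?mc = (1 / r) *\<^sub>R (real n *\<^sub>R a + r0 *\<^sub>R b)"
      using r by (simp flip: \<open>r *\<^sub>R (\<mu> - ?mc) = real n *\<^sub>R a + r0 *\<^sub>R b\<close>)
    have qc: "(\<mu> - ?mc) \<bullet> (?P *v (\<mu> - ?mc)) = ((real n)\<^sup>2 * \<alpha> + 2 * real n * r0 * \<gamma> + r0\<^sup>2 * \<beta>) / r\<^sup>2"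
      unfolding mc by (simp add: matrix_vector_mult_scaleR matrix_vector_right_distrib inner_add_left
          inner_add_right \<alpha>_def[symmetric] \<beta>_def[symmetric] \<gamma>_def[symmetric] \<gamma> power2_eq_square)
        (simp add: algebra_simps add_divide_distrib)
    have q0: "(m0 - ?m) \<bullet> (?P *v (m0 - ?m)) = \<alpha> - 2 * \<gamma> + \<beta>"
    proof -
      have e: "m0 - ?m = a - b" by (simp add: a_def b_def)
      show ?thesis unfolding e
        by (simp add: matrix_vector_mult_diff_distrib inner_diff_left inner_diff_right
            \<alpha>_def[symmetric] \<beta>_def[symmetric] \<gamma>_def[symmetric] \<gamma>)
    qed
    define T where "T = trace (S_c m0 r0 S0 t n x ** ?P)"
    define Q where "Q = r * ((\<mu> - ?mc) \<bullet> (?P *v (\<mu> - ?mc)))"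
    have T: "T = trace (S_d t n x ** ?P) + trace (S0 ** ?P) + (real n * r0 / r) * (\<alpha> - 2 * \<gamma> + \<beta>)"
      by (simp add: T_def S_c_def r_def trace_mult_linear trace_outer_mult q0[symmetric])
    have "real n * \<alpha> + r0 * \<beta> = Q + (real n * r0 / r) * (\<alpha> - 2 * \<gamma> + \<beta>)"
    proof -
      have "r * (real n * \<alpha> + r0 * \<beta>) = ((real n)\<^sup>2 * \<alpha> + 2 * real n * r0 * \<gamma> + r0\<^sup>2 * \<beta>)
          + (real n * r0) * (\<alpha> - 2 * \<gamma> + \<beta>)"
        by (simp add: r_def power2_eq_square algebra_simps)
      then show ?thesis unfolding Q_def qc using r by (simp add: field_simps power2_eq_square)
    qed
    note square = this
    have lin: "- (A + u) / 2 + - B / 2 + - w / 2 = - Q / 2 + - (u + w + X) / 2"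
      if "A + B = Q + X" for A B Q X u w :: real
      using that by (simp add: field_simps)
    have expo: "- (real n * \<alpha> + trace (S_d t n x ** ?P)) / 2 + - (r0 * \<beta>) / 2 + - trace (S0 ** ?P) / 2
        = - Q / 2 + - T / 2"
      unfolding T by (rule lin[OF square])
    define \<Delta> where "\<Delta> = det \<Sigma>"
    have "\<Delta> powr (- real n / 2) * \<Delta> powr (- 1 / 2) * \<Delta> powr (- d0 / 2)
        = \<Delta> powr (- 1 / 2) * \<Delta> powr (- (real n + d0) / 2)"
      unfolding powr_add[symmetric] by (rule arg_cong[where f = "(powr) \<Delta>"]) (simp add: field_simps)
    note powers = this
    have "likelihood t n x \<mu> \<Sigma> * conjugate_prior m0 r0 d0 S0 \<mu> \<Sigma> =
      (((2 * pi) ^ CARD('k)) powr (- real n / 2) * c0 / Z) *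
      (\<Delta> powr (- real n / 2) * \<Delta> powr (- 1 / 2) * \<Delta> powr (- d0 / 2)) *
      (exp (- (real n * \<alpha> + trace (S_d t n x ** ?P)) / 2) * exp (- (r0 * \<beta>) / 2) * exp (- trace (S0 ** ?P) / 2))"
      unfolding conjugate_prior_def iw_density_def iw_kernel_def Z_def[symmetric, unfolded iw_kernel_def]
        likelihood_eq[OF \<Sigma> n01] mvn_density_scaled[OF \<Sigma> r0] \<alpha>_def \<beta>_def a_def b_def c0_def \<Delta>_def
      by (simp add: mult_ac)
    also have "\<dots> = C * ((c * \<Delta> powr (- 1 / 2) * exp (- Q / 2)) * (\<Delta> powr (- (real n + d0) / 2) * exp (- T / 2)))"
      unfolding powers exp_add[symmetric] expo unfolding exp_add using c Z by (simp add: C_def mult_ac)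
    finally show ?thesis
      unfolding mvn_density_scaled[OF \<Sigma> r] iw_kernel_def by (simp only: Q_def T_def \<Delta>_def c_def)
  qed
  moreover have "0 < C" using c Z by (simp add: C_def)
  ultimately show ?thesis using that unfolding r_def by blast
qed

lemma pos_def_S_c:
  fixes S0 :: "real^'k^'k"
  assumes n: "n \<noteq> 1" and r0: "0 < r0" and S0: "pos_def S0"
  shows "pos_def (S_c m0 r0 S0 t n x)"
  unfolding pos_def_def
proof (intro conjI allI impI)
  let ?w = "m0 - sample_mean t n x"
  have "transpose (outer ?w ?w) = outer ?w ?w"
    by (simp add: vec_eq_iff transpose_def outer_def mult.commute)
  moreover have "transpose (A + B) = transpose A + transpose B" for A B :: "real^'k^'k"
    by (simp add: vec_eq_iff transpose_def)
  ultimately show "transpose (S_c m0 r0 S0 t n x) = S_c m0 r0 S0 t n x"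
    by (simp add: S_c_def transpose_S_d[OF n] pos_def_sym[OF S0] transpose_scalar)
  fix v :: "real^'k" assume v: "v \<noteq> 0"
  have "v \<bullet> (S_c m0 r0 S0 t n x *v v) = v \<bullet> (S_d t n x *v v) + v \<bullet> (S0 *v v)
      + (real n * r0 / (real n + r0)) * (v \<bullet> ?w)\<^sup>2"
    by (simp add: S_c_def matrix_vector_mult_add_rdistrib inner_add_right outer_mult_vector
        power2_eq_square inner_commute flip: scaleR_matrix_vector_assoc)
  moreover have "0 \<le> v \<bullet> (S_d t n x *v v)" unfolding S_d_form[OF n] by (simp add: sum_nonneg)
  moreover have "0 \<le> (real n * r0 / (real n + r0)) * (v \<bullet> ?w)\<^sup>2" using r0 by simp
  ultimately show "0 < v \<bullet> (S_c m0 r0 S0 t n x *v v)" using pos_def_pos[OF S0 v] by linarith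
qed


section \<open>The posterior predictive law\<close>

lemma nn_integral_indep_student_t:
  fixes F :: "real \<times> real \<Rightarrow> ennreal"
  assumes ind: "indep_student_t Q d1 t1 d2 t2" and F: "F \<in> borel_measurable (borel \<Otimes>\<^sub>M borel)"
  shows "(\<integral>\<^sup>+q. F (t1 q, t2 q) \<partial>Q) =
    (\<integral>\<^sup>+y1. \<integral>\<^sup>+y2. F (y1, y2) * ennreal (student_t_density d2 y2) * ennreal (student_t_density d1 y1) \<partial>lborel \<partial>lborel)"
proof -
  interpret Q: prob_space Q using ind by (simp add: indep_student_t_def)
  let ?D = "\<lambda>d. density lborel (\<lambda>y. ennreal (student_t_density d y))"
  have [measurable]: "student_t_density d \<in> borel_measurable borel" for d
    unfolding student_t_density_def by measurable
  have D: "distr Q borel t1 = ?D d1" "distr Q borel t2 = ?D d2"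
    using ind unfolding indep_student_t_def distributed_def
    by (metis distr_cong sets_lborel)+
  have rv: "t1 \<in> borel_measurable Q" "t2 \<in> borel_measurable Q"
    and joint: "distr Q borel t1 \<Otimes>\<^sub>M distr Q borel t2 = distr Q (borel \<Otimes>\<^sub>M borel) (\<lambda>q. (t1 q, t2 q))"
    using ind Q.indep_var_distribution_eq[of borel t1 borel t2] by (auto simp: indep_student_t_def)
  interpret D2: prob_space "?D d2" unfolding D(2)[symmetric] by (rule Q.prob_space_distr[OF rv(2)])
  have F': "F \<in> borel_measurable (?D d1 \<Otimes>\<^sub>M ?D d2)"
  proof -
    have "sets (?D d1 \<Otimes>\<^sub>M ?D d2) = sets (borel \<Otimes>\<^sub>M borel)" by (intro sets_pair_measure_cong) simp_all
    then show ?thesis using F measurable_cong_sets by blast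
  qed
  have "(\<integral>\<^sup>+q. F (t1 q, t2 q) \<partial>Q) = (\<integral>\<^sup>+y. F y \<partial>distr Q (borel \<Otimes>\<^sub>M borel) (\<lambda>q. (t1 q, t2 q)))"
    using rv F by (subst nn_integral_distr) simp_all
  also have "\<dots> = (\<integral>\<^sup>+y1. \<integral>\<^sup>+y2. F (y1, y2) \<partial>?D d2 \<partial>?D d1)"
    unfolding joint[symmetric] D by (rule D2.nn_integral_fst[OF F', symmetric])
  also have "\<dots> = (\<integral>\<^sup>+y1. \<integral>\<^sup>+y2. F (y1, y2) * ennreal (student_t_density d2 y2) * ennreal (student_t_density d1 y1) \<partial>lborel \<partial>lborel)"
    using F by (simp add: nn_integral_density nn_integral_multc nn_integral_cmult mult_ac)
  finally show ?thesis .
qed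

lemma measurable_param_measure:
  assumes "f \<in> borel \<Otimes>\<^sub>M borel \<rightarrow>\<^sub>M N"
  shows "f \<in> (param_measure :: ((real^'k) \<times> (real^'k^'k)) measure) \<rightarrow>\<^sub>M N"
proof -
  have 1: "(\<lambda>\<Sigma>. \<Sigma>) \<in> (pd_measure :: (real^'k^'k) measure) \<rightarrow>\<^sub>M borel"
    by (rule measurable_pd_measure) simp
  have "(\<lambda>\<theta>. (fst \<theta>, snd \<theta>)) \<in> (lborel \<Otimes>\<^sub>M pd_measure :: ((real^'k) \<times> (real^'k^'k)) measure) \<rightarrow>\<^sub>M borel \<Otimes>\<^sub>M borel"
    using measurable_compose[OF measurable_snd 1] by (intro measurable_Pair) simp_all
  then show ?thesis
    unfolding param_measure_def using measurable_compose[OF _ assms] by simp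
qed

lemma space_param_measure: "space param_measure = UNIV \<times> {\<Sigma> :: real^'k^'k. pos_def \<Sigma>}"
  by (simp add: param_measure_def space_pair_measure space_pd_measure)

lemma nn_integral_param_measure:
  fixes F :: "(real^'k) \<times> (real^'k^'k) \<Rightarrow> ennreal"
  assumes "F \<in> borel_measurable (borel \<Otimes>\<^sub>M borel)"
  shows "(\<integral>\<^sup>+\<theta>. F \<theta> \<partial>param_measure) = (\<integral>\<^sup>+\<Sigma>. \<integral>\<^sup>+\<mu>. F (\<mu>, \<Sigma>) \<partial>lborel \<partial>pd_measure)"
proof -
  interpret pair_sigma_finite "lborel :: (real^'k) measure" "pd_measure :: (real^'k^'k) measure"
    using sigma_finite_pd_measure sigma_finite_lborel by (rule pair_sigma_finite.intro[rotated])
  show ?thesis using measurable_param_measure[OF assms]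
    unfolding param_measure_def by (rule nn_integral_snd[symmetric])
qed

lemma mvn_density_nonneg: "pos_def \<Sigma> \<Longrightarrow> 0 \<le> mvn_density \<mu> \<Sigma> y"
  using pos_def_det_pos[of \<Sigma>] by (simp add: mvn_density_def)

lemma iw_kernel_nonneg: "0 \<le> iw_kernel d S \<Sigma>"
  by (simp add: iw_kernel_def)

abbreviation niw_kernel ::
  "real^'k \<Rightarrow> real \<Rightarrow> real \<Rightarrow> real^'k^'k \<Rightarrow> (real^'k) \<times> (real^'k^'k) \<Rightarrow> ennreal" where
  "niw_kernel m r d S \<theta> \<equiv>
    ennreal (mvn_density m ((1 / r) *\<^sub>R snd \<theta>) (fst \<theta>)) * ennreal (iw_kernel d S (snd \<theta>))"

text \<open>Integrating over \<open>\<mu>\<close> first leaves a function of \<open>v \<bullet> (\<Sigma> *v v)\<close> alone.\<close>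

lemma nn_integral_niw_kernel:
  fixes S :: "real^'k^'k"
  assumes S: "pos_def S" and d: "2 * real CARD('k) < d" and r: "0 < r" and v: "v \<noteq> 0"
  obtains c where "0 < c" "c < \<infinity>"
    "\<And>\<Phi>. \<Phi> \<in> borel_measurable (borel \<Otimes>\<^sub>M borel) \<Longrightarrow>
      (\<integral>\<^sup>+\<theta>. \<Phi> (v \<bullet> fst \<theta>, v \<bullet> (snd \<theta> *v v)) * niw_kernel m r d S \<theta> \<partial>param_measure) =
      c * (\<integral>\<^sup>+s. (\<integral>\<^sup>+a. \<Phi> (a, s) * ennreal (normal_density (v \<bullet> m) (sqrt (s / r)) a) \<partial>lborel) *
        ennreal (ig_kernel (d / 2 - real CARD('k)) (v \<bullet> (S *v v)) s) \<partial>lborel)"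
proof -
  obtain c where c: "0 < c" "c < \<infinity>" and law:
    "\<And>\<phi>. \<phi> \<in> borel_measurable borel \<Longrightarrow>
      (\<integral>\<^sup>+\<Sigma>. \<phi> (v \<bullet> (\<Sigma> *v v)) * ennreal (iw_kernel d S \<Sigma>) \<partial>pd_measure)
      = c * (\<integral>\<^sup>+s. \<phi> s * ennreal (ig_kernel (d / 2 - real CARD('k)) (v \<bullet> (S *v v)) s) \<partial>lborel)"
    using inverse_wishart_form_law[OF S d v] by blast
  have "(\<integral>\<^sup>+\<theta>. \<Phi> (v \<bullet> fst \<theta>, v \<bullet> (snd \<theta> *v v)) * niw_kernel m r d S \<theta> \<partial>param_measure) =
      c * (\<integral>\<^sup>+s. (\<integral>\<^sup>+a. \<Phi> (a, s) * ennreal (normal_density (v \<bullet> m) (sqrt (s / r)) a) \<partial>lborel) *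
        ennreal (ig_kernel (d / 2 - real CARD('k)) (v \<bullet> (S *v v)) s) \<partial>lborel)"
    if \<Phi> [measurable]: "\<Phi> \<in> borel_measurable (borel \<Otimes>\<^sub>M borel)" for \<Phi>
  proof -
    define \<phi> where "\<phi> s = (\<integral>\<^sup>+a. \<Phi> (a, s) * ennreal (normal_density (v \<bullet> m) (sqrt (s / r)) a) \<partial>lborel)" for s
    have m\<phi>: "\<phi> \<in> borel_measurable borel" unfolding \<phi>_def by measurable
    have "(\<integral>\<^sup>+\<theta>. \<Phi> (v \<bullet> fst \<theta>, v \<bullet> (snd \<theta> *v v)) * niw_kernel m r d S \<theta> \<partial>param_measure)
      = (\<integral>\<^sup>+\<Sigma>. \<integral>\<^sup>+\<mu>. \<Phi> (v \<bullet> \<mu>, v \<bullet> (\<Sigma> *v v)) * (ennreal (mvn_density m ((1 / r) *\<^sub>R \<Sigma>) \<mu>) *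
          ennreal (iw_kernel d S \<Sigma>)) \<partial>lborel \<partial>pd_measure)"
      by (subst nn_integral_param_measure) simp_all
    also have "\<dots> = (\<integral>\<^sup>+\<Sigma>. \<phi> (v \<bullet> (\<Sigma> *v v)) * ennreal (iw_kernel d S \<Sigma>) \<partial>pd_measure)"
    proof (rule nn_integral_cong)
      fix \<Sigma> :: "real^'k^'k" assume "\<Sigma> \<in> space pd_measure"
      then have "pos_def ((1 / r) *\<^sub>R \<Sigma>)"
        using r by (intro pos_def_scaleR) (simp_all add: space_pd_measure)
      from mvn_form_law[OF this v, of "\<lambda>a. \<Phi> (a, v \<bullet> (\<Sigma> *v v))" m]
      have "(\<integral>\<^sup>+\<mu>. \<Phi> (v \<bullet> \<mu>, v \<bullet> (\<Sigma> *v v)) * ennreal (mvn_density m ((1 / r) *\<^sub>R \<Sigma>) \<mu>) \<partial>lborel)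
        = \<phi> (v \<bullet> (\<Sigma> *v v))"
        by (simp add: \<phi>_def flip: scaleR_matrix_vector_assoc)
      then show "(\<integral>\<^sup>+\<mu>. \<Phi> (v \<bullet> \<mu>, v \<bullet> (\<Sigma> *v v)) * (ennreal (mvn_density m ((1 / r) *\<^sub>R \<Sigma>) \<mu>) *
          ennreal (iw_kernel d S \<Sigma>)) \<partial>lborel) = \<phi> (v \<bullet> (\<Sigma> *v v)) * ennreal (iw_kernel d S \<Sigma>)"
        by (simp add: nn_integral_multc flip: mult.assoc)
    qed
    also have "\<dots> = c * (\<integral>\<^sup>+s. \<phi> s * ennreal (ig_kernel (d / 2 - real CARD('k)) (v \<bullet> (S *v v)) s) \<partial>lborel)"
      by (rule law[OF m\<phi>])
    finally show ?thesis unfolding \<phi>_def .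
  qed
  with c show ?thesis using that by blast
qed

lemma nn_integral_niw_kernel_finite_pos:
  fixes S :: "real^'k^'k"
  assumes S: "pos_def S" and d: "2 * real CARD('k) < d" and r: "0 < r"
  shows "0 < (\<integral>\<^sup>+\<theta>. niw_kernel m r d S \<theta> \<partial>param_measure)" "(\<integral>\<^sup>+\<theta>. niw_kernel m r d S \<theta> \<partial>param_measure) < \<infinity>"
proof -
  have "(\<integral>\<^sup>+\<theta>. niw_kernel m r d S \<theta> \<partial>param_measure)
      = (\<integral>\<^sup>+\<Sigma>. \<integral>\<^sup>+\<mu>. ennreal (mvn_density m ((1 / r) *\<^sub>R \<Sigma>) \<mu>) * ennreal (iw_kernel d S \<Sigma>) \<partial>lborel \<partial>pd_measure)"
    by (subst nn_integral_param_measure) simp_all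
  also have "\<dots> = (\<integral>\<^sup>+\<Sigma>. 1 * ennreal (iw_kernel d S \<Sigma>) \<partial>pd_measure)"
  proof (rule nn_integral_cong)
    fix \<Sigma> :: "real^'k^'k" assume "\<Sigma> \<in> space pd_measure"
    then have "pos_def ((1 / r) *\<^sub>R \<Sigma>)"
      using r by (intro pos_def_scaleR) (simp_all add: space_pd_measure)
    then show "(\<integral>\<^sup>+\<mu>. ennreal (mvn_density m ((1 / r) *\<^sub>R \<Sigma>) \<mu>) * ennreal (iw_kernel d S \<Sigma>) \<partial>lborel)
      = 1 * ennreal (iw_kernel d S \<Sigma>)"
      by (simp add: nn_integral_multc nn_integral_mvn_density)
  qed
  also have "\<dots> = (\<integral>\<^sup>+f. pd_kernel d S (frame UNIV f) \<partial>lborel_on (pairs UNIV))"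
    using nn_integral_iw_kernel[OF borel_measurable_const, of 1 d S] unfolding mult_1 .
  finally have e: "(\<integral>\<^sup>+\<theta>. niw_kernel m r d S \<theta> \<partial>param_measure)
    = (\<integral>\<^sup>+f. pd_kernel d S (frame UNIV f) \<partial>lborel_on (pairs UNIV))" .
  show "0 < (\<integral>\<^sup>+\<theta>. niw_kernel m r d S \<theta> \<partial>param_measure)"
    unfolding e by (rule nn_integral_pd_kernel_finite_pos(1)[OF S d])
  show "(\<integral>\<^sup>+\<theta>. niw_kernel m r d S \<theta> \<partial>param_measure) < \<infinity>"
    unfolding e by (rule nn_integral_pd_kernel_finite_pos(2)[OF S d])
qed

text \<open>By the preceding sections the two laws agree up to a constant factor \<open>\<kappa>\<close>, which does not
  depend on the event. As both are probability measures, \<open>\<kappa> = 1\<close>.\<close>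

theorem posterior_predictive_niw:
  fixes P :: "real^'k \<Rightarrow> real^'k^'k \<Rightarrow> 'w measure" and S :: "real^'k^'k" and g :: "real \<Rightarrow> real"
  assumes S: "pos_def S" and d: "2 * real CARD('k) < d" and r: "0 < r" and C: "0 < C"
    and posterior: "\<And>\<mu> \<Sigma>. pos_def \<Sigma> \<Longrightarrow> likelihood t n x \<mu> \<Sigma> * \<pi> \<mu> \<Sigma> =
      C * (mvn_density m ((1 / r) *\<^sub>R \<Sigma>) \<mu> * iw_kernel d S \<Sigma>)"
    and normal: "\<And>\<mu> \<Sigma>. pos_def \<Sigma> \<Longrightarrow> distributed (P \<mu> \<Sigma>) lborel Y (\<lambda>y. ennreal (mvn_density \<mu> \<Sigma> y))"
    and g [measurable]: "g \<in> borel_measurable borel"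
    and t: "indep_student_t Q (d - 2 * real CARD('k)) t1 (d - 2 * real CARD('k) + 1) t2"
  shows "posterior_predictive \<pi> t n x P (\<lambda>\<omega>. g (v \<bullet> Y \<omega>)) =
    distr Q borel (\<lambda>q. g (v \<bullet> m + sqrt (v \<bullet> (S *v v)) * (t1 q / sqrt (r * (d - 2 * real CARD('k)))
      + sqrt (1 + (t1 q)\<^sup>2 / (d - 2 * real CARD('k))) * (t2 q / sqrt (d - 2 * real CARD('k) + 1)))))"
proof -
  define \<nu> where "\<nu> = d - 2 * real CARD('k)"
  have \<nu>: "0 < \<nu>" "d / 2 - real CARD('k) = \<nu> / 2" using d by (simp_all add: \<nu>_def)
  define T where "T y1 y2 = v \<bullet> m + sqrt (v \<bullet> (S *v v)) * (y1 / sqrt (r * \<nu>)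
      + sqrt (1 + y1\<^sup>2 / \<nu>) * (y2 / sqrt (\<nu> + 1)))" for y1 y2
  let ?K = "niw_kernel m r d S"
  define Z where "Z = (\<integral>\<^sup>+\<theta>. ?K \<theta> \<partial>param_measure)"
  have Z: "0 < Z" "Z < \<infinity>" unfolding Z_def by (rule nn_integral_niw_kernel_finite_pos[OF S d r])+
  define D where "D = ennreal C / (ennreal C * Z)"
  have DZ: "D * Z = 1"
  proof -
    have "D * Z = (ennreal C * Z) / (ennreal C * Z)"
      by (simp add: D_def ennreal_times_divide mult_ac)
    also have "\<dots> = 1" using C Z by (intro ennreal_divide_self) (auto simp: ennreal_mult_less_top)
    finally show ?thesis .
  qed
  have mK [measurable]: "?K \<in> borel_measurable (borel \<Otimes>\<^sub>M borel)" by measurable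
  define G where "G = (\<lambda>(\<mu>, \<Sigma>). ennreal (likelihood t n x \<mu> \<Sigma> * \<pi> \<mu> \<Sigma>))"
  have G: "G \<theta> = ennreal C * ?K \<theta>" if "\<theta> \<in> space param_measure" for \<theta>
  proof -
    have pd: "pos_def (snd \<theta>)" using that by (auto simp: space_param_measure)
    then have "0 \<le> mvn_density m ((1 / r) *\<^sub>R snd \<theta>) (fst \<theta>)"
      using r by (intro mvn_density_nonneg pos_def_scaleR) simp_all
    then show ?thesis using posterior[OF pd, of "fst \<theta>"] C
      by (simp add: G_def case_prod_beta ennreal_mult iw_kernel_nonneg)
  qed
  have GZ: "(\<integral>\<^sup>+\<theta>. G \<theta> \<partial>param_measure) = ennreal C * Z"
  proof -
    have "(\<integral>\<^sup>+\<theta>. G \<theta> \<partial>param_measure) = (\<integral>\<^sup>+\<theta>. ennreal C * ?K \<theta> \<partial>param_measure)"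
      by (rule nn_integral_cong) (rule G)
    then show ?thesis unfolding Z_def using measurable_param_measure[OF mK] by (simp add: nn_integral_cmult)
  qed
  have post: "posterior \<pi> t n x = density param_measure (\<lambda>\<theta>. D * ?K \<theta>)"
  proof -
    have div: "x * y / z = x / z * y" for x y z :: ennreal
      by (simp add: divide_ennreal_def mult_ac)
    have e: "G \<theta> / (ennreal C * Z) = D * ?K \<theta>" if "\<theta> \<in> space param_measure" for \<theta>
      unfolding G[OF that] D_def by (rule div)
    have m: "(\<lambda>\<theta>. D * ?K \<theta>) \<in> borel_measurable param_measure"
      by (intro measurable_param_measure) measurable
    have "posterior \<pi> t n x = density param_measure (\<lambda>\<theta>. G \<theta> / (ennreal C * Z))"
      unfolding posterior_def Let_def G_def[symmetric] GZ ..
    also have "\<dots> = density param_measure (\<lambda>\<theta>. D * ?K \<theta>)"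
    proof (rule density_cong)
      show "(\<lambda>\<theta>. G \<theta> / (ennreal C * Z)) \<in> borel_measurable param_measure"
        using m by (subst measurable_cong[OF e]) simp_all
    qed (use m e in auto)
    finally show ?thesis .
  qed
  define N where "N = (\<lambda>(\<mu>, \<Sigma>). distr (P \<mu> \<Sigma>) borel (\<lambda>\<omega>. g (v \<bullet> Y \<omega>)))"
  define E where "E A \<theta> = (\<integral>\<^sup>+y. indicator A (g (v \<bullet> y)) * ennreal (mvn_density (fst \<theta>) (snd \<theta>) y) \<partial>lborel)"
    for A \<theta>
  have mE: "E A \<in> borel_measurable (borel \<Otimes>\<^sub>M borel)" if [measurable]: "A \<in> sets borel" for A
    unfolding E_def by measurable
  have NE: "emeasure (N \<theta>) A = E A \<theta>" if \<theta>: "\<theta> \<in> space param_measure" and A [measurable]: "A \<in> sets borel" for \<theta> A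
  proof -
    have pd: "pos_def (snd \<theta>)" using \<theta> by (auto simp: space_param_measure)
    note dist = normal[OF pd, of "fst \<theta>"]
    have mY: "Y \<in> P (fst \<theta>) (snd \<theta>) \<rightarrow>\<^sub>M lborel" by (rule distributed_measurable[OF dist])
    have mg: "(\<lambda>y. g (v \<bullet> y)) \<in> lborel \<rightarrow>\<^sub>M borel" by measurable
    have "N \<theta> = distr (distr (P (fst \<theta>) (snd \<theta>)) lborel Y) borel (\<lambda>y. g (v \<bullet> y))"
      unfolding distr_distr[OF mg mY] by (simp add: N_def case_prod_beta comp_def)
    also have "\<dots> = distr (density lborel (\<lambda>y. ennreal (mvn_density (fst \<theta>) (snd \<theta>) y))) borel (\<lambda>y. g (v \<bullet> y))"
      by (simp only: distributed_distr_eq_density[OF dist])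
    finally have "emeasure (N \<theta>) A = (\<integral>\<^sup>+z. indicator A z
      \<partial>distr (density lborel (\<lambda>y. ennreal (mvn_density (fst \<theta>) (snd \<theta>) y))) borel (\<lambda>y. g (v \<bullet> y)))"
      by simp
    also have "\<dots> = (\<integral>\<^sup>+y. indicator A (g (v \<bullet> y)) \<partial>density lborel (\<lambda>y. ennreal (mvn_density (fst \<theta>) (snd \<theta>) y)))"
      by (rule nn_integral_distr) measurable
    also have "\<dots> = (\<integral>\<^sup>+y. ennreal (mvn_density (fst \<theta>) (snd \<theta>) y) * indicator A (g (v \<bullet> y)) \<partial>lborel)"
      by (rule nn_integral_density) measurable
    also have "\<dots> = E A \<theta>"
      by (simp add: E_def mult.commute)
    finally show ?thesis .
  qed
  have E1: "E UNIV \<theta> = 1" if "\<theta> \<in> space param_measure" for \<theta>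
    using that by (auto simp: E_def space_param_measure nn_integral_mvn_density)
  have N: "N \<in> posterior \<pi> t n x \<rightarrow>\<^sub>M subprob_algebra borel"
  proof (rule measurable_subprob_algebra)
    fix \<theta> assume "\<theta> \<in> space (posterior \<pi> t n x)"
    then have \<theta>: "\<theta> \<in> space param_measure" by (simp add: post)
    have "emeasure (N \<theta>) (space (N \<theta>)) = 1"
      using NE[OF \<theta>, of UNIV] E1[OF \<theta>] by (simp add: N_def case_prod_beta)
    then show "subprob_space (N \<theta>)" by (intro prob_space_imp_subprob_space prob_spaceI)
    show "sets (N \<theta>) = sets borel" by (simp add: N_def case_prod_beta)
  next
    fix A :: "real set" assume A: "A \<in> sets borel"
    have "(\<lambda>\<theta>. emeasure (N \<theta>) A) \<in> borel_measurable param_measure"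
      using measurable_param_measure[OF mE[OF A]] by (subst measurable_cong[OF NE[OF _ A]]) simp_all
    then show "(\<lambda>\<theta>. emeasure (N \<theta>) A) \<in> borel_measurable (posterior \<pi> t n x)" by (simp add: post)
  qed
  have ne: "space (posterior \<pi> t n x) \<noteq> {}"
    using pos_def_mat_1 by (auto simp: post space_param_measure)
  let ?L = "posterior_predictive \<pi> t n x P (\<lambda>\<omega>. g (v \<bullet> Y \<omega>))"
  have L: "emeasure ?L A = D * (\<integral>\<^sup>+\<theta>. E A \<theta> * ?K \<theta> \<partial>param_measure)" if A: "A \<in> sets borel" for A
  proof -
    have "emeasure ?L A = (\<integral>\<^sup>+\<theta>. emeasure (N \<theta>) A \<partial>posterior \<pi> t n x)"
      unfolding posterior_predictive_def N_def[symmetric] by (rule emeasure_bind[OF ne N A])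
    also have "\<dots> = (\<integral>\<^sup>+\<theta>. D * ?K \<theta> * emeasure (N \<theta>) A \<partial>param_measure)"
      unfolding post
    proof (rule nn_integral_density)
      show "(\<lambda>\<theta>. D * ?K \<theta>) \<in> borel_measurable param_measure"
        by (intro measurable_param_measure) measurable
      show "(\<lambda>\<theta>. emeasure (N \<theta>) A) \<in> borel_measurable param_measure"
        using measurable_param_measure[OF mE[OF A]] by (subst measurable_cong[OF NE[OF _ A]]) simp_all
    qed
    also have "\<dots> = (\<integral>\<^sup>+\<theta>. D * (E A \<theta> * ?K \<theta>) \<partial>param_measure)"
      by (intro nn_integral_cong) (simp add: NE[OF _ A] mult_ac)
    also have "\<dots> = D * (\<integral>\<^sup>+\<theta>. E A \<theta> * ?K \<theta> \<partial>param_measure)"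
      by (rule nn_integral_cmult[OF measurable_param_measure[OF borel_measurable_times_ennreal[OF mE[OF A] mK]]])
    finally show ?thesis .
  qed
  have setsL: "sets ?L = sets borel"
    unfolding posterior_predictive_def N_def[symmetric] by (rule sets_bind[OF sets_kernel[OF N] ne])
  have L1: "emeasure ?L UNIV = 1"
  proof -
    have "(\<integral>\<^sup>+\<theta>. E UNIV \<theta> * ?K \<theta> \<partial>param_measure) = Z"
      unfolding Z_def by (intro nn_integral_cong) (simp add: E1)
    then show ?thesis using L[of UNIV] DZ by simp
  qed
  interpret Q: prob_space Q using t by (simp add: indep_student_t_def)
  have [measurable]: "t1 \<in> borel_measurable Q" "t2 \<in> borel_measurable Q"
    using t by (auto simp: indep_student_t_def dest: distributed_measurable)
  have mT [measurable]: "(\<lambda>y. T (fst y) (snd y)) \<in> borel_measurable (borel \<Otimes>\<^sub>M borel)"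
    unfolding T_def by measurable
  have mTq [measurable]: "(\<lambda>q. T (t1 q) (t2 q)) \<in> borel_measurable Q"
    unfolding T_def by measurable
  let ?R = "distr Q borel (\<lambda>q. g (T (t1 q) (t2 q)))"
  have R1: "emeasure ?R UNIV = 1"
    using Q.emeasure_space_1 by (simp add: emeasure_distr)
  have R: "emeasure ?R A = (\<integral>\<^sup>+q. indicator A (g (T (t1 q) (t2 q))) \<partial>Q)" if [measurable]: "A \<in> sets borel" for A
    by (simp add: nn_integral_distr flip: nn_integral_indicator)
  have "\<exists>\<kappa>. \<forall>A\<in>sets borel. emeasure ?L A = \<kappa> * emeasure ?R A"
  proof (cases "v = 0")
    \<comment> \<open>the degenerate case, in which both laws are the point mass at \<open>g 0\<close>\<close>
    case True
    have "emeasure ?L A = 1 * emeasure ?R A" if A: "A \<in> sets borel" for A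
    proof -
      have "E A \<theta> = indicator A (g 0) * E UNIV \<theta>" for \<theta>
        using True by (simp add: E_def nn_integral_cmult)
      then have "(\<integral>\<^sup>+\<theta>. E A \<theta> * ?K \<theta> \<partial>param_measure) = (\<integral>\<^sup>+\<theta>. indicator A (g 0) * ?K \<theta> \<partial>param_measure)"
        by (intro nn_integral_cong) (simp add: E1)
      also have "\<dots> = indicator A (g 0) * Z"
        unfolding Z_def by (rule nn_integral_cmult[OF measurable_param_measure[OF mK]])
      finally have "emeasure ?L A = indicator A (g 0) * (D * Z)" using L[OF A] by (simp add: mult_ac)
      moreover have "T y1 y2 = 0" for y1 y2 using True by (simp add: T_def)
      ultimately show ?thesis using R[OF A] Q.emeasure_space_1 by (simp add: DZ)
    qed
    then show ?thesis by blast
  next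
    case v: False
    define q where "q = v \<bullet> (S *v v)"
    have q: "0 < q" unfolding q_def by (rule pos_def_pos[OF S v])
    obtain c where law: "\<And>\<Phi>. \<Phi> \<in> borel_measurable (borel \<Otimes>\<^sub>M borel) \<Longrightarrow>
      (\<integral>\<^sup>+\<theta>. \<Phi> (v \<bullet> fst \<theta>, v \<bullet> (snd \<theta> *v v)) * ?K \<theta> \<partial>param_measure) =
      c * (\<integral>\<^sup>+s. (\<integral>\<^sup>+a. \<Phi> (a, s) * ennreal (normal_density (v \<bullet> m) (sqrt (s / r)) a) \<partial>lborel) *
        ennreal (ig_kernel (\<nu> / 2) q s) \<partial>lborel)"
      using nn_integral_niw_kernel[OF S d r v, of m] unfolding \<nu>(2) q_def by blast
    obtain \<kappa> where pred: "\<And>h. h \<in> borel_measurable borel \<Longrightarrow>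
      (\<integral>\<^sup>+s. (\<integral>\<^sup>+a. (\<integral>\<^sup>+z. h z * ennreal (normal_density a (sqrt s) z) \<partial>lborel) *
          ennreal (normal_density (v \<bullet> m) (sqrt (s / r)) a) \<partial>lborel) * ennreal (ig_kernel (\<nu> / 2) q s) \<partial>lborel)
      = \<kappa> * (\<integral>\<^sup>+y1. \<integral>\<^sup>+y2. h (T y1 y2)
          * ennreal (student_t_density (\<nu> + 1) y2) * ennreal (student_t_density \<nu> y1) \<partial>lborel \<partial>lborel)"
      using normal_inverse_gamma_predictive[OF \<nu>(1) q r, of "v \<bullet> m"] unfolding T_def q_def by blast
    have "emeasure ?L A = (D * c * \<kappa>) * emeasure ?R A" if A [measurable]: "A \<in> sets borel" for A
    proof -
      let ?h = "\<lambda>z. indicator A (g z) :: ennreal"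
      define \<Phi> where "\<Phi> = (\<lambda>(a, s). \<integral>\<^sup>+z. ?h z * ennreal (normal_density a (sqrt s) z) \<partial>lborel)"
      have "\<Phi> \<in> borel_measurable (borel \<Otimes>\<^sub>M borel)" unfolding \<Phi>_def by measurable
      note law = law[OF this]
      have "E A \<theta> = \<Phi> (v \<bullet> fst \<theta>, v \<bullet> (snd \<theta> *v v))" if "\<theta> \<in> space param_measure" for \<theta>
      proof -
        have "pos_def (snd \<theta>)" using that by (auto simp: space_param_measure)
        from mvn_form_law[OF this v, of ?h "fst \<theta>"] show ?thesis by (simp add: E_def \<Phi>_def)
      qed
      then have "(\<integral>\<^sup>+\<theta>. E A \<theta> * ?K \<theta> \<partial>param_measure)
          = (\<integral>\<^sup>+\<theta>. \<Phi> (v \<bullet> fst \<theta>, v \<bullet> (snd \<theta> *v v)) * ?K \<theta> \<partial>param_measure)"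
        by (intro nn_integral_cong) simp
      also have "\<dots> = c * (\<kappa> * (\<integral>\<^sup>+y1. \<integral>\<^sup>+y2. ?h (T y1 y2)
          * ennreal (student_t_density (\<nu> + 1) y2) * ennreal (student_t_density \<nu> y1) \<partial>lborel \<partial>lborel))"
        unfolding law by (subst pred[symmetric]) (simp_all add: \<Phi>_def)
      also have "(\<integral>\<^sup>+y1. \<integral>\<^sup>+y2. ?h (T y1 y2) * ennreal (student_t_density (\<nu> + 1) y2) *
          ennreal (student_t_density \<nu> y1) \<partial>lborel \<partial>lborel) = emeasure ?R A"
        using nn_integral_indep_student_t[OF t, of "\<lambda>y. ?h (T (fst y) (snd y))"]
        by (simp add: R[OF A] \<nu>_def[symmetric])
      finally show ?thesis unfolding L[OF A] by (simp add: mult_ac)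
    qed
    then show ?thesis by blast
  qed
  then obtain \<kappa> where \<kappa>: "\<And>A. A \<in> sets borel \<Longrightarrow> emeasure ?L A = \<kappa> * emeasure ?R A" by blast
  have "\<kappa> = 1" using \<kappa>[of UNIV] L1 R1 by simp
  then have "?L = ?R" by (intro measure_eqI) (simp_all add: setsL \<kappa>)
  then show ?thesis by (simp add: T_def \<nu>_def)
qed


section \<open>Almost sure definiteness of the sample covariance\<close>

lemma pos_def_S_d_if_det:
  fixes x :: "int \<Rightarrow> real^'k" and e :: "'k \<Rightarrow> int"
  assumes n: "n \<noteq> 1" and mem: "i0 \<in> window t n" "\<And>j. e j \<in> window t n"
    and det: "det (\<chi> j. x (e j) - x i0) \<noteq> 0"
  shows "pos_def (S_d t n x)"
  unfolding pos_def_def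
proof (intro conjI allI impI)
  show "transpose (S_d t n x) = S_d t n x" by (rule transpose_S_d[OF n])
  fix v :: "real^'k" assume v: "v \<noteq> 0"
  let ?m = "sample_mean t n x" and ?A = "\<chi> j. x (e j) - x i0"
  have "v \<bullet> (S_d t n x *v v) \<noteq> 0"
  proof
    assume "v \<bullet> (S_d t n x *v v) = 0"
    then have "v \<bullet> (x i - ?m) = 0" if "i \<in> window t n" for i
      using that unfolding S_d_form[OF n] by (subst (asm) sum_nonneg_eq_0_iff) auto
    then have "v \<bullet> x i = v \<bullet> ?m" if "i \<in> window t n" for i
      using that by (simp add: inner_diff_right)
    then have "(?A *v v) $ j = 0" for j
      using mem by (simp add: matrix_vector_mul_component inner_commute[of _ v] inner_diff_right)
    then have "?A *v v = 0" by (simp add: vec_eq_iff)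
    moreover have "invertible ?A" using det by (simp add: invertible_det_nz)
    ultimately show False using v
      by (metis inj_matrix_vector_mult injD matrix_vector_mult_0_right)
  qed
  moreover have "0 \<le> v \<bullet> (S_d t n x *v v)" unfolding S_d_form[OF n] by (simp add: sum_nonneg)
  ultimately show "0 < v \<bullet> (S_d t n x *v v)" by linarith
qed

text \<open>With the other rows kept, the determinant is a linear form in one row. If it is not the zero form,
  its kernel is a hyperplane.\<close>

lemma null_set_det_row:
  fixes R :: "'k \<Rightarrow> real^'k" and w c :: "real^'k"
  assumes "det (\<chi> j. if j = i then w else R j) \<noteq> 0"
  shows "{y. det (\<chi> j. if j = i then y - c else R j) = 0} \<in> null_sets lborel"
proof -
  define h where "h z = det (\<chi> j. if j = i then z else R j)" for z
  have add: "h (y + z) = h y + h z" for y z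
    unfolding h_def using det_row_add[of i "\<lambda>_. y" "\<lambda>_. z" R] by simp
  have scale: "h (a *\<^sub>R y) = a * h y" for a y
    unfolding h_def using det_row_mul[of i a "\<lambda>_. y" R] by (simp only: scalar_mult_eq_scaleR)
  have lin: "linear h" by (rule linearI) (simp_all add: add scale)
  have "y \<bullet> adjoint h 1 = h y \<bullet> 1" for y by (rule adjoint_works[OF lin])
  then have h: "h y = adjoint h 1 \<bullet> y" for y by (simp add: inner_commute)
  have "adjoint h 1 \<noteq> 0"
  proof
    assume "adjoint h 1 = 0"
    then have "h w = 0" by (simp add: h)
    then show False using assms by (simp add: h_def)
  qed
  then have "negligible {y. adjoint h 1 \<bullet> y = adjoint h 1 \<bullet> c}"
    by (intro negligible_hyperplane) simp
  moreover have "{y. adjoint h 1 \<bullet> y = adjoint h 1 \<bullet> c} \<in> sets lborel"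
    by (simp add: closed_hyperplane borel_closed)
  ultimately have "{y. adjoint h 1 \<bullet> y = adjoint h 1 \<bullet> c} \<in> null_sets lborel"
    by (simp add: negligible_iff_null_sets null_sets_completion_iff)
  moreover have "h (y - c) = 0 \<longleftrightarrow> adjoint h 1 \<bullet> y = adjoint h 1 \<bullet> c" for y
    by (simp add: h inner_diff_right)
  ultimately show ?thesis by (simp add: h_def)
qed

text \<open>The rows are drawn one after the other; those not drawn yet are kept at unit vectors.\<close>

lemma nn_integral_det_rows_zero:
  fixes \<rho> :: "(real^'k) measure" and e :: "'k \<Rightarrow> 'i"
  assumes \<rho>: "prob_space \<rho>" "sets \<rho> = sets borel" "absolutely_continuous lborel \<rho>"
    and inj: "inj_on e J"
  shows "(\<integral>\<^sup>+x. indicator {0} (det (\<chi> j. if j \<in> J then x (e j) - c else axis j 1)) \<partial>Pi\<^sub>M (e ` J) (\<lambda>_. \<rho>)) = 0"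
  using finite[of J] inj
proof (induction J rule: finite_induct)
  case empty
  have "(\<chi> j. axis j 1) = (mat 1 :: real^'k^'k)" by (simp add: vec_eq_iff mat_def axis_def)
  then show ?case by simp
next
  case (insert i J)
  interpret \<rho>: product_sigma_finite "\<lambda>_ :: 'i. \<rho>"
    by (rule product_sigma_finite.intro) (rule prob_space_imp_sigma_finite[OF \<rho>(1)])
  note sets_\<rho> [measurable_cong] = \<rho>(2)
  let ?I = "e ` J"
  have ei: "e i \<notin> ?I" using insert.hyps insert.prems by auto
  have ne: "e j \<noteq> e i" if "j \<in> J" for j using ei that by (metis imageI)
  define M where "M J x = (\<chi> j. if j \<in> J then x (e j) - c else axis j 1)" for J x
  have coord: "(\<lambda>x. x q) \<in> borel_measurable (Pi\<^sub>M I (\<lambda>_. \<rho>))" if "q \<in> I" for q and I :: "'i set"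
    using measurable_component_singleton[OF that, of "\<lambda>_. \<rho>"] measurable_cong_sets[OF refl \<rho>(2)] by blast
  have mM: "(\<lambda>x. indicator {0} (det (M J x)) :: ennreal) \<in> borel_measurable (Pi\<^sub>M (e ` J) (\<lambda>_. \<rho>))" for J
  proof -
    have [measurable]: "(\<lambda>x. if j \<in> J then x (e j) - c else axis j 1) \<in> borel_measurable (Pi\<^sub>M (e ` J) (\<lambda>_. \<rho>))" for j
      using coord[of "e j" "e ` J"] by (cases "j \<in> J") simp_all
    have [measurable]: "(\<lambda>x. det (M J x)) \<in> borel_measurable (Pi\<^sub>M (e ` J) (\<lambda>_. \<rho>))"
      unfolding M_def by measurable
    show ?thesis by measurable
  qed
  have "(\<integral>\<^sup>+x. indicator {0} (det (M (insert i J) x)) \<partial>Pi\<^sub>M (insert (e i) ?I) (\<lambda>_. \<rho>))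
      = (\<integral>\<^sup>+x. \<integral>\<^sup>+y. indicator {0} (det (M (insert i J) (x(e i := y)))) \<partial>\<rho> \<partial>Pi\<^sub>M ?I (\<lambda>_. \<rho>))"
    by (rule \<rho>.product_nn_integral_insert) (use ei mM[of "insert i J"] in simp_all)
  also have "\<dots> \<le> (\<integral>\<^sup>+x. indicator {0} (det (M J x)) \<partial>Pi\<^sub>M ?I (\<lambda>_. \<rho>))"
  proof (rule nn_integral_mono)
    fix x
    show "(\<integral>\<^sup>+y. indicator {0} (det (M (insert i J) (x(e i := y)))) \<partial>\<rho>) \<le> indicator {0} (det (M J x) :: real)"
    proof (cases "det (M J x) = 0")
      case True
      have "(\<integral>\<^sup>+y. indicator {0} (det (M (insert i J) (x(e i := y)))) \<partial>\<rho>) \<le> (\<integral>\<^sup>+y. 1 \<partial>\<rho>)"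
        by (intro nn_integral_mono) (simp add: indicator_def)
      then show ?thesis using True prob_space.emeasure_space_1[OF \<rho>(1)] by simp
    next
      case False
      define R where "R = (\<lambda>j. if j \<in> J then x (e j) - c else axis j 1)"
      define B where "B = {y. det (\<chi> j. if j = i then y - c else R j) = 0}"
      have "M J x = (\<chi> j. if j = i then axis i 1 else R j)"
        using insert.hyps by (auto simp: M_def R_def vec_eq_iff)
      then have "B \<in> null_sets lborel" unfolding B_def using False by (intro null_set_det_row) simp
      then have "B \<in> null_sets \<rho>" using \<rho>(3) by (auto simp: absolutely_continuous_def)
      moreover have "M (insert i J) (x(e i := y)) = (\<chi> j. if j = i then y - c else R j)" for y
        using insert.hyps ne by (auto simp: M_def R_def vec_eq_iff)
      then have "(\<integral>\<^sup>+y. indicator {0} (det (M (insert i J) (x(e i := y)))) \<partial>\<rho>) = (\<integral>\<^sup>+y. indicator B y \<partial>\<rho>)"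
        by (intro nn_integral_cong) (simp add: B_def indicator_def)
      ultimately show ?thesis by (simp add: null_setsD1 null_setsD2)
    qed
  qed
  also have "\<dots> = 0" using insert.IH insert.prems by (simp add: M_def)
  finally show ?case by (simp add: M_def)
qed

text \<open>The differences of \<open>k\<close> observations to one base observation suffice; this is where \<open>n > k\<close> is
  needed.\<close>

lemma AE_pos_def_S_d:
  fixes X :: "int \<Rightarrow> 'w \<Rightarrow> real^'k"
  assumes n: "CARD('k) < n" and P: "prob_space P"
    and indep: "prob_space.indep_vars P (\<lambda>_. borel) X (window t n)"
    and law: "\<And>i. i \<in> window t n \<Longrightarrow> distributed P lborel (X i) f"
  shows "AE \<omega> in P. pos_def (S_d t n (\<lambda>i. X i \<omega>))"
proof -
  interpret prob_space P by (rule P)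
  have n1: "n \<noteq> 1" "0 < n" using n zero_less_card_finite[where 'a='k] by linarith+
  define i0 where "i0 = t"
  have i0: "i0 \<in> window t n" using n1 by (simp add: window_def i0_def)
  have "card (window t n - {i0}) = n - 1" using i0 by (simp add: card_Diff_singleton)
  then have "card (UNIV :: 'k set) \<le> card (window t n - {i0})" using n by linarith
  then obtain e :: "'k \<Rightarrow> int" where e: "inj e" "range e \<subseteq> window t n - {i0}"
    using card_le_inj[of "UNIV :: 'k set" "window t n - {i0}"] by auto
  define I where "I = insert i0 (range e)"
  have I: "I \<subseteq> window t n" "I \<noteq> {}" "finite (range e)" "i0 \<notin> range e" "i0 \<in> I" "\<And>j. e j \<in> I"
    using e i0 by (auto simp: I_def)
  define \<rho> where "\<rho> = density lborel f"
  have rv: "X i \<in> borel_measurable P" if "i \<in> I" for i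
    using distributed_measurable[OF law, of i] that I(1) by auto
  have f: "f \<in> borel_measurable lborel" using distributed_borel_measurable[OF law[OF i0]] .
  have X\<rho>: "distr P borel (X i) = \<rho>" if "i \<in> I" for i
  proof -
    have "distr P borel (X i) = distr P lborel (X i)" by (rule distr_cong) simp_all
    then show ?thesis using distributed_distr_eq_density[OF law, of i] that I(1) by (auto simp: \<rho>_def)
  qed
  have \<rho>: "prob_space \<rho>" "sets \<rho> = sets borel" "absolutely_continuous lborel \<rho>"
    using prob_space_distr[OF rv[OF I(5)]] X\<rho>[OF I(5)] absolutely_continuousI_density[OF f]
    by (simp_all add: \<rho>_def)
  note sets_\<rho> [measurable_cong] = \<rho>(2)
  interpret \<rho>: product_sigma_finite "\<lambda>_ :: int. \<rho>"
    by (rule product_sigma_finite.intro) (rule prob_space_imp_sigma_finite[OF \<rho>(1)])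
  have joint: "distr P (Pi\<^sub>M I (\<lambda>_. borel)) (\<lambda>\<omega>. \<lambda>i\<in>I. X i \<omega>) = Pi\<^sub>M I (\<lambda>_. \<rho>)"
  proof -
    have "indep_vars (\<lambda>_. borel) X I" by (rule indep_vars_subset[OF indep I(1)])
    then have "distr P (Pi\<^sub>M I (\<lambda>_. borel)) (\<lambda>\<omega>. \<lambda>i\<in>I. X i \<omega>) = Pi\<^sub>M I (\<lambda>i. distr P borel (X i))"
      using indep_vars_iff_distr_eq_PiM'[OF I(2), of X "\<lambda>_. borel"] rv by simp
    also have "\<dots> = Pi\<^sub>M I (\<lambda>_. \<rho>)" by (rule PiM_cong) (simp_all add: X\<rho>)
    finally show ?thesis .
  qed
  define A :: "(int \<Rightarrow> real^'k) \<Rightarrow> real^'k^'k" where "A x = (\<chi> j. x (e j) - x i0)" for x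
  have mA: "(\<lambda>x. det (A x)) \<in> borel_measurable (Pi\<^sub>M I (\<lambda>_. borel))"
  proof -
    have [measurable]: "(\<lambda>x. x (e j) - x i0) \<in> borel_measurable (Pi\<^sub>M I (\<lambda>_. borel :: (real^'k) measure))" for j
      using I(5,6) by (intro borel_measurable_diff measurable_component_singleton)
    show ?thesis unfolding A_def by measurable
  qed
  have sets_eq: "sets (Pi\<^sub>M I (\<lambda>_. \<rho>)) = sets (Pi\<^sub>M I (\<lambda>_. borel))"
    by (rule sets_PiM_cong) (simp_all add: \<rho>(2))
  have m\<rho>: "(\<lambda>x. indicator {0} (det (A x)) :: ennreal) \<in> borel_measurable (Pi\<^sub>M I (\<lambda>_. \<rho>))"
  proof -
    have "(\<lambda>x. det (A x)) \<in> borel_measurable (Pi\<^sub>M I (\<lambda>_. \<rho>))"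
      using mA measurable_cong_sets[OF sets_eq refl] by blast
    then show ?thesis by measurable
  qed
  have "(\<integral>\<^sup>+x. indicator {0} (det (A x)) \<partial>Pi\<^sub>M I (\<lambda>_. \<rho>))
      = (\<integral>\<^sup>+c. \<integral>\<^sup>+x. indicator {0} (det (A (x(i0 := c)))) \<partial>Pi\<^sub>M (range e) (\<lambda>_. \<rho>) \<partial>\<rho>)"
    unfolding I_def
    by (rule \<rho>.product_nn_integral_insert_rev) (use I(3,4) m\<rho> in \<open>simp_all add: I_def\<close>)
  also have "\<dots> = (\<integral>\<^sup>+c. 0 \<partial>\<rho>)"
  proof (rule nn_integral_cong)
    fix c :: "real^'k"
    have "e j \<noteq> i0" for j using I(4) by auto
    then have "A (x(i0 := c)) = (\<chi> j. if j \<in> UNIV then x (e j) - c else axis j 1)" for x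
      by (simp add: A_def)
    then show "(\<integral>\<^sup>+x. indicator {0} (det (A (x(i0 := c)))) \<partial>Pi\<^sub>M (range e) (\<lambda>_. \<rho>)) = 0"
      using nn_integral_det_rows_zero[OF \<rho> e(1), of c] by simp
  qed
  finally have "AE x in Pi\<^sub>M I (\<lambda>_. \<rho>). det (A x) \<noteq> 0"
    using nn_integral_0_iff_AE[OF m\<rho>] by (simp add: indicator_eq_0_iff)
  then have "AE x in distr P (Pi\<^sub>M I (\<lambda>_. borel)) (\<lambda>\<omega>. \<lambda>i\<in>I. X i \<omega>). det (A x) \<noteq> 0"
    unfolding joint .
  moreover have "(\<lambda>\<omega>. \<lambda>i\<in>I. X i \<omega>) \<in> P \<rightarrow>\<^sub>M Pi\<^sub>M I (\<lambda>_. borel)"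
    using rv by (intro measurable_restrict)
  ultimately have "AE \<omega> in P. det (A (\<lambda>i\<in>I. X i \<omega>)) \<noteq> 0" by (rule AE_distrD[rotated])
  moreover have "A (\<lambda>i\<in>I. X i \<omega>) = (\<chi> j. X (e j) \<omega> - X i0 \<omega>)" for \<omega>
    using I(5,6) by (simp add: A_def)
  ultimately have "AE \<omega> in P. det (\<chi> j. X (e j) \<omega> - X i0 \<omega>) \<noteq> 0" by simp
  then show ?thesis
  proof (rule AE_mp, intro AE_I2 impI)
    fix \<omega> assume "det (\<chi> j. X (e j) \<omega> - X i0 \<omega>) \<noteq> 0"
    then show "pos_def (S_d t n (\<lambda>i. X i \<omega>))"
      using pos_def_S_d_if_det[OF n1(1) i0, of e "\<lambda>i. X i \<omega>"] e(2) by blast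
  qed
qed


section \<open>The predictive distribution of the wealth\<close>

theorem theorem6:
  fixes P :: "real^'k \<Rightarrow> real^'k^'k \<Rightarrow> 'w measure"
    and X :: "int \<Rightarrow> 'w \<Rightarrow> real^'k"
    and Wnext :: "'w \<Rightarrow> real"
    and t :: int and n :: nat and W rf :: real and v :: "real^'k"
    and m0 :: "real^'k" and r0 d0 :: real and S0 :: "real^'k^'k"
  assumes n: "n > CARD('k)"
    and prob: "\<And>\<mu> \<Sigma>. pos_def \<Sigma> \<Longrightarrow> prob_space (P \<mu> \<Sigma>)"
    and indep: "\<And>\<mu> \<Sigma>. pos_def \<Sigma> \<Longrightarrow>
      prob_space.indep_vars (P \<mu> \<Sigma>) (\<lambda>_. borel) X (insert (t + 1) (window t n))"
    and normal: "\<And>\<mu> \<Sigma> i. pos_def \<Sigma> \<Longrightarrow> i \<in> insert (t + 1) (window t n) \<Longrightarrow>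
      distributed (P \<mu> \<Sigma>) lborel (X i) (\<lambda>y. ennreal (mvn_density \<mu> \<Sigma> y))"
    and wealth: "\<And>\<omega>. Wnext \<omega> = W * (1 + rf + v \<bullet> (X (t + 1) \<omega> - rf *\<^sub>R vec 1))"
    and hyper: "r0 > 0" "d0 > 2 * real CARD('k)" "pos_def S0"
  shows
    "(\<forall>\<mu> \<Sigma>. pos_def \<Sigma> \<longrightarrow> (AE \<omega> in P \<mu> \<Sigma>. pos_def (S_d t n (\<lambda>i. X i \<omega>))))
   \<and> (\<forall>x. pos_def (S_d t n x) \<longrightarrow>
       (\<forall>(Q :: 'q measure) t1 t2.
          indep_student_t Q (real n - real CARD('k)) t1 (real n - real CARD('k) + 1) t2 \<longrightarrow>
          posterior_predictive diffuse_prior t n x P Wnext =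
          distr Q borel (\<lambda>q. W * (1 + rf + v \<bullet> (mean_d t n x - rf *\<^sub>R vec 1)
            + sqrt (v \<bullet> (S_d t n x *v v)) *
              (t1 q / sqrt (real n * (real n - real CARD('k)))
               + sqrt (1 + (t1 q)\<^sup>2 / (real n - real CARD('k)))
                 * (t2 q / sqrt (real n - real CARD('k) + 1)))))))
   \<and> (\<forall>x (Q :: 'q measure) t1 t2.
          indep_student_t Q (real n + d0 - 2 * real CARD('k)) t1
                            (real n + d0 - 2 * real CARD('k) + 1) t2 \<longrightarrow>
          posterior_predictive (conjugate_prior m0 r0 d0 S0) t n x P Wnext =
          distr Q borel (\<lambda>q. W * (1 + rf + v \<bullet> (mean_c m0 r0 t n x - rf *\<^sub>R vec 1)
            + sqrt (v \<bullet> (S_c m0 r0 S0 t n x *v v)) *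
              (t1 q / sqrt ((real n + r0) * (real n + d0 - 2 * real CARD('k)))
               + sqrt (1 + (t1 q)\<^sup>2 / (real n + d0 - 2 * real CARD('k)))
                 * (t2 q / sqrt (real n + d0 - 2 * real CARD('k) + 1))))))"
proof (intro conjI allI impI)
  let ?k = "real CARD('k)"
  have n1: "n \<noteq> 1" using n zero_less_card_finite[where 'a='k] by linarith
  define g where "g z = W * (1 + rf + (z - rf * (v \<bullet> vec 1)))" for z
  have g: "g \<in> borel_measurable borel" unfolding g_def by measurable
  have Wnext: "Wnext = (\<lambda>\<omega>. g (v \<bullet> X (t + 1) \<omega>))"
    by (rule ext) (simp add: wealth g_def inner_diff_right)
  have gm: "W * (1 + rf + v \<bullet> (m - rf *\<^sub>R vec 1) + z) = g (v \<bullet> m + z)" for m z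
    by (simp add: g_def inner_diff_right)
  have norm: "distributed (P \<mu> \<Sigma>) lborel (X (t + 1)) (\<lambda>y. ennreal (mvn_density \<mu> \<Sigma> y))"
    if "pos_def \<Sigma>" for \<mu> \<Sigma>
    using normal[OF that] by simp
  {
    fix \<mu> :: "real^'k" and \<Sigma> :: "real^'k^'k" assume \<Sigma>: "pos_def \<Sigma>"
    interpret prob_space "P \<mu> \<Sigma>" by (rule prob[OF \<Sigma>])
    show "AE \<omega> in P \<mu> \<Sigma>. pos_def (S_d t n (\<lambda>i. X i \<omega>))"
    proof (rule AE_pos_def_S_d[OF n])
      show "indep_vars (\<lambda>_. borel) X (window t n)"
        by (rule indep_vars_subset[OF indep[OF \<Sigma>]]) blast
    qed (use normal[OF \<Sigma>] prob[OF \<Sigma>] in auto)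
  next
    fix x :: "int \<Rightarrow> real^'k" and Q :: "'q measure" and t1 t2
    assume S: "pos_def (S_d t n x)"
      and st: "indep_student_t Q (real n - ?k) t1 (real n - ?k + 1) t2"
    obtain C where C: "0 < C" "\<And>\<mu> \<Sigma>. pos_def \<Sigma> \<Longrightarrow> likelihood t n x \<mu> \<Sigma> * diffuse_prior \<mu> \<Sigma> =
        C * (mvn_density (mean_d t n x) ((1 / real n) *\<^sub>R \<Sigma>) \<mu> * iw_kernel (real n + ?k) (S_d t n x) \<Sigma>)"
      using diffuse_posterior_kernel[OF n] by blast
    have \<nu>: "real n + ?k - 2 * ?k = real n - ?k" by simp
    have "2 * ?k < real n + ?k" "0 < real n" using n by simp_all
    note posterior_predictive_niw[OF S this C norm g, unfolded \<nu>, OF _ _ st, where v = v]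
    then show "posterior_predictive diffuse_prior t n x P Wnext =
      distr Q borel (\<lambda>q. W * (1 + rf + v \<bullet> (mean_d t n x - rf *\<^sub>R vec 1)
        + sqrt (v \<bullet> (S_d t n x *v v)) *
          (t1 q / sqrt (real n * (real n - ?k))
           + sqrt (1 + (t1 q)\<^sup>2 / (real n - ?k)) * (t2 q / sqrt (real n - ?k + 1)))))"
      unfolding Wnext gm by blast
  next
    fix x :: "int \<Rightarrow> real^'k" and Q :: "'q measure" and t1 t2
    assume st: "indep_student_t Q (real n + d0 - 2 * ?k) t1 (real n + d0 - 2 * ?k + 1) t2"
    obtain C where C: "0 < C" "\<And>\<mu> \<Sigma>. pos_def \<Sigma> \<Longrightarrow>
        likelihood t n x \<mu> \<Sigma> * conjugate_prior m0 r0 d0 S0 \<mu> \<Sigma> =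
        C * (mvn_density (mean_c m0 r0 t n x) ((1 / (real n + r0)) *\<^sub>R \<Sigma>) \<mu> *
          iw_kernel (real n + d0) (S_c m0 r0 S0 t n x) \<Sigma>)"
      using conjugate_posterior_kernel[OF n hyper] by blast
    have S: "pos_def (S_c m0 r0 S0 t n x)" by (rule pos_def_S_c[OF n1 hyper(1,3)])
    have "2 * ?k < real n + d0" "0 < real n + r0" using hyper by simp_all
    note posterior_predictive_niw[OF S this C norm g st, where v = v]
    then show "posterior_predictive (conjugate_prior m0 r0 d0 S0) t n x P Wnext =
      distr Q borel (\<lambda>q. W * (1 + rf + v \<bullet> (mean_c m0 r0 t n x - rf *\<^sub>R vec 1)
        + sqrt (v \<bullet> (S_c m0 r0 S0 t n x *v v)) *
          (t1 q / sqrt ((real n + r0) * (real n + d0 - 2 * ?k))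
           + sqrt (1 + (t1 q)\<^sup>2 / (real n + d0 - 2 * ?k)) * (t2 q / sqrt (real n + d0 - 2 * ?k + 1)))))"
      unfolding Wnext gm by blast
  }
qed

end
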